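(* For each $\beta\ge 0$ and $n\ge1$ let $\mu=\mu_{\beta,n}$ be the Sherrington--Kirkpatrick Gibbs measure on $\{-1,+1\}^n$ at inverse temperature $\beta$ with no external field, and let $\mathrm{cov}(\mu)$ be its covariance matrix. Then: (1) For every $0\le\beta<1$, $\displaystyle\liminf_{n\to\infty}\mathbb{E}\,\|\mathrm{cov}(\mu)\|_{\mathrm{op}} \ge \frac{1}{1-\beta^2}$. (2) There exists an absolute constant $c>0$ such that for $\beta=1$ and all $n\ge 2$, $\displaystyle\mathbb{E}\,\|\mathrm{cov}(\mu)\|_{\mathrm{op}} \ge c\,\Big(\frac{n}{\log n}\Big)^{3/16}$. (3) For every $\beta>1$ there exists $c(\beta)>0$ such that $\mathbb{E}\,\|\mathrm{cov}(\mu)\|_{\mathrm{op}} \ge c(\beta)\,n$ for all $n\ge 1$.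
   Context: Let $(g_{ij})_{1\le i<j\le n}$ be i.i.d. standard Gaussian $N(0,1)$ random variables (the disorder), and let $\beta \ge 0$. The Sherrington--Kirkpatrick Gibbs measure (no external field) is the random probability measure on $\{-1,+1\}^n$ $$\mu(\sigma) = \frac{1}{Z}\exp\Big\{\frac{\beta}{\sqrt{n}}\sum_{i<j} g_{ij}\sigma_i\sigma_j\Big\},\qquad \sigma\in\{-1,+1\}^n,$$ with $Z$ the normalizing constant. The bracket $\langle\cdot\rangle$ denotes the average with respect to $\mu$ (for fixed disorder). The covariance matrix is the $n\times n$ random matrix $\mathrm{cov}(\mu)$ with entries $(\mathrm{cov}(\mu))_{ij} = \langle \sigma_i\sigma_j\rangle$ for $i,j\in\{1,\dots,n\}$ (the mean of $\mu$ is zero by symmetry). $\|\cdot\|_{\mathrm{op}}$ is the operator (spectral) norm, and $\mathbb{E}$ is the expectation over the disorder $(g_{ij})$. *)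

theory Defs
  imports "HOL-Probability.Probability"
begin

definition pairs :: "nat \<Rightarrow> (nat \<times> nat) set" where
  "pairs n = {(i, j). 1 \<le> i \<and> i < j \<and> j \<le> n}"

(* The joint law of the i.i.d. N(0,1) disorder; a point g of this space is one
   realisation of the disorder, with g (i, j) playing the role of g_ij. *)
definition disorder :: "nat \<Rightarrow> (nat \<times> nat \<Rightarrow> real) measure" where
  "disorder n = (\<Pi>\<^sub>M p\<in>pairs n. density lborel std_normal_density)"

definition spins :: "nat \<Rightarrow> (nat \<Rightarrow> real) set" where
  "spins n = {1..n} \<rightarrow>\<^sub>E {-1, 1}"

definition boltzmann :: "nat \<Rightarrow> real \<Rightarrow> (nat \<times> nat \<Rightarrow> real) \<Rightarrow> (nat \<Rightarrow> real) \<Rightarrow> real" where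
  "boltzmann n \<beta> g \<sigma> = exp (\<beta> / sqrt (real n) * (\<Sum>(i, j)\<in>pairs n. g (i, j) * \<sigma> i * \<sigma> j))"

definition partition_fun :: "nat \<Rightarrow> real \<Rightarrow> (nat \<times> nat \<Rightarrow> real) \<Rightarrow> real" where
  "partition_fun n \<beta> g = (\<Sum>\<sigma>\<in>spins n. boltzmann n \<beta> g \<sigma>)"

definition gibbs :: "nat \<Rightarrow> real \<Rightarrow> (nat \<times> nat \<Rightarrow> real) \<Rightarrow> (nat \<Rightarrow> real) \<Rightarrow> real" where
  "gibbs n \<beta> g \<sigma> = boltzmann n \<beta> g \<sigma> / partition_fun n \<beta> g"

definition bracket ::
  "nat \<Rightarrow> real \<Rightarrow> (nat \<times> nat \<Rightarrow> real) \<Rightarrow> ((nat \<Rightarrow> real) \<Rightarrow> real) \<Rightarrow> real" where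
  "bracket n \<beta> g f = (\<Sum>\<sigma>\<in>spins n. f \<sigma> * gibbs n \<beta> g \<sigma>)"

(* No centering term: the Gibbs measure is invariant under the global spin flip,
   so its mean vanishes. *)
definition cov :: "nat \<Rightarrow> real \<Rightarrow> (nat \<times> nat \<Rightarrow> real) \<Rightarrow> nat \<Rightarrow> nat \<Rightarrow> real" where
  "cov n \<beta> g i j = bracket n \<beta> g (\<lambda>\<sigma>. \<sigma> i * \<sigma> j)"

(* The counterpart of onorm for the Euclidean norm on R^n, with n an ordinary
   natural number instead of a type: vectors are functions whose coordinates
   1, ..., n are the only relevant ones. As for onorm, a vector with vanishing
   norm contributes 0 / 0 = 0. *)
definition op_norm :: "nat \<Rightarrow> (nat \<Rightarrow> nat \<Rightarrow> real) \<Rightarrow> real" where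
  "op_norm n A =
     (SUP x. L2_set (\<lambda>i. \<Sum>j=1..n. A i j * x j) {1..n} / L2_set x {1..n})"

end

theory Submission
  imports Defs "HOL-Real_Asymp.Real_Asymp" "Jordan_Normal_Form.Determinant"
begin

text \<open>
  The covariance matrix \<open>M\<close> is positive semidefinite with trace \<open>n\<close>, so its operator norm is at
  least \<open>\<parallel>M\<parallel>\<^sub>F\<^sup>2 / n\<close>. It therefore suffices to bound \<open>n \<nu>\<close> from below, where \<open>\<nu>\<close> is the expectation of
  \<open>\<parallel>M\<parallel>\<^sub>F\<^sup>2 / n\<^sup>2\<close>, the mean squared overlap.

  The matrix \<open>M\<close> is tested against the resolvent \<open>Q = (z - A)\<^sup>-\<^sup>1\<close> of the coupling matrix \<open>A\<close> with entries
  \<open>g\<^sub>i\<^sub>j / \<surd>n\<close>, at \<open>z = \<beta> + 1/\<beta> + \<i> \<eta>\<close>. Gaussian integration by parts shows that \<open>w = E (tr Q) / n\<close> nearly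
  solves \<open>w\<^sup>2 - z w + 1 = 0\<close>, with \<open>tr Q / n\<close> concentrated at \<open>w\<close>, and that \<open>S = tr (Q M) / n\<close> satisfies
  \<open>E S (z - w - \<beta>) = 1\<close> up to \<open>5 / (n \<eta>\<^sup>2) + \<beta> \<nu> / \<eta>\<close>. The sign of \<open>Im w\<close> selects the root near
  \<open>min \<beta> (1/\<beta>)\<close>. Either \<open>\<nu>\<close> is large enough to spoil this equation, and nothing is left to prove,
  or \<open>E S\<close> is known.

  For \<open>\<beta> \<le> 1\<close> the Cauchy-Schwarz inequality gives \<open>|E S|\<^sup>2 \<le> n \<nu> |Im w| / \<eta>\<close>. If \<open>\<beta> < 1\<close>, letting \<open>\<eta>\<close> tend to
  0 yields \<open>1 / (1 - \<beta>\<^sup>2)\<close>. If \<open>\<beta> = 1\<close>, both \<open>|Im w|\<close> and \<open>|z - w - 1|\<close> are of order \<open>\<surd>\<eta>\<close>, so \<open>n \<nu>\<close> is at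
  least of order \<open>1 / \<surd>\<eta>\<close>.

  For \<open>\<beta> > 1\<close> the factor \<open>z - w - \<beta>\<close> is of order \<open>\<eta>\<close>, so that \<open>|E S|\<close> would be of order \<open>1 / \<eta>\<close>. But
  \<open>Re z = \<beta> + 1/\<beta> > 2\<close>, whereas the largest eigenvalue of \<open>A\<close> is at most \<open>2 + \<delta>\<close> with high probability, which
  keeps \<open>S\<close> bounded. The eigenvalue bound is a Gaussian comparison of \<open>x \<mapsto> x\<^sup>T A x\<close> with
  \<open>x \<mapsto> 2 h \<bullet> x / \<surd>n\<close> on unit vectors.
\<close>

subsection \<open>Gaussian integration by parts\<close>

text \<open>The point \<open>\<beta> + 1/\<beta>\<close> comes from the high-temperature heuristic
  that \<open>M\<close> is close to the inverse of \<open>1 + \<beta>\<^sup>2 - \<beta> A\<close>,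
  which is \<open>Q / \<beta>\<close> at \<open>\<eta> = 0\<close>. Proportional \<open>M\<close>
  and \<open>Q\<close> are the equality case of the Cauchy-Schwarz step, so the sharp constant can
  survive. At the same point the quadratic equation has for \<open>\<eta> = 0\<close> the roots
  \<open>\<beta>\<close> and \<open>1/\<beta>\<close>, so a bound \<open>|w| \<le> 1\<close>
  suffices to select the root. Differentiating a Gibbs average usually produces higher correlations.
  In \<open>tr (A Q M)\<close> each coupling \<open>g\<^sub>i\<^sub>j\<close> meets an entry of
  \<open>M\<close> with index \<open>i\<close>, the repeated spin squares to 1, and the equation
  closes up to \<open>tr (Q M\<^sup>2) / n\<^sup>2\<close>. That term is controlled only by
  \<open>\<nu> / \<eta>\<close>, whence the alternative in \<nu>. The other errors must stay of
  order \<open>1 / (n \<eta>\<^sup>2)\<close> while \<eta> tends to 0. As \<open>S\<close> is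
  bounded only by \<open>1 / \<eta>\<close>, the fluctuations of \<open>tr Q / n\<close> have to be
  of order \<open>1 / (n \<eta>)\<close>; the easy bound \<open>1 / (n \<eta>\<^sup>2)\<close> would
  be too weak at \<beta> = 1.\<close>

abbreviation std_gauss :: "real measure" where
  "std_gauss \<equiv> density lborel std_normal_density"

lemma std_normal_density_exp:
  "std_normal_density t * exp (c * t) = exp (c\<^sup>2 / 2) * normal_density c 1 t"
proof -
  have "- (t\<^sup>2 / 2) + c * t = c\<^sup>2 / 2 + - ((t - c)\<^sup>2 / 2)"
    by (simp add: power2_eq_square field_simps)
  then show ?thesis
    by (simp add: normal_density_def flip: exp_add)
qed

lemma integrable_std_normal_density_exp_abs:
  "integrable lborel (\<lambda>t. std_normal_density t * exp (c * \<bar>t\<bar>))"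
proof -
  have 1: "integrable lborel (\<lambda>t. std_normal_density t * exp (d * t))" for d
    unfolding std_normal_density_exp by (auto intro: integrable_normal_density)
  have "integrable lborel (\<lambda>t. std_normal_density t * exp (c * t) + std_normal_density t * exp ((-c) * t))"
    by (intro Bochner_Integration.integrable_add 1)
  then show ?thesis
  proof (rule Bochner_Integration.integrable_bound)
    have "\<bar>std_normal_density t * exp (c * \<bar>t\<bar>)\<bar>
        \<le> std_normal_density t * exp (c * t) + std_normal_density t * exp ((-c) * t)" for t
      by (cases "t \<ge> 0") (simp_all add: abs_mult)
    then show "AE t in lborel. norm (std_normal_density t * exp (c * \<bar>t\<bar>))
        \<le> norm (std_normal_density t * exp (c * t) + std_normal_density t * exp ((-c) * t))"
      by (intro AE_I2) (smt (verit, best) real_norm_def)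
  qed simp
qed

lemma std_normal_density_has_deriv:
  "(std_normal_density has_vector_derivative - t * std_normal_density t) (at t within S)"
proof -
  have "(std_normal_density has_real_derivative - t * std_normal_density t) (at t within S)"
    unfolding std_normal_density_def
    by (auto intro!: derivative_eq_intros simp: field_simps)
  then show ?thesis
    using has_real_derivative_iff_has_vector_derivative by blast
qed

lemma abs_le_exp_abs: "\<bar>t::real\<bar> \<le> exp \<bar>t\<bar>"
  using exp_ge_add_one_self[of "\<bar>t\<bar>"] by linarith

text \<open>The fundamental theorem of calculus on \<open>[-k, k]\<close>, with \<open>k\<close>
  sent to infinity by dominated convergence. Limits along the integers are enough for this.\<close>

lemma integral_lborel_derivative_eq_0:
  fixes h h' :: "real \<Rightarrow> 'b::euclidean_space"
  assumes d: "\<And>t. (h has_vector_derivative h' t) (at t)"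
    and i: "integrable lborel h'"
    and l: "(\<lambda>k. h (real k)) \<longlonglongrightarrow> 0" "(\<lambda>k. h (- real k)) \<longlonglongrightarrow> 0"
  shows "(LINT t|lborel. h' t) = 0"
proof -
  have eq: "(LINT t|lborel. indicator {- real k..real k} t *\<^sub>R h' t) = h (real k) - h (- real k)" for k
  proof -
    have si: "set_integrable lborel {- real k..real k} h'"
      unfolding set_integrable_def by (rule integrable_mult_indicator) (auto simp: i)
    have "(h' has_integral h (real k) - h (- real k)) {- real k..real k}"
      by (rule fundamental_theorem_of_calculus) (auto intro: has_vector_derivative_at_within d)
    with set_borel_integral_eq_integral(2)[OF si] show ?thesis
      by (simp add: integral_unique set_lebesgue_integral_def)
  qed
  have "(\<lambda>k. LINT t|lborel. indicator {- real k..real k} t *\<^sub>R h' t) \<longlonglongrightarrow> (LINT t|lborel. h' t)"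
  proof (rule integral_dominated_convergence[where w = "\<lambda>t. norm (h' t)"])
    show "AE t in lborel. (\<lambda>k. indicator {- real k..real k} t *\<^sub>R h' t) \<longlonglongrightarrow> h' t"
    proof (rule AE_I2)
      fix t :: real
      obtain N where N: "\<bar>t\<bar> \<le> real N" using real_arch_simple by blast
      have "eventually (\<lambda>k. indicator {- real k..real k} t *\<^sub>R h' t = h' t) sequentially"
        using eventually_ge_at_top[of N] by eventually_elim (use N in \<open>auto simp: indicator_def\<close>)
      then show "(\<lambda>k. indicator {- real k..real k} t *\<^sub>R h' t) \<longlonglongrightarrow> h' t"
        by (rule tendsto_eventually)
    qed
  qed (use i in \<open>auto simp: indicator_def intro!: AE_I2 borel_measurable_scaleR\<close>)
  moreover have "(\<lambda>k. h (real k) - h (- real k)) \<longlonglongrightarrow> 0"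
    using tendsto_diff[OF l] by simp
  ultimately show ?thesis
    unfolding eq using LIMSEQ_unique by blast
qed

text \<open>The derivative of density times \<open>f\<close> is density times
  \<open>f' t - t f t\<close>, and its integral over the line vanishes because the Gaussian beats
  every exponential. The growth class covers bounded functions (\<open>c = 0\<close>) as well as the
  partition functions of the comparison argument.\<close>

lemma gauss_ibp_1:
  fixes f f' :: "real \<Rightarrow> 'b::euclidean_space"
  assumes d: "\<And>t. (f has_vector_derivative f' t) (at t)"
    and m: "f' \<in> borel_measurable borel"
    and bf: "\<And>t. norm (f t) \<le> C * exp (c * \<bar>t\<bar>)" and bf': "\<And>t. norm (f' t) \<le> C * exp (c * \<bar>t\<bar>)"
  shows "(LINT t|std_gauss. t *\<^sub>R f t) = (LINT t|std_gauss. f' t)"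
proof -
  have C: "C \<ge> 0"
    using order_trans[OF norm_ge_zero bf[of 0]] by simp
  have cf: "continuous_on UNIV f"
    using d has_vector_derivative_continuous continuous_at_imp_continuous_on by blast
  have mf [measurable]: "f \<in> borel_measurable borel"
    by (rule borel_measurable_continuous_onI[OF cf])
  note m [measurable]
  let ?p = std_normal_density
  have bound: "integrable lborel (\<lambda>t. ?p t *\<^sub>R k t)"
    if [measurable]: "k \<in> borel_measurable borel" and b: "\<And>t. norm (k t) \<le> C * exp (c' * \<bar>t\<bar>)"
    for k :: "real \<Rightarrow> 'b" and c'
  proof (rule Bochner_Integration.integrable_bound)
    show "integrable lborel (\<lambda>t. C * (?p t * exp (c' * \<bar>t\<bar>)))"
      by (intro integrable_mult_right integrable_std_normal_density_exp_abs)
    show "AE t in lborel. norm (?p t *\<^sub>R k t) \<le> norm (C * (?p t * exp (c' * \<bar>t\<bar>)))"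
    proof (rule AE_I2)
      fix t
      have "?p t * norm (k t) \<le> ?p t * (C * exp (c' * \<bar>t\<bar>))"
        by (intro mult_left_mono b) auto
      then show "norm (?p t *\<^sub>R k t) \<le> norm (C * (?p t * exp (c' * \<bar>t\<bar>)))"
        using C by (simp add: abs_mult mult.left_commute)
    qed
  qed auto
  have b1: "norm (t *\<^sub>R f t) \<le> C * exp ((c + 1) * \<bar>t\<bar>)" for t
  proof -
    have "\<bar>t\<bar> * norm (f t) \<le> exp \<bar>t\<bar> * (C * exp (c * \<bar>t\<bar>))"
      by (intro mult_mono abs_le_exp_abs bf) auto
    also have "\<dots> = C * exp ((c + 1) * \<bar>t\<bar>)"
      by (simp add: algebra_simps exp_add)
    finally show ?thesis by simp
  qed
  have i1: "integrable lborel (\<lambda>t. ?p t *\<^sub>R (t *\<^sub>R f t))" by (rule bound[OF _ b1]) simp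
  have i2: "integrable lborel (\<lambda>t. ?p t *\<^sub>R f' t)" by (rule bound[OF _ bf']) simp
  have 0: "(LINT t|lborel. (?p t *\<^sub>R f' t) - ?p t *\<^sub>R (t *\<^sub>R f t)) = 0"
  proof (rule integral_lborel_derivative_eq_0)
    show "((\<lambda>t. ?p t *\<^sub>R f t) has_vector_derivative (?p t *\<^sub>R f' t) - ?p t *\<^sub>R (t *\<^sub>R f t)) (at t)" for t
    proof -
      have "(?p has_real_derivative - t * ?p t) (at t)"
        using std_normal_density_has_deriv[of t UNIV] has_real_derivative_iff_has_vector_derivative by blast
      then have "((\<lambda>t. ?p t *\<^sub>R f t) has_vector_derivative ?p t *\<^sub>R f' t + (- t * ?p t) *\<^sub>R f t) (at t)"
        by (intro has_vector_derivative_scaleR d)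
      then show ?thesis by (simp add: mult.commute)
    qed
    show "integrable lborel (\<lambda>t. (?p t *\<^sub>R f' t) - ?p t *\<^sub>R (t *\<^sub>R f t))"
      using i1 i2 by simp
    have l: "(\<lambda>k. ?p (real k) * (C * exp (c * real k))) \<longlonglongrightarrow> 0"
    proof -
      have "(\<lambda>k. exp (- (real k)\<^sup>2 / 2) * exp (c * real k)) \<longlonglongrightarrow> 0"
        by (cases c "0::real" rule: linorder_cases) real_asymp+
      from tendsto_mult_left[OF this, of "C / sqrt (2 * pi)"] show ?thesis
        unfolding std_normal_density_def by (simp add: mult_ac)
    qed
    have e: "?p (- real k) = ?p (real k)" for k by (simp add: std_normal_density_def)
    have *: "norm (?p s *\<^sub>R f s) \<le> ?p (real k) * (C * exp (c * real k))"
      if "s = real k \<or> s = - real k" for s k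
      using bf[of s] that e[of k] by (auto intro!: mult_left_mono)
    show "(\<lambda>k. ?p (real k) *\<^sub>R f (real k)) \<longlonglongrightarrow> 0"
      by (rule Lim_null_comparison[OF _ l]) (use * in auto)
    show "(\<lambda>k. ?p (- real k) *\<^sub>R f (- real k)) \<longlonglongrightarrow> 0"
      by (rule Lim_null_comparison[OF _ l]) (use * in auto)
  qed
  have "(LINT t|lborel. ?p t *\<^sub>R f' t) = (LINT t|lborel. ?p t *\<^sub>R (t *\<^sub>R f t))"
    using 0 i1 i2 by simp
  then show ?thesis
    by (simp add: integral_density)
qed

section \<open>Finite products of standard Gaussians\<close>

abbreviation gauss_space :: "'i set \<Rightarrow> ('i \<Rightarrow> real) measure" where
  "gauss_space J \<equiv> (\<Pi>\<^sub>M j\<in>J. std_gauss)"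

lemma prob_space_std_gauss: "prob_space std_gauss"
  by (rule prob_space_normal_density) simp

lemma product_prob_space_std_gauss: "product_prob_space (\<lambda>_. std_gauss)"
  by (intro product_prob_spaceI prob_space_std_gauss)

lemma product_sigma_finite_std_gauss: "product_sigma_finite (\<lambda>_. std_gauss)"
  using product_prob_space.axioms(1) product_prob_space_std_gauss by blast

lemma prob_space_gauss_space: "prob_space (gauss_space J)"
  by (intro prob_space_PiM prob_space_std_gauss)

lemma integrable_std_gauss_exp_abs: "integrable std_gauss (\<lambda>t. exp (c * \<bar>t\<bar>))"
  using integrable_std_normal_density_exp_abs[of c]
  by (subst integrable_density) (auto simp: mult.commute)

lemma integrable_gauss_space_exp:
  assumes "finite J"
  shows "integrable (gauss_space J) (\<lambda>g. C * exp (c * (\<Sum>j\<in>J. \<bar>g j\<bar>)))"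
proof -
  interpret product_sigma_finite "\<lambda>_. std_gauss" by (rule product_sigma_finite_std_gauss)
  have "integrable (gauss_space J) (\<lambda>g. \<Prod>j\<in>J. exp (c * \<bar>g j\<bar>))"
    by (intro product_integrable_prod assms integrable_std_gauss_exp_abs)
  then show ?thesis
    using assms by (simp add: exp_sum sum_distrib_left)
qed

lemma integrable_gauss_space_bound:
  fixes f :: "('i \<Rightarrow> real) \<Rightarrow> 'b::{banach,second_countable_topology}"
  assumes "finite J" "f \<in> borel_measurable (gauss_space J)"
    and "\<And>g. norm (f g) \<le> C * exp (c * (\<Sum>j\<in>J. \<bar>g j\<bar>))"
  shows "integrable (gauss_space J) f"
  by (rule Bochner_Integration.integrable_bound[OF integrable_gauss_space_exp[of J C c]])
     (use assms in \<open>auto intro!: AE_I2 order_trans[OF assms(3)]\<close>)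

lemma gauss_ibp:
  fixes f f' :: "('i \<Rightarrow> real) \<Rightarrow> 'b::euclidean_space"
  assumes J: "finite J" "e \<in> J"
    and pd: "\<And>g. ((\<lambda>t. f (g(e := t))) has_vector_derivative f' g) (at (g e))"
    and m [measurable]: "f \<in> borel_measurable (gauss_space J)" "f' \<in> borel_measurable (gauss_space J)"
    and bf: "\<And>g. norm (f g) \<le> C * exp (c * (\<Sum>j\<in>J. \<bar>g j\<bar>))"
    and bf': "\<And>g. norm (f' g) \<le> C * exp (c * (\<Sum>j\<in>J. \<bar>g j\<bar>))"
  shows "(LINT g|gauss_space J. g e *\<^sub>R f g) = (LINT g|gauss_space J. f' g)"
proof -
  interpret product_sigma_finite "\<lambda>_. std_gauss" by (rule product_sigma_finite_std_gauss)
  have C: "C \<ge> 0"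
    using order_trans[OF norm_ge_zero bf[of "\<lambda>_. 0"]] by simp
  define J' where "J' = J - {e}"
  have J': "J = insert e J'" "e \<notin> J'" "finite J'" using J by (auto simp: J'_def)
  have me [measurable]: "(\<lambda>g. g e) \<in> borel_measurable (gauss_space J)"
    using measurable_component_singleton[OF J(2), of "\<lambda>_. std_gauss"] by simp
  have i1: "integrable (gauss_space J) (\<lambda>g. g e *\<^sub>R f g)"
  proof (rule integrable_gauss_space_bound[OF J(1)])
    fix g :: "'i \<Rightarrow> real"
    have "\<bar>g e\<bar> \<le> (\<Sum>j\<in>J. \<bar>g j\<bar>)" using J by (intro member_le_sum) auto
    then have "\<bar>g e\<bar> \<le> exp (\<Sum>j\<in>J. \<bar>g j\<bar>)"
      using exp_ge_add_one_self[of "\<Sum>j\<in>J. \<bar>g j\<bar>"] by linarith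
    then have "\<bar>g e\<bar> * norm (f g) \<le> exp (\<Sum>j\<in>J. \<bar>g j\<bar>) * (C * exp (c * (\<Sum>j\<in>J. \<bar>g j\<bar>)))"
      by (intro mult_mono bf) auto
    then show "norm (g e *\<^sub>R f g) \<le> C * exp ((c + 1) * (\<Sum>j\<in>J. \<bar>g j\<bar>))"
      by (simp add: distrib_right exp_add mult.commute mult.left_commute)
  qed measurable
  have i2: "integrable (gauss_space J) f'"
    by (rule integrable_gauss_space_bound[OF J(1) m(2) bf'])
  have "(LINT g|gauss_space J. g e *\<^sub>R f g)
      = (LINT x|gauss_space J'. LINT y|std_gauss. y *\<^sub>R f (x(e := y)))"
    using product_integral_insert[OF J'(3,2), of "\<lambda>g. g e *\<^sub>R f g"] i1 J'(1) by simp
  also have "\<dots> = (LINT x|gauss_space J'. LINT y|std_gauss. f' (x(e := y)))"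
  proof (rule Bochner_Integration.integral_cong[OF refl])
    fix x assume x: "x \<in> space (gauss_space J')"
    have upd: "(\<lambda>y. x(e := y)) \<in> std_gauss \<rightarrow>\<^sub>M gauss_space J"
      using measurable_component_update[OF x J'(2)] J'(1) by simp
    have s: "(\<Sum>j\<in>J. \<bar>(x(e := y)) j\<bar>) = \<bar>y\<bar> + (\<Sum>j\<in>J'. \<bar>x j\<bar>)" for y
      using J' by (auto intro!: sum.cong)
    show "(LINT y|std_gauss. y *\<^sub>R f (x(e := y))) = (LINT y|std_gauss. f' (x(e := y)))"
    proof (rule gauss_ibp_1)
      show "((\<lambda>y. f (x(e := y))) has_vector_derivative f' (x(e := t))) (at t)" for t
        using pd[of "x(e := t)"] by simp
      show "(\<lambda>y. f' (x(e := y))) \<in> borel_measurable borel"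
        using measurable_compose[OF upd m(2)] by simp
      show "norm (f (x(e := t))) \<le> C * exp (c * (\<Sum>j\<in>J'. \<bar>x j\<bar>)) * exp (c * \<bar>t\<bar>)" for t
        using bf[of "x(e := t)"] unfolding s by (simp add: distrib_left exp_add mult_ac)
      show "norm (f' (x(e := t))) \<le> C * exp (c * (\<Sum>j\<in>J'. \<bar>x j\<bar>)) * exp (c * \<bar>t\<bar>)" for t
        using bf'[of "x(e := t)"] unfolding s by (simp add: distrib_left exp_add mult_ac)
    qed
  qed
  also have "\<dots> = (LINT g|gauss_space J. f' g)"
    using product_integral_insert[OF J'(3,2), of f'] i2 J'(1) by simp
  finally show ?thesis .
qed

subsection \<open>Resolvents of real symmetric matrices\<close>

unbundle no vec_syntax

text \<open>Cramer's rule; indices run from 1 here, but from 0 in the matrix type.\<close>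

definition resolvent :: "nat \<Rightarrow> complex \<Rightarrow> (nat \<Rightarrow> nat \<Rightarrow> real) \<Rightarrow> nat \<Rightarrow> nat \<Rightarrow> complex" where
  "resolvent n z A i j =
     (let B = mat n n (\<lambda>(k, l). (if k = l then z else 0) - complex_of_real (A (Suc k) (Suc l)))
      in cofactor B (j - 1) (i - 1) / det B)"

lemma sum_Suc_shift: "(\<Sum>k<n. f (Suc k)) = (\<Sum>k\<in>{1..n}. f k)"
  by (rule sum.reindex_bij_witness[of _ "\<lambda>k. k - 1" Suc]) auto

lemma cmod_sum_mult_le_L2_set:
  "norm (\<Sum>i\<in>I. f i * g i :: complex) \<le> L2_set (\<lambda>i. norm (f i)) I * L2_set (\<lambda>i. norm (g i)) I"
proof -
  have "norm (\<Sum>i\<in>I. f i * g i) \<le> (\<Sum>i\<in>I. \<bar>norm (f i)\<bar> * \<bar>norm (g i)\<bar>)"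
    by (rule order_trans[OF norm_sum]) (simp add: norm_mult)
  then show ?thesis
    using L2_set_mult_ineq[of "\<lambda>i. norm (f i)" "\<lambda>i. norm (g i)" I] by linarith
qed

lemma hermitian_form_real:
  assumes "\<And>i j. (A i j :: real) = A j i"
  shows "Im (\<Sum>i\<in>I. cnj (y i) * (\<Sum>j\<in>I. of_real (A i j) * y j)) = 0"
proof -
  let ?s = "\<Sum>i\<in>I. cnj (y i) * (\<Sum>j\<in>I. of_real (A i j) * y j)"
  have "?s = (\<Sum>i\<in>I. \<Sum>j\<in>I. cnj (y i) * (of_real (A i j) * y j))"
    by (simp add: sum_distrib_left)
  also have "\<dots> = (\<Sum>j\<in>I. \<Sum>i\<in>I. cnj (y i) * (of_real (A i j) * y j))"
    by (rule sum.swap)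
  also have "\<dots> = cnj ?s"
    unfolding cnj_sum sum_distrib_left
  proof (intro sum.cong refl)
    fix i j
    show "cnj (y i) * (of_real (A i j) * y j) = cnj (cnj (y j) * (of_real (A j i) * y i))"
      by (subst assms) simp
  qed
  finally have "?s = cnj ?s" .
  then have "Im ?s = Im (cnj ?s)" by (rule arg_cong)
  then show ?thesis unfolding cnj.sel(2) by linarith
qed

lemma sum_cnj_mult_self: "(\<Sum>i\<in>I. cnj (y i) * y i) = of_real (\<Sum>i\<in>I. (norm (y i))\<^sup>2)"
  unfolding of_real_sum
  by (rule sum.cong[OF refl]) (subst complex_norm_square, rule mult.commute)

lemma resolvent_split:
  fixes w y v S :: "'a \<Rightarrow> complex"
  assumes "\<And>i. i \<in> I \<Longrightarrow> v i = z * y i - S i"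
  shows "(\<Sum>i\<in>I. w i * v i) = z * (\<Sum>i\<in>I. w i * y i) - (\<Sum>i\<in>I. w i * S i)"
proof -
  have "(\<Sum>i\<in>I. w i * v i) = (\<Sum>i\<in>I. z * (w i * y i) - w i * S i)"
    using assms by (intro sum.cong) (simp_all add: right_diff_distrib mult.left_commute)
  then show ?thesis by (simp add: sum_subtractf sum_distrib_left)
qed

lemma mult_mat_entry:
  assumes "X \<in> carrier_mat n n" "Y \<in> carrier_mat n n" "i < n" "k < n"
  shows "(X * Y) $$ (i, k) = (\<Sum>l<n. X $$ (i, l) * Y $$ (l, k))"
proof -
  have d: "dim_row X = n" "dim_col X = n" "dim_row Y = n" "dim_col Y = n"
    using assms by auto
  show ?thesis
    using assms(3,4) by (simp add: d scalar_prod_def atLeast0LessThan)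
qed

text \<open>Pairing \<open>v = (z - A) y\<close> with \<open>y\<close>: the quadratic form of
  \<open>A\<close> is real, so only \<open>Im z\<close> contributes. Invertibility, the norm bound
  \<open>1 / Im z\<close> and the Ward identity all arise from this by a choice of
  \<open>v\<close>.\<close>

lemma resolvent_energy:
  assumes sym: "\<And>i j. (A i j :: real) = A j i"
    and v: "\<And>i. i \<in> I \<Longrightarrow> v i = z * y i - (\<Sum>j\<in>I. of_real (A i j) * y j)"
  shows "Im (\<Sum>i\<in>I. cnj (y i) * v i) = Im z * (\<Sum>i\<in>I. (norm (y i))\<^sup>2)"
proof -
  define T where "T = (\<Sum>i\<in>I. cnj (y i) * (\<Sum>j\<in>I. of_real (A i j) * y j))"
  have T: "Im T = 0"
    unfolding T_def by (rule hermitian_form_real) (rule sym)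
  define s where "s = (\<Sum>i\<in>I. (norm (y i))\<^sup>2)"
  have "(\<Sum>i\<in>I. cnj (y i) * v i) = z * of_real s - T"
    unfolding T_def s_def sum_cnj_mult_self[symmetric] by (rule resolvent_split) (rule v)
  then have "Im (\<Sum>i\<in>I. cnj (y i) * v i) = Im (z * of_real s - T)"
    by (rule arg_cong)
  also have "\<dots> = Im z * s"
    using T by simp
  finally show ?thesis unfolding s_def .
qed

text \<open>The real-part counterpart, useful to the right of the spectrum: there it controls the
  resolvent uniformly in \<open>Im z\<close>.\<close>

lemma resolvent_energy_Re:
  assumes v: "\<And>i. i \<in> I \<Longrightarrow> v i = z * y i - (\<Sum>j\<in>I. of_real (A i j) * y j)"
    and form: "\<And>x :: 'a \<Rightarrow> real. (\<Sum>i\<in>I. \<Sum>j\<in>I. A i j * x i * x j) \<le> L * (\<Sum>i\<in>I. (x i)\<^sup>2)"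
  shows "Re (\<Sum>i\<in>I. cnj (y i) * v i) \<ge> (Re z - L) * (\<Sum>i\<in>I. (norm (y i))\<^sup>2)"
proof -
  define T where "T = (\<Sum>i\<in>I. cnj (y i) * (\<Sum>j\<in>I. of_real (A i j) * y j))"
  \<comment> \<open>The form bound is assumed for real vectors only. The mixed terms of real and
    imaginary parts are purely imaginary, so the real part splits into the form at
    \<open>Re y\<close> plus the form at \<open>Im y\<close>.\<close>
  have *: "Re (cnj (y i) * (\<Sum>j\<in>I. of_real (A i j) * y j))
      = (\<Sum>j\<in>I. A i j * Re (y i) * Re (y j)) + (\<Sum>j\<in>I. A i j * Im (y i) * Im (y j))" for i
    unfolding sum_distrib_left Re_sum sum.distrib[symmetric]
    by (rule sum.cong) (auto simp: algebra_simps)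
  have "Re T = (\<Sum>i\<in>I. \<Sum>j\<in>I. A i j * Re (y i) * Re (y j)) + (\<Sum>i\<in>I. \<Sum>j\<in>I. A i j * Im (y i) * Im (y j))"
    unfolding T_def Re_sum * by (rule sum.distrib)
  also have "\<dots> \<le> L * (\<Sum>i\<in>I. (Re (y i))\<^sup>2) + L * (\<Sum>i\<in>I. (Im (y i))\<^sup>2)"
    by (rule add_mono[OF form form])
  also have "\<dots> = L * (\<Sum>i\<in>I. (norm (y i))\<^sup>2)"
    unfolding cmod_power2 sum.distrib by (rule distrib_left[symmetric])
  finally have T: "Re T \<le> L * (\<Sum>i\<in>I. (norm (y i))\<^sup>2)" .
  define s where "s = (\<Sum>i\<in>I. (norm (y i))\<^sup>2)"
  have "(\<Sum>i\<in>I. cnj (y i) * v i) = z * of_real s - T"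
    unfolding T_def s_def sum_cnj_mult_self[symmetric] by (rule resolvent_split) (rule v)
  then have "Re (\<Sum>i\<in>I. cnj (y i) * v i) = Re (z * of_real s - T)"
    by (rule arg_cong)
  also have "\<dots> \<ge> Re z * s - L * s"
    using T unfolding s_def[symmetric] by simp
  finally show ?thesis unfolding s_def left_diff_distrib .
qed

lemma if_diff_mult:
  "((if c then z else 0) - a) * (d * q) = (if c then d * (z * q) else 0) - d * (a * q :: complex)"
  by (cases c) (simp_all add: algebra_simps)

lemma mult_if_diff:
  "(d * q) * ((if c then z else 0) - a) = (if c then d * (z * q) else 0) - d * (q * a :: complex)"
  by (cases c) (simp_all add: algebra_simps)

section \<open>Existence, symmetry and norm bounds of the resolvent\<close>

locale resolvent_setup =
  fixes n :: nat and A :: "nat \<Rightarrow> nat \<Rightarrow> real" and z :: complex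
  assumes sym: "\<And>i j. A i j = A j i" and Im_z: "Im z > 0"
begin

abbreviation I where "I \<equiv> {1..n}"

abbreviation Q where "Q \<equiv> resolvent n z A"

definition B where "B = mat n n (\<lambda>(k, l). (if k = l then z else 0) - complex_of_real (A (Suc k) (Suc l)))"

lemma B_carrier: "B \<in> carrier_mat n n" by (simp add: B_def)

text \<open>A kernel vector satisfies the energy identity with \<open>v = 0\<close>, so its norm
  vanishes because \<open>Im z > 0\<close>.\<close>

lemma det_B: "det B \<noteq> 0"
proof
  assume "det B = 0"
  then obtain v where v: "v \<in> carrier_vec n" "v \<noteq> 0\<^sub>v n" "B *\<^sub>v v = 0\<^sub>v n"
    using det_0_iff_vec_prod_zero[OF B_carrier] by blast
  define y where "y i = v $ (i - 1)" for i
  have "0 = z * y i - (\<Sum>j\<in>I. of_real (A i j) * y j)" if i: "i \<in> I" for i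
  proof -
    have "0 = (B *\<^sub>v v) $ (i - 1)" unfolding v(3) using i by (subst index_zero_vec) (auto simp: One_nat_def)
    also have "\<dots> = (\<Sum>k<n. ((if i - 1 = k then z else 0) - of_real (A (Suc (i - 1)) (Suc k))) * v $ k)"
      using i v(1) by (subst index_mult_mat_vec) (auto simp: B_def scalar_prod_def atLeast0LessThan)
    also have "\<dots> = (\<Sum>k<n. (if i - 1 = k then z * v $ k else 0)) - (\<Sum>k<n. of_real (A i (Suc k)) * v $ k)"
      unfolding sum_subtractf[symmetric] using i by (intro sum.cong) (auto simp: algebra_simps)
    also have "\<dots> = z * y i - (\<Sum>k<n. of_real (A i (Suc k)) * y (Suc k))"
    proof -
      have "i - 1 < n" "Suc (i - 1) = i" using i by auto
      then show ?thesis by (simp add: y_def)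
    qed
    finally show ?thesis
      unfolding sum_Suc_shift[of "\<lambda>k. of_real (A i k) * y k" n] .
  qed
  from resolvent_energy[of A I "\<lambda>_. 0" z y, OF sym this]
  have "(\<Sum>i\<in>I. (norm (y i))\<^sup>2) = 0" using Im_z by simp
  then have 0: "y i = 0" if "i \<in> I" for i
    using that by (simp add: sum_nonneg_eq_0_iff)
  have "v = 0\<^sub>v n"
  proof (rule eq_vecI)
    fix k assume "k < dim_vec (0\<^sub>v n :: complex vec)"
    then show "v $ k = 0\<^sub>v n $ k" using 0[of "Suc k"] by (simp add: y_def)
  qed (use v(1) in auto)
  with v(2) show False by contradiction
qed

lemma Q_eq: "i < n \<Longrightarrow> j < n \<Longrightarrow> adj_mat B $$ (i, j) = det B * Q (Suc i) (Suc j)"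
  using B_carrier det_B unfolding resolvent_def Let_def B_def[symmetric] adj_mat_def by auto

lemma right_inverse:
  assumes "i \<in> I" "k \<in> I"
  shows "z * Q i k - (\<Sum>j\<in>I. of_real (A i j) * Q j k) = (if i = k then 1 else 0)"
proof -
  obtain i' k' where ik: "i = Suc i'" "k = Suc k'" "i' < n" "k' < n"
    using assms by (metis One_nat_def Suc_le_eq atLeastAtMost_iff not0_implies_Suc not_one_le_zero)
  have "det B * (if i = k then 1 else 0) = (B * adj_mat B) $$ (i', k')"
    using ik unfolding adj_mat(2)[OF B_carrier] by auto
  also have "\<dots> = (\<Sum>l<n. B $$ (i', l) * adj_mat B $$ (l, k'))"
    by (rule mult_mat_entry) (use B_carrier adj_mat(1)[OF B_carrier] ik in auto)
  also have "\<dots> = (\<Sum>l<n. (if i' = l then det B * (z * Q (Suc l) k) else 0)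
      - det B * (of_real (A i (Suc l)) * Q (Suc l) k))"
  proof (rule sum.cong[OF refl])
    fix l assume "l \<in> {..<n}"
    then have l: "l < n" by simp
    have B: "B $$ (i', l) = (if i' = l then z else 0) - of_real (A i (Suc l))"
      using l ik by (simp add: B_def)
    show "B $$ (i', l) * adj_mat B $$ (l, k') = (if i' = l then det B * (z * Q (Suc l) k) else 0)
      - det B * (of_real (A i (Suc l)) * Q (Suc l) k)"
      unfolding B Q_eq[OF l ik(4)] ik(2) by (rule if_diff_mult)
  qed
  also have "\<dots> = det B * (z * Q i k - (\<Sum>l<n. of_real (A i (Suc l)) * Q (Suc l) k))"
    using ik by (simp add: sum_subtractf right_diff_distrib sum_distrib_left)
  also have "(\<Sum>l<n. of_real (A i (Suc l)) * Q (Suc l) k) = (\<Sum>j\<in>I. of_real (A i j) * Q j k)"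
    by (rule sum_Suc_shift)
  finally show ?thesis
    by (rule mult_left_cancel[OF det_B, THEN iffD1, symmetric])
qed

lemma left_inverse:
  assumes "i \<in> I" "k \<in> I"
  shows "z * Q i k - (\<Sum>j\<in>I. Q i j * of_real (A j k)) = (if i = k then 1 else 0)"
proof -
  obtain i' k' where ik: "i = Suc i'" "k = Suc k'" "i' < n" "k' < n"
    using assms by (metis One_nat_def Suc_le_eq atLeastAtMost_iff not0_implies_Suc not_one_le_zero)
  have "det B * (if i = k then 1 else 0) = (adj_mat B * B) $$ (i', k')"
    using ik unfolding adj_mat(3)[OF B_carrier] by auto
  also have "\<dots> = (\<Sum>l<n. adj_mat B $$ (i', l) * B $$ (l, k'))"
    by (rule mult_mat_entry) (use B_carrier adj_mat(1)[OF B_carrier] ik in auto)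
  also have "\<dots> = (\<Sum>l<n. (if k' = l then det B * (z * Q i (Suc l)) else 0)
      - det B * (Q i (Suc l) * of_real (A (Suc l) k)))"
  proof (rule sum.cong[OF refl])
    fix l assume "l \<in> {..<n}"
    then have l: "l < n" by simp
    have B: "B $$ (l, k') = (if l = k' then z else 0) - of_real (A (Suc l) k)"
      using l ik by (simp add: B_def)
    show "adj_mat B $$ (i', l) * B $$ (l, k') = (if k' = l then det B * (z * Q i (Suc l)) else 0)
      - det B * (Q i (Suc l) * of_real (A (Suc l) k))"
      unfolding B Q_eq[OF ik(3) l] ik(1) eq_commute[of k'] by (rule mult_if_diff)
  qed
  also have "\<dots> = det B * (z * Q i k - (\<Sum>l<n. Q i (Suc l) * of_real (A (Suc l) k)))"
    using ik by (simp add: sum_subtractf right_diff_distrib sum_distrib_left)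
  also have "(\<Sum>l<n. Q i (Suc l) * of_real (A (Suc l) k)) = (\<Sum>j\<in>I. Q i j * of_real (A j k))"
    by (rule sum_Suc_shift)
  finally show ?thesis
    by (rule mult_left_cancel[OF det_B, THEN iffD1, symmetric])
qed

text \<open>Applying the left inverse to \<open>v = (z - A) y\<close>. This is how identities for
  \<open>Q\<close> are obtained below: exhibit a solution of the linear system.\<close>

lemma Q_unique:
  assumes v: "\<And>i. i \<in> I \<Longrightarrow> v i = z * y i - (\<Sum>j\<in>I. of_real (A i j) * y j)" and i: "i \<in> I"
  shows "y i = (\<Sum>j\<in>I. Q i j * v j)"
proof -
  have "(\<Sum>j\<in>I. Q i j * v j) = (\<Sum>k\<in>I. (z * Q i k) * y k) - (\<Sum>j\<in>I. \<Sum>k\<in>I. (Q i j * of_real (A j k)) * y k)"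
    using resolvent_split[of I v z y, OF v, where w = "\<lambda>j. Q i j"] by (simp add: sum_distrib_left mult_ac)
  also have "(\<Sum>j\<in>I. \<Sum>k\<in>I. (Q i j * of_real (A j k)) * y k) = (\<Sum>k\<in>I. (\<Sum>j\<in>I. Q i j * of_real (A j k)) * y k)"
    by (subst sum.swap) (simp add: sum_distrib_right)
  also have "(\<Sum>k\<in>I. (z * Q i k) * y k) - \<dots> = (\<Sum>k\<in>I. (if i = k then 1 else 0) * y k)"
    unfolding sum_subtractf[symmetric] left_diff_distrib[symmetric]
    by (intro sum.cong refl) (simp only: left_inverse[OF i])
  also have "\<dots> = y i" using i by (simp add: if_distrib[of "\<lambda>a. a * _"] cong: if_cong)
  finally show ?thesis by simp
qed

lemma Q_apply:
  assumes i: "i \<in> I"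
  shows "v i = z * (\<Sum>k\<in>I. Q i k * v k) - (\<Sum>j\<in>I. of_real (A i j) * (\<Sum>k\<in>I. Q j k * v k))"
proof -
  have "(\<Sum>j\<in>I. of_real (A i j) * (\<Sum>k\<in>I. Q j k * v k)) = (\<Sum>k\<in>I. (\<Sum>j\<in>I. of_real (A i j) * Q j k) * v k)"
    unfolding sum_distrib_left sum_distrib_right by (subst sum.swap) (simp add: mult_ac)
  moreover have "z * (\<Sum>k\<in>I. Q i k * v k) - \<dots> = (\<Sum>k\<in>I. (z * Q i k - (\<Sum>j\<in>I. of_real (A i j) * Q j k)) * v k)"
    by (simp add: sum_distrib_left[of z] left_diff_distrib sum_subtractf mult.assoc)
  moreover have "\<dots> = (\<Sum>k\<in>I. (if i = k then 1 else 0) * v k)"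
    by (intro sum.cong refl) (simp only: right_inverse[OF i])
  moreover have "\<dots> = v i" using i by (simp add: if_distrib[of "\<lambda>a. a * _"] cong: if_cong)
  ultimately show ?thesis by simp
qed

text \<open>By \<open>left_inverse\<close> and the symmetry of \<open>A\<close>, row
  \<open>k\<close> of \<open>Q\<close> solves the system that determines column
  \<open>k\<close>.\<close>

lemma Q_sym:
  assumes "i \<in> I" "k \<in> I"
  shows "Q i k = Q k i"
proof -
  have "Q k i = (\<Sum>j\<in>I. Q i j * (if j = k then 1 else 0))"
  proof (rule Q_unique[OF _ assms(1)])
    fix l assume "l \<in> I"
    then show "(if l = k then 1 else 0) = z * Q k l - (\<Sum>j\<in>I. of_real (A l j) * Q k j)"
      using left_inverse[of k l] assms sym[of l] by (simp add: mult.commute)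
  qed
  then show ?thesis using assms by (simp add: if_distrib[of "\<lambda>a. _ * a"] cong: if_cong)
qed

lemma Q_bound: "L2_set (\<lambda>i. norm (\<Sum>j\<in>I. Q i j * v j)) I \<le> L2_set (\<lambda>i. norm (v i)) I / Im z"
proof -
  define y where "y i = (\<Sum>j\<in>I. Q i j * v j)" for i
  let ?Y = "L2_set (\<lambda>i. norm (y i)) I" and ?V = "L2_set (\<lambda>i. norm (v i)) I"
  have "Im z * (\<Sum>i\<in>I. (norm (y i))\<^sup>2) = Im (\<Sum>i\<in>I. cnj (y i) * v i)"
    by (rule resolvent_energy[OF sym, symmetric]) (use Q_apply in \<open>simp add: y_def\<close>)
  also have "\<dots> \<le> norm (\<Sum>i\<in>I. cnj (y i) * v i)"
    using abs_Im_le_cmod by (rule order_trans[OF abs_ge_self])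
  also have "\<dots> \<le> ?Y * ?V"
    using cmod_sum_mult_le_L2_set[of "\<lambda>i. cnj (y i)" v I] by simp
  finally have "?Y * (Im z * ?Y) \<le> ?Y * ?V"
    by (simp add: L2_set_def sum_nonneg power2_eq_square[symmetric] mult.left_commute)
  then have "?Y = 0 \<or> Im z * ?Y \<le> ?V"
    by (metis L2_set_nonneg mult_le_cancel_left_pos order_le_less)
  then have "Im z * ?Y \<le> ?V" using L2_set_nonneg by fastforce
  then show ?thesis using Im_z by (simp add: y_def field_simps)
qed

text \<open>The gain over \<open>Q_bound\<close> is that the bound does not degrade as
  \<open>Im z\<close> tends to 0.\<close>

lemma Q_bound_form:
  assumes form: "\<And>x :: nat \<Rightarrow> real. (\<Sum>i\<in>I. \<Sum>j\<in>I. A i j * x i * x j) \<le> L * (\<Sum>i\<in>I. (x i)\<^sup>2)"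
    and L: "L < Re z"
  shows "L2_set (\<lambda>i. norm (\<Sum>j\<in>I. Q i j * v j)) I \<le> L2_set (\<lambda>i. norm (v i)) I / (Re z - L)"
proof -
  define y where "y i = (\<Sum>j\<in>I. Q i j * v j)" for i
  let ?Y = "L2_set (\<lambda>i. norm (y i)) I" and ?V = "L2_set (\<lambda>i. norm (v i)) I"
  have "(Re z - L) * (\<Sum>i\<in>I. (norm (y i))\<^sup>2) \<le> Re (\<Sum>i\<in>I. cnj (y i) * v i)"
    by (rule resolvent_energy_Re[OF _ form]) (use Q_apply in \<open>simp add: y_def\<close>)
  also have "\<dots> \<le> norm (\<Sum>i\<in>I. cnj (y i) * v i)"
    by (rule complex_Re_le_cmod)
  also have "\<dots> \<le> ?Y * ?V"
    using cmod_sum_mult_le_L2_set[of "\<lambda>i. cnj (y i)" v I] by simp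
  finally have "?Y * ((Re z - L) * ?Y) \<le> ?Y * ?V"
    by (simp add: L2_set_def sum_nonneg power2_eq_square[symmetric] mult.left_commute)
  then have "?Y = 0 \<or> (Re z - L) * ?Y \<le> ?V"
    by (metis L2_set_nonneg mult_le_cancel_left_pos order_le_less)
  then have "(Re z - L) * ?Y \<le> ?V" using L2_set_nonneg by fastforce
  then show ?thesis using L by (simp add: y_def field_simps)
qed

text \<open>The energy identity with \<open>v\<close> a unit vector. It expresses a sum of squares
  through a single diagonal entry, which gains a factor \<open>- Im (Q k k)\<close> over the trivial
  bound by the operator norm.\<close>

lemma ward:
  assumes "k \<in> I"
  shows "Im z * (\<Sum>i\<in>I. (norm (Q i k))\<^sup>2) = - Im (Q k k)"
proof -
  have "Im z * (\<Sum>i\<in>I. (norm (Q i k))\<^sup>2) = Im (\<Sum>i\<in>I. cnj (Q i k) * (if i = k then 1 else 0))"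
    by (rule resolvent_energy[OF sym, symmetric]) (rule right_inverse[OF _ assms, symmetric])
  also have "\<dots> = - Im (Q k k)"
    using assms by (simp add: if_distrib[of "\<lambda>a. _ * a"] cong: if_cong)
  finally show ?thesis .
qed

lemma Q_entry_bound:
  assumes "i \<in> I" "k \<in> I"
  shows "norm (Q i k) \<le> 1 / Im z"
proof -
  have "norm (Q i k) \<le> L2_set (\<lambda>i. norm (Q i k)) I"
    using assms member_le_L2_set[of I i "\<lambda>i. norm (Q i k)"] by simp
  also have "\<dots> = L2_set (\<lambda>i. norm (\<Sum>j\<in>I. Q i j * (if j = k then 1 else 0))) I"
    using assms by (simp add: if_distrib[of "\<lambda>a. _ * a"] cong: if_cong)
  also have "\<dots> \<le> L2_set (\<lambda>i. norm (if i = k then 1 else 0 :: complex)) I / Im z"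
    by (rule Q_bound)
  also have "L2_set (\<lambda>i. norm (if i = k then 1 else 0 :: complex)) I = 1"
    using assms by (simp add: L2_set_def if_distrib[of norm] if_distrib[of "\<lambda>a. a\<^sup>2"] cong: if_cong)
  finally show ?thesis .
qed

end

text \<open>The identity \<open>Q' - Q = Q' (A' - A) Q\<close>: the columns of the difference solve
  the system of \<open>A'\<close> with right side \<open>(A' - A) Q\<close>.\<close>

lemma resolvent_identity:
  assumes "resolvent_setup A z" "resolvent_setup A' z" "k \<in> {1..n}" "l \<in> {1..n}"
  shows "resolvent n z A' k l - resolvent n z A k l =
    (\<Sum>i\<in>{1..n}. \<Sum>j\<in>{1..n}. resolvent n z A' k i * of_real (A' i j - A i j) * resolvent n z A j l)"
proof -
  interpret R: resolvent_setup n A z by fact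
  interpret R': resolvent_setup n A' z by fact
  have "R'.Q k l - R.Q k l = (\<Sum>i\<in>{1..n}. R'.Q k i * (\<Sum>j\<in>{1..n}. of_real (A' i j - A i j) * R.Q j l))"
  proof (rule R'.Q_unique[OF _ assms(3), of "\<lambda>i. \<Sum>j\<in>{1..n}. of_real (A' i j - A i j) * R.Q j l"
        "\<lambda>k. R'.Q k l - R.Q k l"])
    fix i assume i: "i \<in> {1..n}"
    show "(\<Sum>j\<in>{1..n}. of_real (A' i j - A i j) * R.Q j l)
        = z * (R'.Q i l - R.Q i l) - (\<Sum>j\<in>{1..n}. of_real (A' i j) * (R'.Q j l - R.Q j l))"
      using R.right_inverse[OF i assms(4)] R'.right_inverse[OF i assms(4)]
      by (simp add: algebra_simps sum_subtractf)
  qed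
  then show ?thesis
    by (simp add: sum_distrib_left mult.assoc)
qed

section \<open>Measurability of the resolvent\<close>

lemma borel_measurable_det:
  fixes F :: "'a \<Rightarrow> nat \<Rightarrow> nat \<Rightarrow> complex"
  assumes "\<And>i j. i < n \<Longrightarrow> j < n \<Longrightarrow> (\<lambda>g. F g i j) \<in> borel_measurable M"
  shows "(\<lambda>g. det (mat n n (\<lambda>(i, j). F g i j))) \<in> borel_measurable M"
proof -
  have "(\<lambda>g. \<Sum>p\<in>{p. p permutes {0..<n}}. signof p * (\<Prod>i = 0..<n. F g i (p i))) \<in> borel_measurable M"
    by (intro borel_measurable_sum borel_measurable_times borel_measurable_prod borel_measurable_const assms)
       (auto dest: permutes_in_image)
  moreover have "det (mat n n (\<lambda>(i, j). F g i j))
      = (\<Sum>p\<in>{p. p permutes {0..<n}}. signof p * (\<Prod>i = 0..<n. F g i (p i)))" for g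
    by (subst det_def'[of _ n])
       (auto intro!: sum.cong prod.cong simp: permutes_in_image)
  ultimately show ?thesis by simp
qed

text \<open>Cofactor and determinant are polynomials in the matrix entries; this is what the
  definition by Cramer's rule buys. The index map \<open>?s\<close> describes the deleted row and
  column.\<close>

lemma borel_measurable_resolvent:
  assumes "\<And>i j. i \<in> {1..n} \<Longrightarrow> j \<in> {1..n} \<Longrightarrow> (\<lambda>g. A g i j) \<in> borel_measurable M"
    and ij: "i \<in> {1..n}" "j \<in> {1..n}"
  shows "(\<lambda>g. resolvent n z (A g) i j) \<in> borel_measurable M"
proof -
  let ?F = "\<lambda>g k l. (if k = l then z else 0) - complex_of_real (A g (Suc k) (Suc l))"
  let ?s = "\<lambda>a k :: nat. if k < a then k else Suc k"
  have F: "(\<lambda>g. ?F g k l) \<in> borel_measurable M" if "k < n" "l < n" for k l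
  proof -
    have [measurable]: "(\<lambda>g. A g (Suc k) (Suc l)) \<in> borel_measurable M"
      using that by (intro assms(1)) auto
    show ?thesis by measurable
  qed
  have del: "mat_delete (mat n n (\<lambda>(k, l). ?F g k l)) (j - 1) (i - 1)
      = mat (n - 1) (n - 1) (\<lambda>(k, l). ?F g (?s (j - 1) k) (?s (i - 1) l))" for g
    using ij by (auto simp: mat_delete_def intro!: eq_matI)
  have "(\<lambda>g. det (mat (n - 1) (n - 1) (\<lambda>(k, l). ?F g (?s (j - 1) k) (?s (i - 1) l)))) \<in> borel_measurable M"
    by (rule borel_measurable_det, rule F) auto
  moreover have "(\<lambda>g. det (mat n n (\<lambda>(k, l). ?F g k l))) \<in> borel_measurable M"
    by (rule borel_measurable_det, rule F)
  ultimately show ?thesis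
    unfolding resolvent_def Let_def cofactor_def del by measurable
qed

subsection \<open>Partial derivatives in the disorder\<close>

text \<open>A relation between functions on the whole disorder space, so that the rules below
  assemble \<open>f'\<close> along with \<open>f\<close>. The derivative is taken at
  \<open>g e\<close> for every \<open>g\<close>, hence at every point of each coordinate
  line.\<close>

definition pd :: "'i \<Rightarrow> (('i \<Rightarrow> real) \<Rightarrow> 'b::real_normed_vector) \<Rightarrow> (('i \<Rightarrow> real) \<Rightarrow> 'b) \<Rightarrow> bool" where
  "pd e f f' \<longleftrightarrow> (\<forall>g. ((\<lambda>t. f (g(e := t))) has_vector_derivative f' g) (at (g e)))"

lemma pd_const: "pd e (\<lambda>_. c) (\<lambda>_. 0)"
  by (simp add: pd_def)

lemma pd_diff: "pd e f f' \<Longrightarrow> pd e h h' \<Longrightarrow> pd e (\<lambda>g. f g - h g) (\<lambda>g. f' g - h' g)"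
  by (simp add: pd_def has_vector_derivative_diff)

lemma pd_mult:
  fixes f h :: "('a \<Rightarrow> real) \<Rightarrow> 'b::real_normed_algebra"
  shows "pd e f f' \<Longrightarrow> pd e h h' \<Longrightarrow> pd e (\<lambda>g. f g * h g) (\<lambda>g. f g * h' g + f' g * h g)"
  unfolding pd_def
proof (intro impI allI)
  fix g :: "'a \<Rightarrow> real"
  assume f: "\<forall>g. ((\<lambda>t. f (g(e := t))) has_vector_derivative f' g) (at (g e))"
    and h: "\<forall>g. ((\<lambda>t. h (g(e := t))) has_vector_derivative h' g) (at (g e))"
  show "((\<lambda>t. f (g(e := t)) * h (g(e := t))) has_vector_derivative f g * h' g + f' g * h g) (at (g e))"
    using has_vector_derivative_mult[OF spec[OF f, of g] spec[OF h, of g]] by simp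
qed

lemma pd_sum: "(\<And>i. i \<in> S \<Longrightarrow> pd e (f i) (f' i)) \<Longrightarrow> pd e (\<lambda>g. \<Sum>i\<in>S. f i g) (\<lambda>g. \<Sum>i\<in>S. f' i g)"
  by (simp add: pd_def has_vector_derivative_sum)

lemma pd_cmult:
  fixes f :: "_ \<Rightarrow> 'b::real_normed_algebra"
  shows "pd e f f' \<Longrightarrow> pd e (\<lambda>g. c * f g) (\<lambda>g. c * f' g)"
  using pd_mult[OF pd_const, of e f f' c] by simp

lemma pd_cnj: "pd e f f' \<Longrightarrow> pd e (\<lambda>g. cnj (f g)) (\<lambda>g. cnj (f' g))"
  by (simp add: pd_def has_vector_derivative_cnj)

lemma pd_of_real: "pd e f f' \<Longrightarrow> pd e (\<lambda>g. complex_of_real (f g)) (\<lambda>g. complex_of_real (f' g))"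
  by (simp add: pd_def has_vector_derivative_of_real has_real_derivative_iff_has_vector_derivative)

text \<open>Caratheodory's form of differentiability. The resolvent identity delivers exactly such a
  factorisation of the increment.\<close>

lemma has_vector_derivative_quotientI:
  assumes "\<And>t. f t - f s = (t - s) *\<^sub>R h t" and "(h \<longlongrightarrow> D) (at s)"
  shows "(f has_vector_derivative D) (at s)"
  unfolding has_vector_derivative_def has_derivative_iff_norm
proof
  show "bounded_linear (\<lambda>x. x *\<^sub>R D)" by (rule bounded_linear_scaleR_left)
  have "((\<lambda>t. norm (h t - D)) \<longlongrightarrow> 0) (at s)"
    using assms(2) by (simp add: LIM_zero tendsto_norm_zero)
  moreover have "\<forall>\<^sub>F t in at s. norm (h t - D) = norm (f t - f s - (t - s) *\<^sub>R D) / norm (t - s)"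
    unfolding eventually_at_filter assms(1) scaleR_diff_right[symmetric] norm_scaleR by simp
  ultimately show "((\<lambda>t. norm (f t - f s - (t - s) *\<^sub>R D) / norm (t - s)) \<longlongrightarrow> 0) (at s)"
    using tendsto_cong by force
qed

section \<open>The disorder and the coupling matrix\<close>

definition coupling :: "nat \<Rightarrow> (nat \<times> nat \<Rightarrow> real) \<Rightarrow> nat \<Rightarrow> nat \<Rightarrow> real" where
  "coupling n g i j = (if i = j then 0 else g (min i j, max i j) / sqrt (real n))"

lemma coupling_sym: "coupling n g i j = coupling n g j i"
  by (simp add: coupling_def min.commute max.commute)

lemma finite_pairs: "finite (pairs n)"
  by (rule finite_subset[of _ "{1..n} \<times> {1..n}"]) (auto simp: pairs_def)

lemma edge_in_pairs: "i \<in> {1..n} \<Longrightarrow> j \<in> {1..n} \<Longrightarrow> i \<noteq> j \<Longrightarrow> (min i j, max i j) \<in> pairs n"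
  by (auto simp: pairs_def min_def max_def)

lemma prob_space_disorder: "prob_space (disorder n)"
  unfolding disorder_def by (rule prob_space_gauss_space)

lemma measurable_disorder_component:
  "p \<in> pairs n \<Longrightarrow> (\<lambda>g. g p) \<in> borel_measurable (disorder n)"
  using measurable_component_singleton[of p "pairs n" "\<lambda>_. std_gauss"] by (simp add: disorder_def)

lemma measurable_coupling:
  "i \<in> {1..n} \<Longrightarrow> j \<in> {1..n} \<Longrightarrow> (\<lambda>g. coupling n g i j) \<in> borel_measurable (disorder n)"
  using measurable_disorder_component[OF edge_in_pairs, of i n j]
  by (cases "i = j") (simp_all add: coupling_def)

lemma integrable_disorder_bounded:
  fixes f :: "_ \<Rightarrow> 'b::{banach,second_countable_topology}"
  assumes "f \<in> borel_measurable (disorder n)" "\<And>g. norm (f g) \<le> C"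
  shows "integrable (disorder n) f"
  using prob_space_disorder[of n] assms
  by (intro finite_measure.integrable_const_bound[where B = C])
     (auto simp: prob_space.finite_measure)

lemma coupling_ibp:
  fixes X X' :: "_ \<Rightarrow> complex"
  assumes ij: "i \<in> {1..n}" "j \<in> {1..n}" "i \<noteq> j"
    and pd: "pd (min i j, max i j) X X'"
    and m: "X \<in> borel_measurable (disorder n)" "X' \<in> borel_measurable (disorder n)"
    and b: "\<And>g. norm (X g) \<le> C" "\<And>g. norm (X' g) \<le> C'"
  shows "integrable (disorder n) (\<lambda>g. of_real (coupling n g i j) * X g)"
    and "(LINT g|disorder n. of_real (coupling n g i j) * X g) = (LINT g|disorder n. X' g) / sqrt (real n)"
proof -
  let ?e = "(min i j, max i j)"
  have e: "?e \<in> pairs n" using ij by (rule edge_in_pairs)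
  have eq: "of_real (coupling n g i j) * X g = (g ?e *\<^sub>R X g) / sqrt (real n)" for g
    using ij by (simp add: coupling_def scaleR_conv_of_real)
  have b': "norm (X g) \<le> max C C' * exp (0 * (\<Sum>p\<in>pairs n. \<bar>g p\<bar>))"
      "norm (X' g) \<le> max C C' * exp (0 * (\<Sum>p\<in>pairs n. \<bar>g p\<bar>))" for g
    using b[of g] by simp_all
  have "(LINT g|disorder n. g ?e *\<^sub>R X g) = (LINT g|disorder n. X' g)"
    unfolding disorder_def
    using pd[unfolded pd_def] m[unfolded disorder_def] by (intro gauss_ibp[OF finite_pairs e _ _ _ b']) blast+
  then show "(LINT g|disorder n. of_real (coupling n g i j) * X g) = (LINT g|disorder n. X' g) / sqrt (real n)"
    unfolding eq by simp
  have C: "C \<ge> 0" using order_trans[OF norm_ge_zero b(1)] .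
  have "integrable (disorder n) (\<lambda>g. g ?e *\<^sub>R X g)"
    unfolding disorder_def
  proof (rule integrable_gauss_space_bound[OF finite_pairs])
    show "(\<lambda>g. g ?e *\<^sub>R X g) \<in> borel_measurable (gauss_space (pairs n))"
      using measurable_disorder_component[OF e] m(1) unfolding disorder_def by (intro borel_measurable_scaleR)
    fix g :: "nat \<times> nat \<Rightarrow> real"
    have "\<bar>g ?e\<bar> \<le> (\<Sum>p\<in>pairs n. \<bar>g p\<bar>)" using e finite_pairs by (intro member_le_sum) auto
    then have "\<bar>g ?e\<bar> \<le> exp (\<Sum>p\<in>pairs n. \<bar>g p\<bar>)"
      using exp_ge_add_one_self[of "\<Sum>p\<in>pairs n. \<bar>g p\<bar>"] by linarith
    then have "\<bar>g ?e\<bar> * norm (X g) \<le> exp (\<Sum>p\<in>pairs n. \<bar>g p\<bar>) * C"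
      using b(1) C by (intro mult_mono) auto
    then show "norm (g ?e *\<^sub>R X g) \<le> C * exp (1 * (\<Sum>p\<in>pairs n. \<bar>g p\<bar>))"
      by (simp add: mult.commute)
  qed
  then show "integrable (disorder n) (\<lambda>g. of_real (coupling n g i j) * X g)"
    unfolding eq by simp
qed

section \<open>Gibbs averages and their derivatives\<close>

lemma finite_spins: "finite (spins n)"
  unfolding spins_def by (intro finite_PiE) auto

lemma spins_nonempty: "spins n \<noteq> {}"
  unfolding spins_def by (auto simp: PiE_eq_empty_iff)

lemma spin_square: "\<sigma> \<in> spins n \<Longrightarrow> i \<in> {1..n} \<Longrightarrow> \<sigma> i * \<sigma> i = 1"
  unfolding spins_def by (drule PiE_mem) auto

lemma spin_abs: "\<sigma> \<in> spins n \<Longrightarrow> i \<in> {1..n} \<Longrightarrow> \<bar>\<sigma> i\<bar> = 1"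
  unfolding spins_def by (drule PiE_mem) auto

lemma boltzmann_eq:
  "boltzmann n \<beta> g \<sigma> = exp (\<beta> / sqrt (real n) * (\<Sum>p\<in>pairs n. g p * \<sigma> (fst p) * \<sigma> (snd p)))"
  by (simp add: boltzmann_def case_prod_unfold)

lemma boltzmann_pos: "boltzmann n \<beta> g \<sigma> > 0"
  by (simp add: boltzmann_def)

lemma partition_fun_pos: "partition_fun n \<beta> g > 0"
  unfolding partition_fun_def by (intro sum_pos finite_spins spins_nonempty boltzmann_pos)

lemma gibbs_nonneg: "gibbs n \<beta> g \<sigma> \<ge> 0"
  using boltzmann_pos[of n \<beta> g \<sigma>] partition_fun_pos[of n \<beta> g] by (simp add: gibbs_def)

lemma gibbs_sum: "(\<Sum>\<sigma>\<in>spins n. gibbs n \<beta> g \<sigma>) = 1"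
  using partition_fun_pos[of n \<beta> g]
  by (simp add: gibbs_def sum_divide_distrib[symmetric] partition_fun_def[symmetric])

lemma bracket_mono:
  "(\<And>\<sigma>. \<sigma> \<in> spins n \<Longrightarrow> f \<sigma> \<le> h \<sigma>) \<Longrightarrow> bracket n \<beta> g f \<le> bracket n \<beta> g h"
  unfolding bracket_def by (intro sum_mono mult_right_mono gibbs_nonneg)

lemma bracket_cong:
  "(\<And>\<sigma>. \<sigma> \<in> spins n \<Longrightarrow> f \<sigma> = h \<sigma>) \<Longrightarrow> bracket n \<beta> g f = bracket n \<beta> g h"
  unfolding bracket_def by (intro sum.cong) auto

lemma bracket_const: "bracket n \<beta> g (\<lambda>_. c) = c"
  unfolding bracket_def using gibbs_sum[of n \<beta> g] by (simp add: sum_distrib_left[symmetric])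

lemma bracket_sum: "bracket n \<beta> g (\<lambda>\<sigma>. \<Sum>i\<in>S. f i \<sigma>) = (\<Sum>i\<in>S. bracket n \<beta> g (f i))"
  unfolding bracket_def sum_distrib_right by (rule sum.swap)

lemma bracket_cmult: "bracket n \<beta> g (\<lambda>\<sigma>. c * f \<sigma>) = c * bracket n \<beta> g f"
  unfolding bracket_def sum_distrib_left by (simp add: mult.assoc)

lemma bracket_abs_le:
  assumes "\<And>\<sigma>. \<sigma> \<in> spins n \<Longrightarrow> \<bar>f \<sigma>\<bar> \<le> C"
  shows "\<bar>bracket n \<beta> g f\<bar> \<le> C"
proof -
  have "bracket n \<beta> g f \<le> C" "- C \<le> bracket n \<beta> g f"
    using bracket_mono[of n f "\<lambda>_. C" \<beta> g] bracket_mono[of n "\<lambda>_. - C" f \<beta> g] assms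
    unfolding bracket_const by (fastforce simp: abs_le_iff)+
  then show ?thesis by simp
qed

lemma cov_abs_le: "i \<in> {1..n} \<Longrightarrow> j \<in> {1..n} \<Longrightarrow> \<bar>cov n \<beta> g i j\<bar> \<le> 1"
  unfolding cov_def by (intro bracket_abs_le) (simp add: abs_mult spin_abs)

lemma cov_diag: "i \<in> {1..n} \<Longrightarrow> cov n \<beta> g i i = 1"
  unfolding cov_def using bracket_cong[of n "\<lambda>\<sigma>. \<sigma> i * \<sigma> i" "\<lambda>_. 1"] spin_square by (simp add: bracket_const)

lemma cov_sym: "cov n \<beta> g i j = cov n \<beta> g j i"
  unfolding cov_def by (simp add: mult.commute)

lemma measurable_boltzmann: "(\<lambda>g. boltzmann n \<beta> g \<sigma>) \<in> borel_measurable (disorder n)"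
proof -
  have "(\<lambda>g. \<Sum>p\<in>pairs n. g p * \<sigma> (fst p) * \<sigma> (snd p)) \<in> borel_measurable (disorder n)"
    by (intro borel_measurable_sum borel_measurable_times measurable_disorder_component borel_measurable_const)
  then show ?thesis
    unfolding boltzmann_eq by simp
qed

lemma measurable_bracket: "(\<lambda>g. bracket n \<beta> g f) \<in> borel_measurable (disorder n)"
  unfolding bracket_def gibbs_def partition_fun_def
  by (intro borel_measurable_sum borel_measurable_times borel_measurable_divide measurable_boltzmann borel_measurable_const)

lemma measurable_cov: "(\<lambda>g. cov n \<beta> g i j) \<in> borel_measurable (disorder n)"
  unfolding cov_def by (rule measurable_bracket)

lemma pd_boltzmann:
  assumes "i \<in> {1..n}" "j \<in> {1..n}" "i \<noteq> j"
  shows "pd (min i j, max i j) (\<lambda>g. boltzmann n \<beta> g \<sigma>)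
     (\<lambda>g. \<beta> / sqrt (real n) * (\<sigma> i * \<sigma> j) * boltzmann n \<beta> g \<sigma>)"
  unfolding pd_def
proof
  fix g :: "nat \<times> nat \<Rightarrow> real"
  let ?e = "(min i j, max i j)"
  let ?R = "\<Sum>p\<in>pairs n - {?e}. g p * \<sigma> (fst p) * \<sigma> (snd p)"
  have e: "?e \<in> pairs n" using assms by (rule edge_in_pairs)
  have ss: "\<sigma> (min i j) * \<sigma> (max i j) = \<sigma> i * \<sigma> j" by (simp add: min_def max_def)
  have b: "boltzmann n \<beta> (g(?e := t)) \<sigma> = exp (\<beta> / sqrt (real n) * (t * (\<sigma> i * \<sigma> j) + ?R))" for t
  proof -
    have "(\<Sum>p\<in>pairs n. (g(?e := t)) p * \<sigma> (fst p) * \<sigma> (snd p)) = t * (\<sigma> i * \<sigma> j) + ?R"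
      using sum.remove[OF finite_pairs e, of "\<lambda>p. (g(?e := t)) p * \<sigma> (fst p) * \<sigma> (snd p)"] ss
      by (auto simp: mult.assoc intro!: sum.cong)
    then show ?thesis unfolding boltzmann_eq by (rule arg_cong)
  qed
  have d: "((\<lambda>t. exp (c * (t * s + R))) has_real_derivative c * s * exp (c * (u * s + R))) (at u)" for c s R u :: real
    by (auto intro!: derivative_eq_intros)
  have b': "boltzmann n \<beta> g \<sigma> = exp (\<beta> / sqrt (real n) * (g ?e * (\<sigma> i * \<sigma> j) + ?R))"
    using b[of "g ?e"] by (simp only: fun_upd_triv)
  show "((\<lambda>t. boltzmann n \<beta> (g(?e := t)) \<sigma>) has_vector_derivative
      \<beta> / sqrt (real n) * (\<sigma> i * \<sigma> j) * boltzmann n \<beta> g \<sigma>) (at (g ?e))"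
    unfolding has_real_derivative_iff_has_vector_derivative[symmetric] b b' by (rule d)
qed

text \<open>Quotient rule: the response of a Gibbs average to a coupling is its truncated
  correlation with \<open>\<sigma> i * \<sigma> j\<close>.\<close>

lemma pd_bracket:
  assumes "i \<in> {1..n}" "j \<in> {1..n}" "i \<noteq> j"
  shows "pd (min i j, max i j) (\<lambda>g. bracket n \<beta> g f)
     (\<lambda>g. \<beta> / sqrt (real n) * (bracket n \<beta> g (\<lambda>\<sigma>. f \<sigma> * (\<sigma> i * \<sigma> j)) - bracket n \<beta> g f * cov n \<beta> g i j))"
proof -
  let ?e = "(min i j, max i j)" and ?c = "\<beta> / sqrt (real n)"
  let ?N = "\<lambda>f g. \<Sum>\<sigma>\<in>spins n. f \<sigma> * boltzmann n \<beta> g \<sigma>"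
  have br: "bracket n \<beta> g f = ?N f g / partition_fun n \<beta> g" for f g
    unfolding bracket_def gibbs_def by (simp add: sum_divide_distrib)
  have N: "pd ?e (?N f) (\<lambda>g. ?c * ?N (\<lambda>\<sigma>. f \<sigma> * (\<sigma> i * \<sigma> j)) g)" for f
  proof -
    have "pd ?e (?N f) (\<lambda>g. \<Sum>\<sigma>\<in>spins n. f \<sigma> * (?c * (\<sigma> i * \<sigma> j) * boltzmann n \<beta> g \<sigma>))"
      by (intro pd_sum pd_cmult pd_boltzmann assms)
    then show ?thesis by (simp add: sum_distrib_left mult_ac)
  qed
  have Z: "partition_fun n \<beta> g = ?N (\<lambda>_. 1) g" for g by (simp add: partition_fun_def)
  show ?thesis
    unfolding pd_def
  proof
    fix g :: "nat \<times> nat \<Rightarrow> real"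
    let ?Z = "partition_fun n \<beta> g"
    have Z0: "?Z \<noteq> 0" using partition_fun_pos[of n \<beta> g] by simp
    have 1: "((\<lambda>t. ?N f (g(?e := t))) has_real_derivative ?c * ?N (\<lambda>\<sigma>. f \<sigma> * (\<sigma> i * \<sigma> j)) g) (at (g ?e))"
      using N[of f] unfolding pd_def has_real_derivative_iff_has_vector_derivative by blast
    have 2: "((\<lambda>t. partition_fun n \<beta> (g(?e := t))) has_real_derivative ?c * ?N (\<lambda>\<sigma>. \<sigma> i * \<sigma> j) g) (at (g ?e))"
      using N[of "\<lambda>_. 1"] unfolding pd_def has_real_derivative_iff_has_vector_derivative Z by simp
    have "((\<lambda>t. ?N f (g(?e := t)) / partition_fun n \<beta> (g(?e := t))) has_real_derivative
        (?c * ?N (\<lambda>\<sigma>. f \<sigma> * (\<sigma> i * \<sigma> j)) g * ?Z - ?N f g * (?c * ?N (\<lambda>\<sigma>. \<sigma> i * \<sigma> j) g)) / (?Z * ?Z)) (at (g ?e))"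
      using DERIV_divide[OF 1 2] Z0 by simp
    moreover have "(?c * ?N (\<lambda>\<sigma>. f \<sigma> * (\<sigma> i * \<sigma> j)) g * ?Z - ?N f g * (?c * ?N (\<lambda>\<sigma>. \<sigma> i * \<sigma> j) g)) / (?Z * ?Z)
        = ?c * (bracket n \<beta> g (\<lambda>\<sigma>. f \<sigma> * (\<sigma> i * \<sigma> j)) - bracket n \<beta> g f * cov n \<beta> g i j)"
    proof -
      have alg: "(c * a * Z - b * (c * d)) / (Z * Z) = c * (a / Z - b / Z * (d / Z))" if "Z \<noteq> 0" for a b c d Z :: real
        using that by (simp add: field_simps)
      show ?thesis unfolding cov_def br by (rule alg[OF Z0])
    qed
    ultimately show "((\<lambda>t. bracket n \<beta> (g(?e := t)) f) has_vector_derivative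
        ?c * (bracket n \<beta> g (\<lambda>\<sigma>. f \<sigma> * (\<sigma> i * \<sigma> j)) - bracket n \<beta> g f * cov n \<beta> g i j)) (at (g ?e))"
      unfolding br has_real_derivative_iff_has_vector_derivative[symmetric] by simp
  qed
qed

text \<open>The entry \<open>k i\<close> shares the index \<open>i\<close> with the coupling, so
  \<open>\<sigma> i\<close> occurs twice and squares to 1. The four-point function collapses to
  \<open>cov n \<beta> g k j\<close>, and this is why the equation for \<open>S\<close> closes on
  second moments.\<close>

lemma pd_cov:
  assumes "i \<in> {1..n}" "j \<in> {1..n}" "i \<noteq> j" "k \<in> {1..n}"
  shows "pd (min i j, max i j) (\<lambda>g. cov n \<beta> g k i)
     (\<lambda>g. \<beta> / sqrt (real n) * (cov n \<beta> g k j - cov n \<beta> g k i * cov n \<beta> g i j))"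
proof -
  have "bracket n \<beta> g (\<lambda>\<sigma>. \<sigma> k * \<sigma> i * (\<sigma> i * \<sigma> j)) = cov n \<beta> g k j" for g
    unfolding cov_def
  proof (rule bracket_cong)
    fix \<sigma> assume "\<sigma> \<in> spins n"
    then show "\<sigma> k * \<sigma> i * (\<sigma> i * \<sigma> j) = \<sigma> k * \<sigma> j"
      using spin_square[of \<sigma> n i] assms(1) by (metis mult.assoc mult.left_neutral)
  qed
  with pd_bracket[OF assms(1-3), of \<beta> "\<lambda>\<sigma>. \<sigma> k * \<sigma> i"] show ?thesis
    by (simp add: cov_def)
qed

section \<open>Derivatives of the resolvent in the couplings\<close>

locale sk_resolvent =
  fixes n :: nat and \<beta> :: real and z :: complex
  assumes n: "n \<ge> 1" and Im_z: "Im z > 0"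
begin

abbreviation I where "I \<equiv> {1..n}"
abbreviation \<eta> where "\<eta> \<equiv> Im z"

definition Q where "Q g i j = resolvent n z (coupling n g) i j"

sublocale R: resolvent_setup n "coupling n g" z for g
  by unfold_locales (rule coupling_sym, rule Im_z)

lemma Q_entry_bound: "i \<in> I \<Longrightarrow> j \<in> I \<Longrightarrow> norm (Q g i j) \<le> 1 / \<eta>"
  unfolding Q_def by (rule R.Q_entry_bound)

lemma measurable_Q: "i \<in> I \<Longrightarrow> j \<in> I \<Longrightarrow> (\<lambda>g. Q g i j) \<in> borel_measurable (disorder n)"
  unfolding Q_def by (intro borel_measurable_resolvent measurable_coupling)

text \<open>A coupling occupies two entries of the symmetric matrix, so the resolvent identity
  leaves two terms.\<close>

lemma pd_Q:
  assumes ij: "i \<in> I" "j \<in> I" "i \<noteq> j" and kl: "k \<in> I" "l \<in> I"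
  shows "pd (min i j, max i j) (\<lambda>g. Q g k l)
    (\<lambda>g. (Q g k i * Q g j l + Q g k j * Q g i l) / sqrt (real n))"
  unfolding pd_def
proof
  fix g :: "nat \<times> nat \<Rightarrow> real"
  let ?e = "(min i j, max i j)" and ?r = "sqrt (real n)"
  let ?g = "\<lambda>t. g(?e := t)"
  \<comment> \<open>This increment formula is exact, not first order: the left factors still sit at
    the moved disorder \<open>?g t\<close>. Only their continuity is missing for the
    derivative.\<close>
  have diff: "Q (?g t) k' l - Q g k' l = of_real ((t - g ?e) / ?r) * (Q (?g t) k' i * Q g j l + Q (?g t) k' j * Q g i l)"
    if k': "k' \<in> I" and l: "l \<in> I" for t k' l
  proof -
    let ?D = "\<lambda>a b. coupling n (?g t) a b - coupling n g a b"
    let ?d = "(t - g ?e) / ?r"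
    have D: "?D a b = (if a = i \<and> b = j \<or> a = j \<and> b = i then ?d else 0)" if "a \<in> I" "b \<in> I" for a b
      using ij by (auto simp: coupling_def min_def max_def diff_divide_distrib)
    have "Q (?g t) k' l - Q g k' l = (\<Sum>a\<in>I. \<Sum>b\<in>I. Q (?g t) k' a * of_real (?D a b) * Q g b l)"
      unfolding Q_def by (rule resolvent_identity) (use R.resolvent_setup_axioms k' l in auto)
    also have "\<dots> = (\<Sum>a\<in>I. \<Sum>b\<in>I. (if a = i then if b = j then of_real ?d * (Q (?g t) k' i * Q g j l) else 0 else 0)
        + (if a = j then if b = i then of_real ?d * (Q (?g t) k' j * Q g i l) else 0 else 0))"
      using ij(3) by (intro sum.cong refl) (auto simp: D)
    also have "\<dots> = of_real ?d * (Q (?g t) k' i * Q g j l) + of_real ?d * (Q (?g t) k' j * Q g i l)"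
    proof -
      have *: "(\<Sum>a\<in>I. \<Sum>b\<in>I. if a = p then if b = q then c else 0 else 0) = c" if "p \<in> I" "q \<in> I" for p q and c :: complex
      proof -
        have "(\<Sum>a\<in>I. \<Sum>b\<in>I. if a = p then if b = q then c else 0 else 0) = (\<Sum>a\<in>I. if a = p then (\<Sum>b\<in>I. if b = q then c else 0) else 0)"
          by (intro sum.cong) auto
        then show ?thesis using that by simp
      qed
      show ?thesis unfolding sum.distrib using *[OF ij(1,2)] *[OF ij(2,1)] by simp
    qed
    finally show ?thesis by (simp add: distrib_left)
  qed
  show "((\<lambda>t. Q (?g t) k l) has_vector_derivative (Q g k i * Q g j l + Q g k j * Q g i l) / ?r) (at (g ?e))"
  proof (rule has_vector_derivative_quotientI)
    show "Q (?g t) k l - Q (?g (g ?e)) k l = (t - g ?e) *\<^sub>R ((Q (?g t) k i * Q g j l + Q (?g t) k j * Q g i l) / ?r)" for t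
      using diff[OF kl, of t] by (simp add: scaleR_conv_of_real)
    \<comment> \<open>The same formula with the entry bound \<open>1 / \<eta>\<close> gives
      Lipschitz continuity in \<open>t\<close>.\<close>
    have lim: "((\<lambda>t. Q (?g t) k l') \<longlongrightarrow> Q g k l') (at (g ?e))" if l': "l' \<in> I" for l'
    proof -
      have bd: "norm (Q (?g t) k l' - Q g k l') \<le> \<bar>t - g ?e\<bar> * (2 / \<eta>\<^sup>2 / ?r)" for t
      proof -
        have "norm (Q (?g t) k i * Q g j l' + Q (?g t) k j * Q g i l') \<le> 1 / \<eta> * (1 / \<eta>) + 1 / \<eta> * (1 / \<eta>)"
          by (rule norm_triangle_mono; unfold norm_mult; intro mult_mono Q_entry_bound) (use ij kl l' Im_z in auto)
        also have "\<dots> = 2 / \<eta>\<^sup>2" by (simp add: power2_eq_square)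
        finally have b: "norm (Q (?g t) k i * Q g j l' + Q (?g t) k j * Q g i l') \<le> 2 / \<eta>\<^sup>2" .
        have "norm (Q (?g t) k l' - Q g k l')
            = \<bar>t - g ?e\<bar> / ?r * norm (Q (?g t) k i * Q g j l' + Q (?g t) k j * Q g i l')"
          unfolding diff[OF kl(1) l'] norm_mult norm_of_real by simp
        also have "\<dots> \<le> \<bar>t - g ?e\<bar> / ?r * (2 / \<eta>\<^sup>2)"
          by (intro mult_left_mono b) simp
        finally show ?thesis by (simp add: mult.commute)
      qed
      have l0: "((\<lambda>t. \<bar>t - g ?e\<bar> * (2 / \<eta>\<^sup>2 / ?r)) \<longlongrightarrow> 0) (at (g ?e))"
      proof -
        have "((\<lambda>t. \<bar>t - g ?e\<bar> * (2 / \<eta>\<^sup>2 / ?r)) \<longlongrightarrow> \<bar>g ?e - g ?e\<bar> * (2 / \<eta>\<^sup>2 / ?r)) (at (g ?e))"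
          by (intro tendsto_mult tendsto_rabs tendsto_diff tendsto_const tendsto_ident_at)
        then show ?thesis by simp
      qed
      have "((\<lambda>t. Q (?g t) k l' - Q g k l') \<longlongrightarrow> 0) (at (g ?e))"
        by (rule Lim_null_comparison[OF _ l0], rule always_eventually, rule allI, rule bd)
      then show ?thesis by (simp add: LIM_zero_iff)
    qed
    have "((\<lambda>t. (Q (?g t) k i * Q g j l + Q (?g t) k j * Q g i l) / ?r) \<longlongrightarrow>
        (Q g k i * Q g j l + Q g k j * Q g i l) / ?r) (at (g ?e))"
      using n by (intro tendsto_intros lim ij) simp
    then show "((\<lambda>t. (Q (?g t) k i * Q g j l + Q (?g t) k j * Q g i l) / ?r) \<longlongrightarrow>
        (Q g k i * Q g j l + Q g k j * Q g i l) / ?r) (at (g ?e))" .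
  qed
qed

end

subsection \<open>Loop equations\<close>

lemma L2_set_of_real: "L2_set (\<lambda>i. norm (complex_of_real (f i))) S = L2_set f S"
  by (simp add: L2_set_def)

lemma sum_off_diag:
  fixes f :: "nat \<Rightarrow> nat \<Rightarrow> 'a::ab_group_add"
  assumes "finite S"
  shows "(\<Sum>i\<in>S. \<Sum>j\<in>S - {i}. f i j) = (\<Sum>i\<in>S. \<Sum>j\<in>S. f i j) - (\<Sum>i\<in>S. f i i)"
  using assms by (simp add: sum_diff1 sum_subtractf)

lemma norm_sum_off_diag_le:
  fixes f :: "nat \<Rightarrow> nat \<Rightarrow> complex"
  assumes "finite S"
  shows "norm (\<Sum>i\<in>S. \<Sum>j\<in>S - {i}. f i j) \<le> (\<Sum>i\<in>S. \<Sum>j\<in>S. norm (f i j))"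
proof -
  have "norm (\<Sum>i\<in>S. \<Sum>j\<in>S - {i}. f i j) \<le> (\<Sum>i\<in>S. \<Sum>j\<in>S - {i}. norm (f i j))"
    by (rule order_trans[OF norm_sum], rule sum_mono, rule norm_sum)
  also have "\<dots> \<le> (\<Sum>i\<in>S. \<Sum>j\<in>S. norm (f i j))"
    using assms by (intro sum_mono sum_mono2) auto
  finally show ?thesis .
qed

section \<open>Traces of the resolvent and of its product with the covariance\<close>

context sk_resolvent
begin

abbreviation M where "M g \<equiv> cov n \<beta> g"
abbreviation E :: "((nat \<times> nat \<Rightarrow> real) \<Rightarrow> 'b) \<Rightarrow> 'b::{banach,second_countable_topology}"
  where "E \<equiv> integral\<^sup>L (disorder n)"
abbreviation borel_rv where "borel_rv f \<equiv> f \<in> borel_measurable (disorder n)"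

text \<open>Stieltjes transform of the empirical spectral measure of the coupling matrix.\<close>

definition m where "m g = (\<Sum>k\<in>I. Q g k k) / of_nat n"
definition S where "S g = (\<Sum>j\<in>I. \<Sum>k\<in>I. Q g j k * of_real (M g k j)) / of_nat n"
text \<open>The sign makes it positive, since the Stieltjes transform maps the upper half-plane to
  the lower one.\<close>

definition \<alpha> where "\<alpha> g = - Im (m g)"
definition F where "F g = (\<Sum>j\<in>I. \<Sum>k\<in>I. (norm (Q g j k))\<^sup>2)"
definition V2 where "V2 g = (\<Sum>i\<in>I. \<Sum>j\<in>I. (M g i j)\<^sup>2)"

lemma Q_sym: "i \<in> I \<Longrightarrow> k \<in> I \<Longrightarrow> Q g i k = Q g k i"
  unfolding Q_def by (rule R.Q_sym)

lemma Q_L2: "L2_set (\<lambda>i. norm (\<Sum>j\<in>I. Q g i j * v j)) I \<le> L2_set (\<lambda>i. norm (v i)) I / \<eta>"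
  unfolding Q_def by (rule R.Q_bound)

lemma Q_form_bound:
  "norm (\<Sum>j\<in>I. u j * (\<Sum>k\<in>I. Q g j k * v k)) \<le> L2_set (\<lambda>j. norm (u j)) I * L2_set (\<lambda>j. norm (v j)) I / \<eta>"
  by (rule order_trans[OF cmod_sum_mult_le_L2_set])
     (use mult_left_mono[OF Q_L2 L2_set_nonneg] in simp)

text \<open>The Ward identity summed over columns: the squared Hilbert-Schmidt norm of
  \<open>Q\<close> is a first-order quantity in \<open>m\<close>.\<close>

lemma F_eq: "F g = n * \<alpha> g / \<eta>"
proof -
  have "\<eta> * F g = (\<Sum>k\<in>I. \<eta> * (\<Sum>j\<in>I. (norm (Q g j k))\<^sup>2))"
    unfolding F_def by (subst sum.swap) (simp add: sum_distrib_left)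
  also have "\<dots> = (\<Sum>k\<in>I. - Im (Q g k k))"
    unfolding Q_def by (intro sum.cong refl R.ward)
  also have "\<dots> = n * \<alpha> g"
    using n by (simp add: \<alpha>_def m_def sum_negf Im_divide_of_nat)
  finally show ?thesis using Im_z by (simp add: field_simps)
qed

text \<open>A vanishing \<open>Q\<close> contradicts \<open>(z - A) Q = 1\<close>. Strict positivity
  matters because \<open>a\<close>, the mean of \<open>\<alpha>\<close>, is later cancelled from an
  inequality.\<close>

lemma F_pos: "F g > 0"
proof (rule ccontr)
  assume "\<not> F g > 0"
  then have "F g = 0" unfolding F_def by (meson linorder_not_le order_antisym sum_nonneg zero_le_power2)
  then have 0: "Q g j k = 0" if "j \<in> I" "k \<in> I" for j k
    using that by (simp add: F_def sum_nonneg_eq_0_iff sum_nonneg)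
  have 1: "1 \<in> I" using n by simp
  have "z * Q g 1 1 - (\<Sum>j\<in>I. of_real (coupling n g 1 j) * Q g j 1) = 1"
    unfolding Q_def by (subst R.right_inverse[OF 1 1]) simp
  then show False using 0 1 by simp
qed

lemma \<alpha>_pos: "\<alpha> g > 0"
  using F_pos[of g] n Im_z unfolding F_eq by (simp add: zero_less_divide_iff zero_less_mult_iff)

lemma m_bound: "norm (m g) \<le> 1 / \<eta>"
proof -
  have "norm (\<Sum>k\<in>I. Q g k k) \<le> (\<Sum>k\<in>I. 1 / \<eta>)"
    by (rule order_trans[OF norm_sum], rule sum_mono, rule Q_entry_bound)
  then show ?thesis using n Im_z by (simp add: m_def norm_divide field_simps)
qed

lemma \<alpha>_bound: "\<alpha> g \<le> 1 / \<eta>"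
  using m_bound[of g] abs_Im_le_cmod[of "m g"] by (simp add: \<alpha>_def)

lemma spin_L2: "\<sigma> \<in> spins n \<Longrightarrow> L2_set \<sigma> I = sqrt n"
  by (simp add: L2_set_def power2_eq_square spin_square)

text \<open>Linear functionals of the covariance are Gibbs averages, so a bound that is uniform over the spins suffices.\<close>

lemma norm_cov_sum_le:
  fixes c :: "nat \<Rightarrow> nat \<Rightarrow> complex"
  assumes "\<And>\<sigma>. \<sigma> \<in> spins n \<Longrightarrow> norm (\<Sum>i\<in>I. \<Sum>k\<in>I. c i k * of_real (\<sigma> k * \<sigma> i)) \<le> C"
  shows "norm (\<Sum>i\<in>I. \<Sum>k\<in>I. c i k * of_real (M g k i)) \<le> C"
proof -
  let ?f = "\<lambda>\<sigma>. \<Sum>i\<in>I. \<Sum>k\<in>I. c i k * of_real (\<sigma> k * \<sigma> i)"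
  have "(\<Sum>i\<in>I. \<Sum>k\<in>I. c i k * of_real (M g k i))
      = (\<Sum>i\<in>I. \<Sum>k\<in>I. \<Sum>\<sigma>\<in>spins n. c i k * of_real (\<sigma> k * \<sigma> i) * of_real (gibbs n \<beta> g \<sigma>))"
    unfolding cov_def bracket_def of_real_sum of_real_mult sum_distrib_left mult.assoc by (rule refl)
  also have "\<dots> = (\<Sum>i\<in>I. \<Sum>\<sigma>\<in>spins n. \<Sum>k\<in>I. c i k * of_real (\<sigma> k * \<sigma> i) * of_real (gibbs n \<beta> g \<sigma>))"
    by (intro sum.cong refl sum.swap)
  also have "\<dots> = (\<Sum>\<sigma>\<in>spins n. ?f \<sigma> * of_real (gibbs n \<beta> g \<sigma>))"
    unfolding sum_distrib_right by (rule sum.swap)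
  finally have "norm (\<Sum>i\<in>I. \<Sum>k\<in>I. c i k * of_real (M g k i)) \<le> (\<Sum>\<sigma>\<in>spins n. norm (?f \<sigma> * of_real (gibbs n \<beta> g \<sigma>)))"
    by (simp only: norm_sum)
  also have "\<dots> \<le> (\<Sum>\<sigma>\<in>spins n. C * gibbs n \<beta> g \<sigma>)"
  proof (rule sum_mono)
    fix \<sigma> assume \<sigma>: "\<sigma> \<in> spins n"
    show "norm (?f \<sigma> * of_real (gibbs n \<beta> g \<sigma>)) \<le> C * gibbs n \<beta> g \<sigma>"
      unfolding norm_mult norm_of_real abs_of_nonneg[OF gibbs_nonneg]
      by (intro mult_right_mono assms gibbs_nonneg \<sigma>)
  qed
  also have "\<dots> = C" by (simp add: sum_distrib_left[symmetric] gibbs_sum)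
  finally show ?thesis .
qed

lemma S_bound: "norm (S g) \<le> 1 / \<eta>"
proof -
  have "norm (\<Sum>j\<in>I. \<Sum>k\<in>I. Q g j k * of_real (M g k j)) \<le> n / \<eta>"
  proof (rule norm_cov_sum_le)
    fix \<sigma> assume \<sigma>: "\<sigma> \<in> spins n"
    have "(\<Sum>j\<in>I. \<Sum>k\<in>I. Q g j k * of_real (\<sigma> k * \<sigma> j))
        = (\<Sum>j\<in>I. of_real (\<sigma> j) * (\<Sum>k\<in>I. Q g j k * of_real (\<sigma> k)))"
      by (simp add: sum_distrib_left mult_ac)
    with Q_form_bound[of "\<lambda>j. of_real (\<sigma> j)" g "\<lambda>j. of_real (\<sigma> j)"]
    show "norm (\<Sum>j\<in>I. \<Sum>k\<in>I. Q g j k * of_real (\<sigma> k * \<sigma> j)) \<le> n / \<eta>"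
      unfolding L2_set_of_real spin_L2[OF \<sigma>] by simp
  qed
  then show ?thesis using n Im_z by (simp add: S_def norm_divide field_simps)
qed

text \<open>For one spin configuration this is the sum of the squared entries of
  \<open>Q \<sigma>\<close> (without conjugation), and \<open>Q \<sigma>\<close> has norm at most
  \<open>sqrt n / \<eta>\<close>.\<close>

lemma T1_bound: "norm (\<Sum>i\<in>I. \<Sum>k\<in>I. (\<Sum>j\<in>I. Q g j i * Q g j k) * of_real (M g k i)) \<le> n / \<eta>\<^sup>2"
proof (rule norm_cov_sum_le)
  fix \<sigma> assume \<sigma>: "\<sigma> \<in> spins n"
  let ?y = "\<lambda>j. \<Sum>k\<in>I. Q g j k * of_real (\<sigma> k)"
  have "(\<Sum>i\<in>I. \<Sum>k\<in>I. (\<Sum>j\<in>I. Q g j i * Q g j k) * of_real (\<sigma> k * \<sigma> i))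
      = (\<Sum>i\<in>I. \<Sum>k\<in>I. \<Sum>j\<in>I. (Q g j i * of_real (\<sigma> i)) * (Q g j k * of_real (\<sigma> k)))"
    unfolding sum_distrib_right by (intro sum.cong refl) simp
  also have "\<dots> = (\<Sum>i\<in>I. \<Sum>j\<in>I. \<Sum>k\<in>I. (Q g j i * of_real (\<sigma> i)) * (Q g j k * of_real (\<sigma> k)))"
    by (intro sum.cong refl sum.swap)
  also have "\<dots> = (\<Sum>j\<in>I. \<Sum>i\<in>I. \<Sum>k\<in>I. (Q g j i * of_real (\<sigma> i)) * (Q g j k * of_real (\<sigma> k)))"
    by (rule sum.swap)
  also have "\<dots> = (\<Sum>j\<in>I. ?y j * ?y j)"
    by (simp add: sum_product)
  finally have eq: "(\<Sum>i\<in>I. \<Sum>k\<in>I. (\<Sum>j\<in>I. Q g j i * Q g j k) * of_real (\<sigma> k * \<sigma> i)) = (\<Sum>j\<in>I. ?y j * ?y j)" .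
  have y: "L2_set (\<lambda>j. norm (?y j)) I \<le> sqrt n / \<eta>"
    using Q_L2[of g "\<lambda>k. of_real (\<sigma> k)"] unfolding L2_set_of_real spin_L2[OF \<sigma>] .
  have "norm (\<Sum>j\<in>I. ?y j * ?y j) \<le> L2_set (\<lambda>j. norm (?y j)) I * L2_set (\<lambda>j. norm (?y j)) I"
    by (rule cmod_sum_mult_le_L2_set)
  also have "\<dots> \<le> (sqrt n / \<eta>) * (sqrt n / \<eta>)"
    by (intro mult_mono y) (use Im_z in auto)
  finally show "norm (\<Sum>i\<in>I. \<Sum>k\<in>I. (\<Sum>j\<in>I. Q g j i * Q g j k) * of_real (\<sigma> k * \<sigma> i)) \<le> n / \<eta>\<^sup>2"
    unfolding eq by (simp add: power2_eq_square)
qed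

text \<open>The diagonal of \<open>Q\<close> acts on the spins as multiplication by numbers of
  modulus at most \<open>1 / \<eta>\<close>, and the remaining \<open>Q\<close> costs another factor
  \<open>1 / \<eta>\<close>.\<close>

lemma T2_bound: "norm (\<Sum>i\<in>I. \<Sum>k\<in>I. (Q g i i * Q g i k) * of_real (M g k i)) \<le> n / \<eta>\<^sup>2"
proof (rule norm_cov_sum_le)
  fix \<sigma> assume \<sigma>: "\<sigma> \<in> spins n"
  let ?u = "\<lambda>i. Q g i i * of_real (\<sigma> i)"
  have eq: "(\<Sum>i\<in>I. \<Sum>k\<in>I. (Q g i i * Q g i k) * of_real (\<sigma> k * \<sigma> i))
      = (\<Sum>i\<in>I. ?u i * (\<Sum>k\<in>I. Q g i k * of_real (\<sigma> k)))"
    by (simp add: sum_distrib_left mult_ac)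
  have "L2_set (\<lambda>i. norm (?u i)) I \<le> L2_set (\<lambda>i. 1 / \<eta> * \<bar>\<sigma> i\<bar>) I"
    unfolding norm_mult norm_of_real by (intro L2_set_mono mult_right_mono Q_entry_bound) auto
  also have "\<dots> = sqrt n / \<eta>"
  proof -
    have "L2_set (\<lambda>i. \<bar>\<sigma> i\<bar>) I = L2_set \<sigma> I" by (simp add: L2_set_def)
    then show ?thesis
      using spin_L2[OF \<sigma>] Im_z by (subst L2_set_right_distrib[symmetric]) auto
  qed
  finally have u: "L2_set (\<lambda>i. norm (?u i)) I \<le> sqrt n / \<eta>" .
  have "L2_set (\<lambda>i. norm (?u i)) I * sqrt n / \<eta> \<le> sqrt n / \<eta> * sqrt n / \<eta>"
    using Im_z by (intro divide_right_mono mult_right_mono u) auto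
  then show "norm (\<Sum>i\<in>I. \<Sum>k\<in>I. (Q g i i * Q g i k) * of_real (\<sigma> k * \<sigma> i)) \<le> n / \<eta>\<^sup>2"
    using Q_form_bound[of ?u g "\<lambda>j. of_real (\<sigma> j)"]
    unfolding eq L2_set_of_real spin_L2[OF \<sigma>] by (simp add: power2_eq_square)
qed

text \<open>This is \<open>tr (Q M\<^sup>2)\<close>: each row of \<open>M\<close> is paired with its
  image under \<open>Q\<close>. It is the one error term that is not small by itself and the source
  of \<nu> in the estimates.\<close>

lemma T3_bound: "norm (\<Sum>i\<in>I. \<Sum>j\<in>I. \<Sum>k\<in>I. Q g j k * of_real (M g k i) * of_real (M g i j)) \<le> V2 g / \<eta>"
proof -
  have "norm (\<Sum>j\<in>I. \<Sum>k\<in>I. Q g j k * of_real (M g k i) * of_real (M g i j)) \<le> (\<Sum>j\<in>I. (M g i j)\<^sup>2) / \<eta>" for i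
  proof -
    have "(\<Sum>j\<in>I. \<Sum>k\<in>I. Q g j k * of_real (M g k i) * of_real (M g i j))
        = (\<Sum>j\<in>I. of_real (M g i j) * (\<Sum>k\<in>I. Q g j k * of_real (M g i k)))"
      by (simp add: sum_distrib_left mult_ac cov_sym[of n \<beta> g _ i])
    with Q_form_bound[of "\<lambda>j. of_real (M g i j)" g "\<lambda>j. of_real (M g i j)"] show ?thesis
      unfolding L2_set_of_real by (simp add: L2_set_def sum_nonneg)
  qed
  then have "norm (\<Sum>i\<in>I. \<Sum>j\<in>I. \<Sum>k\<in>I. Q g j k * of_real (M g k i) * of_real (M g i j)) \<le> (\<Sum>i\<in>I. (\<Sum>j\<in>I. (M g i j)\<^sup>2) / \<eta>)"
    by (rule order_trans[OF norm_sum sum_mono])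
  then show ?thesis by (simp add: V2_def sum_divide_distrib)
qed

text \<open>Cauchy-Schwarz over index pairs: the trace of \<open>Q M\<close> against the
  Hilbert-Schmidt norms of both factors.\<close>

lemma S_le_V2: "norm (S g) \<le> sqrt (V2 g) * sqrt (F g) / n"
proof -
  have "norm (\<Sum>p\<in>I \<times> I. Q g (fst p) (snd p) * of_real (M g (snd p) (fst p)))
      \<le> L2_set (\<lambda>p. norm (Q g (fst p) (snd p))) (I \<times> I) * L2_set (\<lambda>p. norm (complex_of_real (M g (snd p) (fst p)))) (I \<times> I)"
    by (rule cmod_sum_mult_le_L2_set)
  also have "\<dots> = sqrt (F g) * sqrt (V2 g)"
    unfolding L2_set_of_real
    by (simp add: L2_set_def F_def V2_def sum.cartesian_product case_prod_unfold cov_sym[of n \<beta> g "fst _"])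
  finally have "norm (\<Sum>j\<in>I. \<Sum>k\<in>I. Q g j k * of_real (M g k j)) \<le> sqrt (V2 g) * sqrt (F g)"
    by (simp add: sum.cartesian_product case_prod_unfold mult.commute)
  then show ?thesis using n by (simp add: S_def norm_divide divide_right_mono)
qed

lemma meas_m: "borel_rv m"
  unfolding m_def by (intro borel_measurable_divide borel_measurable_sum measurable_Q borel_measurable_const)

lemma meas_cov: "borel_rv (\<lambda>g. complex_of_real (M g i j))"
proof -
  note measurable_cov [measurable]
  show ?thesis by measurable
qed

lemma meas_S: "borel_rv S"
  unfolding S_def
  by (intro borel_measurable_divide borel_measurable_sum borel_measurable_times measurable_Q
      meas_cov borel_measurable_const)

lemma meas_V2: "borel_rv V2"
  unfolding V2_def by (intro borel_measurable_sum borel_measurable_power measurable_cov)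

lemma V2_bounds: "0 \<le> V2 g" "V2 g \<le> (real n)\<^sup>2"
proof -
  show "0 \<le> V2 g" unfolding V2_def by (intro sum_nonneg zero_le_power2)
  have "V2 g \<le> (\<Sum>i\<in>I. \<Sum>j\<in>I. 1)"
    unfolding V2_def by (intro sum_mono abs_square_le_1[THEN iffD2] cov_abs_le)
  then show "V2 g \<le> (real n)\<^sup>2" by (simp add: power2_eq_square)
qed

text \<open>The couplings have zero diagonal, so integration by parts yields a sum over
  \<open>j \<noteq> i\<close>. Completing it to a full sum later produces diagonal
  corrections.\<close>

lemma sum_ibp:
  fixes X X' :: "nat \<Rightarrow> nat \<Rightarrow> (nat \<times> nat \<Rightarrow> real) \<Rightarrow> complex"
  assumes "\<And>i j. i \<in> I \<Longrightarrow> j \<in> I \<Longrightarrow> i \<noteq> j \<Longrightarrow> pd (min i j, max i j) (X i j) (X' i j)"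
    and "\<And>i j. i \<in> I \<Longrightarrow> j \<in> I \<Longrightarrow> borel_rv (X i j)" "\<And>i j. i \<in> I \<Longrightarrow> j \<in> I \<Longrightarrow> borel_rv (X' i j)"
    and "\<And>i j g. i \<in> I \<Longrightarrow> j \<in> I \<Longrightarrow> norm (X i j g) \<le> C" "\<And>i j g. i \<in> I \<Longrightarrow> j \<in> I \<Longrightarrow> norm (X' i j g) \<le> C'"
  shows "E (\<lambda>g. \<Sum>i\<in>I. \<Sum>j\<in>I. of_real (coupling n g i j) * X i j g)
    = E (\<lambda>g. \<Sum>i\<in>I. \<Sum>j\<in>I - {i}. X' i j g) / sqrt (real n)"
proof -
  have c: "integrable (disorder n) (\<lambda>g. of_real (coupling n g i j) * X i j g)"
    "E (\<lambda>g. of_real (coupling n g i j) * X i j g) = E (X' i j) / sqrt (real n)"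
    if "i \<in> I" "j \<in> I - {i}" for i j
    using coupling_ibp[of i n j "X i j" "X' i j" C C'] assms that by auto
  have i: "integrable (disorder n) (X' i j)" if "i \<in> I" "j \<in> I - {i}" for i j
    by (rule integrable_disorder_bounded[of _ _ C']) (use assms that in auto)
  have "(\<Sum>i\<in>I. \<Sum>j\<in>I. of_real (coupling n g i j) * X i j g)
      = (\<Sum>i\<in>I. \<Sum>j\<in>I - {i}. of_real (coupling n g i j) * X i j g)" for g
    unfolding sum_off_diag[OF finite_atLeastAtMost] by (simp add: coupling_def)
  then have "E (\<lambda>g. \<Sum>i\<in>I. \<Sum>j\<in>I. of_real (coupling n g i j) * X i j g)
      = E (\<lambda>g. \<Sum>i\<in>I. \<Sum>j\<in>I - {i}. of_real (coupling n g i j) * X i j g)"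
    by simp
  also have "\<dots> = (\<Sum>i\<in>I. E (\<lambda>g. \<Sum>j\<in>I - {i}. of_real (coupling n g i j) * X i j g))"
    by (rule Bochner_Integration.integral_sum, rule Bochner_Integration.integrable_sum, rule c)
  also have "\<dots> = (\<Sum>i\<in>I. \<Sum>j\<in>I - {i}. E (\<lambda>g. of_real (coupling n g i j) * X i j g))"
    by (rule sum.cong[OF refl], rule Bochner_Integration.integral_sum, rule c)
  also have "\<dots> = (\<Sum>i\<in>I. \<Sum>j\<in>I - {i}. E (X' i j) / sqrt (real n))"
    by (rule sum.cong[OF refl], rule sum.cong[OF refl], rule c)
  also have "\<dots> = (\<Sum>i\<in>I. \<Sum>j\<in>I - {i}. E (X' i j)) / sqrt (real n)"
    by (simp only: sum_divide_distrib)
  also have "(\<Sum>i\<in>I. \<Sum>j\<in>I - {i}. E (X' i j)) = (\<Sum>i\<in>I. E (\<lambda>g. \<Sum>j\<in>I - {i}. X' i j g))"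
    by (rule sum.cong[OF refl], rule Bochner_Integration.integral_sum[symmetric], rule i)
  also have "\<dots> = E (\<lambda>g. \<Sum>i\<in>I. \<Sum>j\<in>I - {i}. X' i j g)"
    by (rule Bochner_Integration.integral_sum[symmetric], rule Bochner_Integration.integrable_sum, rule i)
  finally show ?thesis .
qed

lemma meas_norm: "borel_rv f \<Longrightarrow> borel_rv (\<lambda>g. norm (f g))" for f :: "_ \<Rightarrow> complex"
  by measurable

lemma meas_cnj: "borel_rv f \<Longrightarrow> borel_rv (\<lambda>g. cnj (f g))"
  by (rule measurable_compose[OF _ borel_measurable_continuous_onI]) (auto intro: continuous_intros)

section \<open>Mean and concentration of the normalised trace\<close>

definition w where "w = E m"
definition a where "a = - Im w"
definition \<nu> where "\<nu> = E V2 / (real n)\<^sup>2"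
text \<open>The part of \<open>tr (A Q) / n\<close>, after integration by parts, that is not the leading term \<open>m\<^sup>2\<close>.\<close>

definition e1 where "e1 g = ((\<Sum>i\<in>I. \<Sum>j\<in>I - {i}. Q g i j * Q g i j) - (\<Sum>i\<in>I. Q g i i * Q g i i)) / (of_nat n)\<^sup>2"

text \<open>The squares add up to at most \<open>F g\<close>, and the Ward identity turns this into
  a bound carrying the factor \<open>\<alpha> g\<close>. That factor is what \<open>V_le\<close>
  exploits.\<close>

lemma e1_bound: "norm (e1 g) \<le> \<alpha> g / (n * \<eta>)"
proof -
  have "norm ((\<Sum>i\<in>I. \<Sum>j\<in>I - {i}. Q g i j * Q g i j) - (\<Sum>i\<in>I. Q g i i * Q g i i))
      \<le> (\<Sum>i\<in>I. \<Sum>j\<in>I - {i}. (norm (Q g i j))\<^sup>2) + (\<Sum>i\<in>I. (norm (Q g i i))\<^sup>2)"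
    by (rule order_trans[OF norm_triangle_ineq4], rule add_mono)
       ((rule order_trans[OF norm_sum], rule sum_mono)+, simp add: norm_mult power2_eq_square)+
  also have "\<dots> = F g"
    unfolding F_def sum_off_diag[OF finite_atLeastAtMost] by simp
  finally have "norm (e1 g) \<le> F g / (real n)\<^sup>2"
    by (simp add: e1_def norm_divide norm_power divide_right_mono)
  then show ?thesis using n by (simp add: F_eq power2_eq_square mult.commute)
qed

lemma meas_e1: "borel_rv e1"
  unfolding e1_def
  by (intro borel_measurable_divide borel_measurable_diff borel_measurable_sum borel_measurable_times
      measurable_Q borel_measurable_const) auto

text \<open>The diagonal of \<open>z Q - A Q = 1\<close> gives
  \<open>z m - 1 = tr (A Q) / n\<close>. Integrating the couplings by parts against a test function
  \<open>\<phi>\<close>, the derivative of \<open>Q\<close> contributes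
  \<open>m\<^sup>2 + e1\<close> and the derivative of \<open>\<phi>\<close> the last sum. The case
  \<open>\<phi> = 1\<close> gives the quadratic equation, \<open>\<phi> = cnj (m - w)\<close> the
  concentration.\<close>

lemma m_identity:
  assumes pd: "\<And>i j. i \<in> I \<Longrightarrow> j \<in> I \<Longrightarrow> i \<noteq> j \<Longrightarrow> pd (min i j, max i j) \<phi> (\<phi>' i j)"
    and meas: "borel_rv \<phi>" "\<And>i j. i \<in> I \<Longrightarrow> j \<in> I \<Longrightarrow> borel_rv (\<phi>' i j)"
    and b: "\<And>g. norm (\<phi> g) \<le> C" "\<And>i j g. i \<in> I \<Longrightarrow> j \<in> I \<Longrightarrow> norm (\<phi>' i j g) \<le> C'"
  shows "E (\<lambda>g. (z * m g - 1) * \<phi> g)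
    = E (\<lambda>g. ((m g)\<^sup>2 + e1 g) * \<phi> g + (\<Sum>i\<in>I. \<Sum>j\<in>I - {i}. Q g i j * \<phi>' i j g) / (of_nat n * sqrt n))"
proof -
  have n0: "real n > 0" using n by simp
  let ?r = "complex_of_real (sqrt n)"
  have rr: "?r * ?r = of_nat n" "?r \<noteq> 0"
    using n0 by (simp_all flip: of_real_mult)
  define X where "X i j g = Q g i j * \<phi> g" for i j g
  define X' where "X' i j g = Q g i j * \<phi>' i j g + (Q g i i * Q g j j + Q g i j * Q g i j) / ?r * \<phi> g" for i j g
  have C: "C \<ge> 0" using order_trans[OF norm_ge_zero b(1)] .
  have ibp: "E (\<lambda>g. \<Sum>i\<in>I. \<Sum>j\<in>I. of_real (coupling n g i j) * X i j g)
      = E (\<lambda>g. \<Sum>i\<in>I. \<Sum>j\<in>I - {i}. X' i j g) / ?r"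
  proof (rule sum_ibp)
    fix i j assume ij: "i \<in> I" "j \<in> I"
    show "borel_rv (X i j)" "borel_rv (X' i j)"
      unfolding X_def X'_def
      by (intro borel_measurable_add borel_measurable_divide borel_measurable_times borel_measurable_const measurable_Q meas ij)+
    {
      assume "i \<noteq> j"
      show "pd (min i j, max i j) (X i j) (X' i j)"
        unfolding X_def X'_def using pd_mult[OF pd_Q[OF ij \<open>i \<noteq> j\<close> ij] pd[OF ij \<open>i \<noteq> j\<close>]] by simp
    }
    fix g
    show "norm (X i j g) \<le> 1 / \<eta> * C"
      unfolding X_def norm_mult by (intro mult_mono Q_entry_bound ij b) (use Im_z in auto)
    have "norm (Q g i j * \<phi>' i j g) \<le> 1 / \<eta> * C'"
      unfolding norm_mult by (intro mult_mono Q_entry_bound ij b) (use Im_z in auto)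
    moreover have "norm ((Q g i i * Q g j j + Q g i j * Q g i j) / ?r * \<phi> g)
        \<le> (1 / \<eta> * (1 / \<eta>) + 1 / \<eta> * (1 / \<eta>)) / sqrt n * C"
      unfolding norm_mult norm_divide norm_of_real abs_of_nonneg[OF real_sqrt_ge_zero[OF of_nat_0_le_iff]]
    proof (intro mult_mono divide_right_mono b order_trans[OF norm_triangle_ineq] add_mono)
      show "norm (Q g i i * Q g j j) \<le> 1 / \<eta> * (1 / \<eta>)" "norm (Q g i j * Q g i j) \<le> 1 / \<eta> * (1 / \<eta>)"
        unfolding norm_mult by (intro mult_mono Q_entry_bound ij; use Im_z in simp)+
    qed (use Im_z C in auto)
    ultimately show "norm (X' i j g) \<le> 1 / \<eta> * C' + (1 / \<eta> * (1 / \<eta>) + 1 / \<eta> * (1 / \<eta>)) / sqrt n * C"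
      unfolding X'_def by (intro order_trans[OF norm_triangle_ineq] add_mono)
  qed
  have l: "(\<Sum>i\<in>I. \<Sum>j\<in>I. of_real (coupling n g i j) * X i j g) = of_nat n * ((z * m g - 1) * \<phi> g)" for g
  proof -
    have "(\<Sum>j\<in>I. of_real (coupling n g i j) * X i j g) = (z * Q g i i - 1) * \<phi> g" if i: "i \<in> I" for i
    proof -
      have "z * Q g i i - (\<Sum>j\<in>I. of_real (coupling n g i j) * Q g j i) = 1"
        unfolding Q_def by (subst R.right_inverse[OF i i]) simp
      then have e: "z * Q g i i - 1 = (\<Sum>j\<in>I. of_real (coupling n g i j) * Q g j i)" by (simp add: algebra_simps)
      show ?thesis
        unfolding e X_def sum_distrib_right using Q_sym[OF i] by (intro sum.cong refl) simp
    qed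
    then have "(\<Sum>i\<in>I. \<Sum>j\<in>I. of_real (coupling n g i j) * X i j g) = (\<Sum>i\<in>I. (z * Q g i i - 1) * \<phi> g)"
      by (intro sum.cong refl)
    also have "\<dots> = (z * (\<Sum>i\<in>I. Q g i i) - of_nat n) * \<phi> g"
      by (simp add: sum_distrib_right[symmetric] sum_subtractf sum_distrib_left)
    also have "(\<Sum>i\<in>I. Q g i i) = of_nat n * m g" using n by (simp add: m_def)
    finally show ?thesis by (simp add: algebra_simps)
  qed
  have r: "(\<Sum>i\<in>I. \<Sum>j\<in>I - {i}. X' i j g) / ?r
      = of_nat n * (((m g)\<^sup>2 + e1 g) * \<phi> g + (\<Sum>i\<in>I. \<Sum>j\<in>I - {i}. Q g i j * \<phi>' i j g) / (of_nat n * ?r))" for g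
  proof -
    define P1 where "P1 = (\<Sum>i\<in>I. \<Sum>j\<in>I - {i}. Q g i j * \<phi>' i j g)"
    define P2 where "P2 = (\<Sum>i\<in>I. \<Sum>j\<in>I - {i}. Q g i i * Q g j j)"
    define P3 where "P3 = (\<Sum>i\<in>I. \<Sum>j\<in>I - {i}. Q g i j * Q g i j)"
    define P4 where "P4 = (\<Sum>i\<in>I. Q g i i * Q g i i)"
    have "(\<Sum>i\<in>I. Q g i i) = of_nat n * m g" using n by (simp add: m_def)
    then have P2: "P2 = (of_nat n * m g)\<^sup>2 - P4"
      unfolding P2_def P4_def sum_off_diag[OF finite_atLeastAtMost] by (simp add: power2_eq_square sum_product[symmetric])
    have "(\<Sum>i\<in>I. \<Sum>j\<in>I - {i}. X' i j g) = P1 + (P2 + P3) / ?r * \<phi> g"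
      unfolding X'_def P1_def P2_def P3_def
      by (simp only: sum.distrib sum_distrib_right sum_divide_distrib add_divide_distrib distrib_right)
    moreover have "P2 + P3 = (of_nat n)\<^sup>2 * ((m g)\<^sup>2 + e1 g)"
      unfolding P2 e1_def P3_def[symmetric] P4_def[symmetric] using n by (simp add: power_mult_distrib distrib_left)
    moreover have "(p + (of_nat n)\<^sup>2 * s / ?r * f) / ?r = of_nat n * (s * f + p / (of_nat n * ?r))" for p s f
    proof -
      have "(p + (of_nat n)\<^sup>2 * s / ?r * f) / ?r = p / ?r + (of_nat n)\<^sup>2 * s * f / (?r * ?r)"
        by (simp add: add_divide_distrib)
      also have "\<dots> = of_nat n * (s * f + p / (of_nat n * ?r))"
        using n rr by (simp add: power2_eq_square field_simps)
      finally show ?thesis .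
    qed
    ultimately show ?thesis unfolding P1_def[symmetric] by simp
  qed
  have "of_nat n * E (\<lambda>g. (z * m g - 1) * \<phi> g) = of_nat n * E (\<lambda>g. ((m g)\<^sup>2 + e1 g) * \<phi> g + (\<Sum>i\<in>I. \<Sum>j\<in>I - {i}. Q g i j * \<phi>' i j g) / (of_nat n * ?r))"
    using ibp unfolding l integral_divide_zero[symmetric] r integral_mult_right_zero .
  then show ?thesis using n by simp
qed

lemma int_m: "integrable (disorder n) m"
  by (rule integrable_disorder_bounded[OF meas_m m_bound])

lemma meas_\<alpha>: "borel_rv \<alpha>"
proof -
  note meas_m [measurable]
  show ?thesis unfolding \<alpha>_def by measurable
qed

lemma int_\<alpha>: "integrable (disorder n) \<alpha>"
  by (rule integrable_disorder_bounded[OF meas_\<alpha>, of "1 / \<eta>"]) (use \<alpha>_pos \<alpha>_bound in \<open>simp add: less_imp_le\<close>)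

lemma a_eq: "a = E \<alpha>"
  unfolding a_def w_def \<alpha>_def
  using integral_bounded_linear[OF bounded_linear_Im int_m] by simp

lemma a_pos: "a > 0"
proof -
  interpret prob_space "disorder n" by (rule prob_space_disorder)
  have "E (\<lambda>g. - \<alpha> g) < 0"
    by (rule expectation_less) (use int_\<alpha> \<alpha>_pos in auto)
  then show ?thesis unfolding a_eq by simp
qed

lemma w_bound: "norm w \<le> 1 / \<eta>"
proof -
  interpret prob_space "disorder n" by (rule prob_space_disorder)
  have "norm w \<le> E (\<lambda>g. norm (m g))" unfolding w_def by (rule integral_norm_bound)
  also have "\<dots> \<le> E (\<lambda>g. 1 / \<eta>)"
    by (rule integral_mono) (use int_m m_bound in auto)
  finally show ?thesis by (simp add: prob_space)
qed

definition D where "D = E (\<lambda>g. norm (m g - w))"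
definition V where "V = E (\<lambda>g. (norm (m g - w))\<^sup>2)"

lemma dev_bound: "norm (m g - w) \<le> 2 / \<eta>"
  using norm_triangle_ineq4[of "m g" w] m_bound[of g] w_bound by simp

lemma meas_dev: "borel_rv (\<lambda>g. m g - w)"
  by (intro borel_measurable_diff meas_m borel_measurable_const)

lemma int_dev: "integrable (disorder n) (\<lambda>g. norm (m g - w))"
  by (rule integrable_disorder_bounded[of _ _ "2 / \<eta>"]) (use meas_norm[OF meas_dev] dev_bound in auto)

lemma int_dev2: "integrable (disorder n) (\<lambda>g. (norm (m g - w))\<^sup>2)"
proof (rule integrable_disorder_bounded[of _ _ "(2 / \<eta>)\<^sup>2"])
  show "norm ((norm (m g - w))\<^sup>2) \<le> (2 / \<eta>)\<^sup>2" for g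
    using power_mono[OF dev_bound[of g], of 2] by simp
qed (intro borel_measurable_power meas_norm meas_dev)

lemma V_nonneg: "V \<ge> 0" unfolding V_def by (rule Bochner_Integration.integral_nonneg) simp

text \<open>AM-GM, weighted so that \<open>V\<close> can be absorbed in the quadratic inequality for it below.\<close>

lemma D_le: "D \<le> V * (n * \<eta>) / 4 + 1 / (n * \<eta>)"
proof -
  interpret prob_space "disorder n" by (rule prob_space_disorder)
  have c: "n * \<eta> > 0" using n Im_z by simp
  have "x \<le> x\<^sup>2 * (c / 4) + 1 / c" if "c > 0" for x c :: real
  proof -
    have "0 \<le> (x * c / 2 - 1)\<^sup>2 / c" using that by simp
    also have "\<dots> = x\<^sup>2 * (c / 4) + 1 / c - x"
      using that by (simp add: power2_eq_square field_simps)
    finally show ?thesis by simp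
  qed
  note this[OF c]
  then have "D \<le> E (\<lambda>g. (norm (m g - w))\<^sup>2 * (n * \<eta> / 4) + 1 / (n * \<eta>))"
    unfolding D_def using int_dev int_dev2 by (intro integral_mono) auto
  also have "\<dots> = V * (n * \<eta> / 4) + 1 / (n * \<eta>)"
    unfolding V_def using int_dev2 by (simp add: prob_space)
  finally show ?thesis by simp
qed

lemma pd_m:
  assumes ij: "i \<in> I" "j \<in> I" "i \<noteq> j"
  shows "pd (min i j, max i j) m (\<lambda>g. 2 * (\<Sum>k\<in>I. Q g i k * Q g k j) / (of_nat n * sqrt n))"
proof -
  have "pd (min i j, max i j) (\<lambda>g. (1 / of_nat n) * (\<Sum>k\<in>I. Q g k k))
     (\<lambda>g. (1 / of_nat n) * (\<Sum>k\<in>I. (Q g k i * Q g j k + Q g k j * Q g i k) / complex_of_real (sqrt n)))"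
    by (intro pd_cmult pd_sum pd_Q ij)
  moreover have "(1 / of_nat n) * (\<Sum>k\<in>I. (Q g k i * Q g j k + Q g k j * Q g i k) / complex_of_real (sqrt n))
      = 2 * (\<Sum>k\<in>I. Q g i k * Q g k j) / (of_nat n * sqrt n)" for g
  proof -
    have "(\<Sum>k\<in>I. (Q g k i * Q g j k + Q g k j * Q g i k) / complex_of_real (sqrt n))
        = (\<Sum>k\<in>I. 2 * (Q g i k * Q g k j) / complex_of_real (sqrt n))"
      using Q_sym[OF ij(1), of _ g] Q_sym[OF ij(2), of _ g] by (intro sum.cong refl) simp
    also have "\<dots> = 2 * (\<Sum>k\<in>I. Q g i k * Q g k j) / complex_of_real (sqrt n)"
      by (simp add: sum_distrib_left sum_divide_distrib)
    finally show ?thesis by simp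
  qed
  ultimately show ?thesis unfolding m_def by simp
qed

text \<open>One of the three factors \<open>Q\<close> is bounded in operator norm, column by column;
  the other two stay together as \<open>F\<close>, which preserves the factor
  \<open>\<alpha>\<close>.\<close>

lemma Q_square_bound: "(\<Sum>i\<in>I. \<Sum>j\<in>I. norm (Q g i j) * norm (\<Sum>k\<in>I. Q g i k * Q g k j)) \<le> F g / \<eta>"
proof -
  let ?q = "\<lambda>i j. \<Sum>k\<in>I. Q g i k * Q g k j"
  have col: "(\<Sum>i\<in>I. norm (Q g i j) * norm (?q i j)) \<le> (\<Sum>i\<in>I. (norm (Q g i j))\<^sup>2) / \<eta>" for j
  proof -
    let ?L = "L2_set (\<lambda>i. norm (Q g i j)) I"
    have "(\<Sum>i\<in>I. norm (Q g i j) * norm (?q i j)) \<le> ?L * L2_set (\<lambda>i. norm (?q i j)) I"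
      using L2_set_mult_ineq[of "\<lambda>i. norm (Q g i j)" "\<lambda>i. norm (?q i j)" I] by simp
    also have "\<dots> \<le> ?L * (?L / \<eta>)"
      by (intro mult_left_mono Q_L2 L2_set_nonneg)
    also have "\<dots> = (\<Sum>i\<in>I. (norm (Q g i j))\<^sup>2) / \<eta>"
      by (simp add: L2_set_def sum_nonneg)
    finally show ?thesis .
  qed
  have "(\<Sum>i\<in>I. \<Sum>j\<in>I. norm (Q g i j) * norm (?q i j)) = (\<Sum>j\<in>I. \<Sum>i\<in>I. norm (Q g i j) * norm (?q i j))"
    by (rule sum.swap)
  also have "\<dots> \<le> (\<Sum>j\<in>I. (\<Sum>i\<in>I. (norm (Q g i j))\<^sup>2) / \<eta>)"
    by (intro sum_mono col)
  also have "\<dots> = F g / \<eta>"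
    unfolding F_def sum_divide_distrib[symmetric] by (subst sum.swap) (rule refl)
  finally show ?thesis .
qed

text \<open>
  Integration by parts against \<open>cnj (m - w)\<close> gives \<open>E (|m - w|\<^sup>2 (z - m - w))\<close> up to small terms. The imaginary
  part of the last factor is \<open>\<eta> + \<alpha> + a\<close>; the factor \<open>a\<close> it provides cancels against the same factor in
  the error terms, which is what makes the bound sharp enough.
\<close>

lemma V_le:
  assumes big: "n * \<eta>\<^sup>2 \<ge> 1"
  shows "V \<le> 4 / (n * \<eta>)\<^sup>2" and "D \<le> 2 / (n * \<eta>)"
proof -
  interpret prob_space "disorder n" by (rule prob_space_disorder)
  define c where "c = n * \<eta>"
  have c: "c > 0" using n Im_z by (simp add: c_def)
  define \<phi> where "\<phi> g = cnj (m g) - cnj w" for g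
  define q where "q i j g = 2 * (\<Sum>k\<in>I. Q g i k * Q g k j) / (of_nat n * complex_of_real (sqrt n))" for i j g
  define r where "r g = (\<Sum>i\<in>I. \<Sum>j\<in>I - {i}. Q g i j * cnj (q i j g)) / (of_nat n * sqrt n)" for g
  have n\<phi>: "norm (\<phi> g) = norm (m g - w)" for g
    unfolding \<phi>_def by (simp flip: complex_cnj_diff)
  have meas_q: "borel_rv (q i j)" if "i \<in> I" "j \<in> I" for i j
    unfolding q_def using that
    by (intro borel_measurable_divide borel_measurable_sum borel_measurable_times measurable_Q borel_measurable_const) auto
  note meas_m [measurable] meas_e1 [measurable] meas_\<alpha> [measurable]
  have meas_\<phi> [measurable]: "borel_rv \<phi>"
    unfolding \<phi>_def by (intro borel_measurable_diff meas_cnj meas_m borel_measurable_const)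
  have meas_cq: "borel_rv (\<lambda>g. cnj (q i j g))" if "i \<in> I" "j \<in> I" for i j
    by (rule meas_cnj[OF meas_q[OF that]])
  have meas_r [measurable]: "borel_rv r"
    unfolding r_def by (intro borel_measurable_divide borel_measurable_sum borel_measurable_times measurable_Q borel_measurable_const meas_cq) auto
  have q_le: "norm (q i j g) \<le> 2 * (n * (1 / \<eta> * (1 / \<eta>))) / (n * sqrt n)" if ij: "i \<in> I" "j \<in> I" for i j g
  proof -
    have "norm (\<Sum>k\<in>I. Q g i k * Q g k j) \<le> (\<Sum>k\<in>I. 1 / \<eta> * (1 / \<eta>))"
    proof (rule order_trans[OF norm_sum], rule sum_mono)
      fix k assume "k \<in> I"
      then show "norm (Q g i k * Q g k j) \<le> 1 / \<eta> * (1 / \<eta>)"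
        unfolding norm_mult using ij Im_z by (intro mult_mono Q_entry_bound) auto
    qed
    also have "\<dots> = n * (1 / \<eta> * (1 / \<eta>))" by simp
    finally have "2 * norm (\<Sum>k\<in>I. Q g i k * Q g k j) / (n * sqrt n) \<le> 2 * (n * (1 / \<eta> * (1 / \<eta>))) / (n * sqrt n)"
      by (intro divide_right_mono mult_left_mono) auto
    moreover have "norm (q i j g) = 2 * norm (\<Sum>k\<in>I. Q g i k * Q g k j) / (n * sqrt n)"
      by (simp add: q_def norm_divide norm_mult)
    ultimately show ?thesis by simp
  qed
  have id: "E (\<lambda>g. (z * m g - 1) * \<phi> g) = E (\<lambda>g. ((m g)\<^sup>2 + e1 g) * \<phi> g + r g)"
    unfolding r_def
  proof (rule m_identity)
    fix i j assume ij: "i \<in> I" "j \<in> I"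
    show "borel_rv (\<lambda>g. cnj (q i j g))" using ij by (rule meas_cq)
    show "norm (cnj (q i j g)) \<le> 2 * (n * (1 / \<eta> * (1 / \<eta>))) / (n * sqrt n)" for g
      using q_le[OF ij] by simp
    assume "i \<noteq> j"
    from pd_diff[OF pd_cnj[OF pd_m[OF ij this]] pd_const[of _ "cnj w"]]
    show "pd (min i j, max i j) \<phi> (\<lambda>g. cnj (q i j g))" unfolding \<phi>_def q_def by simp
  qed (use n\<phi> dev_bound meas_\<phi> in auto)
  have e1\<phi>: "norm (e1 g * \<phi> g) \<le> \<alpha> g / c * norm (m g - w)" for g
    unfolding norm_mult n\<phi> c_def by (intro mult_right_mono e1_bound) simp
  have r_le: "norm (r g) \<le> 2 * \<alpha> g / c\<^sup>2" for g
  proof -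
    have "norm (\<Sum>i\<in>I. \<Sum>j\<in>I - {i}. Q g i j * cnj (q i j g)) \<le> (\<Sum>i\<in>I. \<Sum>j\<in>I. norm (Q g i j * cnj (q i j g)))"
      by (rule norm_sum_off_diag_le) simp
    also have "\<dots> = (\<Sum>i\<in>I. \<Sum>j\<in>I. norm (Q g i j) * norm (\<Sum>k\<in>I. Q g i k * Q g k j)) * (2 / (n * sqrt n))"
      unfolding sum_distrib_right norm_mult complex_mod_cnj
      by (intro sum.cong refl) (simp add: q_def norm_mult norm_divide)
    also have "\<dots> \<le> F g / \<eta> * (2 / (n * sqrt n))"
      by (intro mult_right_mono Q_square_bound) simp
    finally have *: "norm (\<Sum>i\<in>I. \<Sum>j\<in>I - {i}. Q g i j * cnj (q i j g)) \<le> F g / \<eta> * (2 / (n * sqrt n))" .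
    have "norm (r g) = norm (\<Sum>i\<in>I. \<Sum>j\<in>I - {i}. Q g i j * cnj (q i j g)) / (n * sqrt n)"
      by (simp add: r_def norm_divide norm_mult)
    also have "\<dots> \<le> F g / \<eta> * (2 / (n * sqrt n)) / (n * sqrt n)"
      by (intro divide_right_mono *) simp
    finally have "norm (r g) \<le> F g / \<eta> * (2 / (n * sqrt n)) / (n * sqrt n)" .
    also have "F g / \<eta> * (2 / (n * sqrt n)) / (n * sqrt n) = F g / \<eta> * 2 / (real n * real n * (sqrt n * sqrt n))"
      by (simp only: times_divide_eq_right times_divide_eq_left divide_divide_eq_left mult_ac)
    also have "\<dots> = 2 * \<alpha> g / c\<^sup>2"
      unfolding F_eq c_def using n by (simp add: power2_eq_square mult_ac)
    finally show ?thesis .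
  qed
  have ib: "integrable (disorder n) f" if "borel_rv f" "\<And>g. norm (f g) \<le> B" for f :: "_ \<Rightarrow> complex" and B
    using that by (rule integrable_disorder_bounded)
  have i\<phi>: "integrable (disorder n) \<phi>"
    by (rule ib[of _ "2 / \<eta>"]) (use n\<phi> dev_bound in auto)
  have E\<phi>: "E \<phi> = 0"
  proof -
    have "E (\<lambda>g. cnj (m g)) = cnj w"
      unfolding w_def using integral_bounded_linear[OF bounded_linear_cnj int_m] .
    moreover have "integrable (disorder n) (\<lambda>g. cnj (m g))"
      using int_m by (rule integrable_bounded_linear[OF bounded_linear_cnj])
    ultimately show ?thesis
      unfolding \<phi>_def by (simp add: prob_space)
  qed
  have im\<phi>: "integrable (disorder n) (\<lambda>g. m g * \<phi> g)" "integrable (disorder n) (\<lambda>g. (m g)\<^sup>2 * \<phi> g)"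
    by (rule ib[of _ "1 / \<eta> * (2 / \<eta>)"], measurable, unfold norm_mult,
        intro mult_mono m_bound, use n\<phi> dev_bound Im_z in auto)
       (rule ib[of _ "(1 / \<eta>)\<^sup>2 * (2 / \<eta>)"], measurable, unfold norm_mult norm_power,
        intro mult_mono power_mono m_bound, use n\<phi> dev_bound Im_z in auto)
  have ie\<phi>: "integrable (disorder n) (\<lambda>g. e1 g * \<phi> g)"
  proof (rule ib[of _ "1 / \<eta> / c * (2 / \<eta>)"])
    show "norm (e1 g * \<phi> g) \<le> 1 / \<eta> / c * (2 / \<eta>)" for g
      by (rule order_trans[OF e1\<phi>], intro mult_mono divide_right_mono \<alpha>_bound dev_bound) (use c Im_z in auto)
  qed measurable
  have ir: "integrable (disorder n) r"
  proof (rule ib[of _ "2 * (1 / \<eta>) / c\<^sup>2"])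
    show "norm (r g) \<le> 2 * (1 / \<eta>) / c\<^sup>2" for g
      by (rule order_trans[OF r_le], intro divide_right_mono mult_left_mono \<alpha>_bound) auto
  qed measurable
  define T where "T g = of_real ((norm (m g - w))\<^sup>2) * (z - m g - w)" for g
  \<comment> \<open>The difference \<open>m\<^sup>2 - w\<^sup>2\<close> factors through
    \<open>m - w\<close>. The constant \<open>1 + w\<^sup>2 - z * w\<close> multiplies
    \<open>\<phi>\<close>, which has mean zero, so it drops out without any knowledge of the
    equation for \<open>w\<close>.\<close>
  have T: "T g = (z * m g - 1) * \<phi> g - (m g)\<^sup>2 * \<phi> g + (1 + w\<^sup>2 - z * w) * \<phi> g" for g
  proof -
    have e: "of_real ((norm (m g - w))\<^sup>2) = (m g - w) * \<phi> g"
      unfolding complex_norm_square \<phi>_def by simp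
    show ?thesis unfolding T_def e by (simp add: algebra_simps power2_eq_square)
  qed
  have iT: "integrable (disorder n) T"
  proof -
    have "integrable (disorder n) (\<lambda>g. z * (m g * \<phi> g) - \<phi> g - (m g)\<^sup>2 * \<phi> g + (1 + w\<^sup>2 - z * w) * \<phi> g)"
      using im\<phi> i\<phi> by simp
    then show ?thesis unfolding T by (simp add: algebra_simps)
  qed
  have ET: "E T = E (\<lambda>g. e1 g * \<phi> g + r g)"
  proof -
    have "E T = E (\<lambda>g. (z * m g - 1) * \<phi> g) - E (\<lambda>g. (m g)\<^sup>2 * \<phi> g) + (1 + w\<^sup>2 - z * w) * E \<phi>"
    proof -
      have "integrable (disorder n) (\<lambda>g. (z * m g - 1) * \<phi> g)"
        using im\<phi> i\<phi> by (simp add: left_diff_distrib mult.assoc)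
      then show ?thesis unfolding T using im\<phi> i\<phi> by simp
    qed
    also have "\<dots> = E (\<lambda>g. (m g)\<^sup>2 * \<phi> g + (e1 g * \<phi> g + r g)) - E (\<lambda>g. (m g)\<^sup>2 * \<phi> g)"
      unfolding id E\<phi> by (simp add: distrib_right add.assoc)
    also have "\<dots> = E (\<lambda>g. e1 g * \<phi> g + r g)"
      using im\<phi> ie\<phi> ir by simp
    finally show ?thesis .
  qed
  have ImT: "Im (T g) = (norm (m g - w))\<^sup>2 * (\<eta> + \<alpha> g + a)" for g
    by (simp add: T_def \<alpha>_def a_def)
  have "(\<eta> + a) * V \<le> E (\<lambda>g. Im (T g))"
  proof -
    have iI: "integrable (disorder n) (\<lambda>g. Im (T g))"
      by (rule integrable_bounded_linear[OF bounded_linear_Im iT])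
    have "(\<eta> + a) * V = E (\<lambda>g. (\<eta> + a) * (norm (m g - w))\<^sup>2)"
      unfolding V_def by simp
    also have "\<dots> \<le> E (\<lambda>g. Im (T g))"
    proof (rule integral_mono)
      fix g
      have "(\<eta> + a) * (norm (m g - w))\<^sup>2 \<le> (\<eta> + \<alpha> g + a) * (norm (m g - w))\<^sup>2"
        using \<alpha>_pos[of g] by (intro mult_right_mono) auto
      then show "(\<eta> + a) * (norm (m g - w))\<^sup>2 \<le> Im (T g)" by (simp add: ImT mult.commute)
    qed (use int_dev2 iI in auto)
    finally show ?thesis .
  qed
  also have "\<dots> = Im (E T)"
    using integral_bounded_linear[OF bounded_linear_Im iT] .
  also have "\<dots> \<le> norm (E (\<lambda>g. e1 g * \<phi> g + r g))"
    unfolding ET using abs_Im_le_cmod by (rule order_trans[OF abs_ge_self])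
  also have "\<dots> \<le> E (\<lambda>g. norm (e1 g * \<phi> g + r g))"
    by (rule integral_norm_bound)
  also have "\<dots> \<le> E (\<lambda>g. (a * norm (m g - w) + (norm (m g - w))\<^sup>2) / c + 2 * \<alpha> g / c\<^sup>2)"
  proof (rule integral_mono)
    fix g
    \<comment> \<open>Replaces the random \<open>\<alpha> g\<close> by the constant
      \<open>a\<close>; the price is one more power of the deviation, that is, a term
      \<open>V / c\<close>.\<close>
    have "\<alpha> g \<le> a + norm (m g - w)"
      using abs_Im_le_cmod[of "m g - w"] by (simp add: \<alpha>_def a_def)
    then have "\<alpha> g * norm (m g - w) \<le> (a + norm (m g - w)) * norm (m g - w)"
      by (intro mult_right_mono) auto
    then have "\<alpha> g / c * norm (m g - w) \<le> (a * norm (m g - w) + (norm (m g - w))\<^sup>2) / c"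
      using c by (simp add: divide_right_mono power2_eq_square distrib_right)
    then show "norm (e1 g * \<phi> g + r g) \<le> (a * norm (m g - w) + (norm (m g - w))\<^sup>2) / c + 2 * \<alpha> g / c\<^sup>2"
      using norm_triangle_ineq[of "e1 g * \<phi> g" "r g"] e1\<phi>[of g] r_le[of g] by linarith
  qed (use ie\<phi> ir int_dev int_dev2 int_\<alpha> in auto)
  also have "\<dots> = (a * D + V) / c + 2 * a / c\<^sup>2"
    unfolding D_def V_def a_eq using int_dev int_dev2 int_\<alpha> by simp
  finally have main: "(\<eta> + a) * V \<le> (a * D + V) / c + 2 * a / c\<^sup>2" .
  \<comment> \<open>Because \<open>n \<eta>\<^sup>2 \<ge> 1\<close>, the term \<open>V / c\<close>
    is absorbed by \<open>\<eta> * V\<close> on the left. What remains carries the common factor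
    \<open>a > 0\<close>.\<close>
  have "V / c \<le> \<eta> * V"
  proof -
    have "1 / c \<le> \<eta>" using big c by (simp add: c_def field_simps power2_eq_square)
    from mult_right_mono[OF this V_nonneg] show ?thesis by simp
  qed
  with main have "a * V \<le> a * (D / c + 2 / c\<^sup>2)"
    by (simp add: algebra_simps add_divide_distrib)
  then have "V \<le> D / c + 2 / c\<^sup>2" using a_pos by simp
  \<comment> \<open>The weight in \<open>D_le\<close> makes the contribution of \<open>V\<close>
    exactly \<open>V / 4\<close>, leaving \<open>3/4 V \<le> 3 / c\<^sup>2\<close>.\<close>
  also have "D / c \<le> (V * c / 4 + 1 / c) / c"
    using D_le c unfolding c_def by (intro divide_right_mono) auto
  also have "\<dots> = V / 4 + 1 / c\<^sup>2" using c by (simp add: field_simps power2_eq_square)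
  finally have "V \<le> 4 / c\<^sup>2" by simp
  then show V: "V \<le> 4 / (n * \<eta>)\<^sup>2" by (simp add: c_def)
  have "D \<le> V * c / 4 + 1 / c" using D_le unfolding c_def .
  also have "\<dots> \<le> 4 / c\<^sup>2 * c / 4 + 1 / c"
    using V c unfolding c_def[symmetric] by (intro add_right_mono divide_right_mono mult_right_mono) auto
  also have "\<dots> = 2 / c" using c by (simp add: power2_eq_square)
  finally show "D \<le> 2 / (n * \<eta>)" by (simp add: c_def)
qed

text \<open>\<open>m_identity\<close> with \<open>\<phi> = 1\<close>. The defect of the quadratic
  equation is the mean of the complex square \<open>(m - w)\<^sup>2\<close>, bounded by
  \<open>V\<close>, plus the mean of \<open>e1\<close>, bounded through the Ward identity.\<close>

lemma w_quadratic:
  assumes big: "n * \<eta>\<^sup>2 \<ge> 1"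
  shows "norm (w\<^sup>2 - z * w + 1) \<le> 4 / (n * \<eta>)\<^sup>2 + a / (n * \<eta>)"
proof -
  interpret prob_space "disorder n" by (rule prob_space_disorder)
  note meas_m [measurable] meas_e1 [measurable]
  have "E (\<lambda>g. (z * m g - 1) * 1)
    = E (\<lambda>g. ((m g)\<^sup>2 + e1 g) * 1 + (\<Sum>i\<in>I. \<Sum>j\<in>I - {i}. Q g i j * 0) / (of_nat n * sqrt n))"
    by (rule m_identity[where C = 1 and C' = 0]) (auto simp: pd_const)
  then have id: "E (\<lambda>g. z * m g - 1) = E (\<lambda>g. (m g)\<^sup>2 + e1 g)" by simp
  have i2: "integrable (disorder n) (\<lambda>g. (m g)\<^sup>2)"
    by (rule integrable_disorder_bounded[of _ _ "(1 / \<eta>)\<^sup>2"], measurable)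
       (unfold norm_power, intro power_mono m_bound norm_ge_zero)
  have ie: "integrable (disorder n) e1"
  proof (rule integrable_disorder_bounded[OF meas_e1])
    show "norm (e1 g) \<le> 1 / \<eta> / (n * \<eta>)" for g
      by (rule order_trans[OF e1_bound], intro divide_right_mono \<alpha>_bound) (use Im_z in auto)
  qed
  have "E (\<lambda>g. z * m g - 1) = z * w - 1"
    unfolding w_def using int_m by (simp add: prob_space)
  then have 1: "z * w - 1 = E (\<lambda>g. (m g)\<^sup>2) + E e1"
    using id i2 ie by simp
  have "E (\<lambda>g. (m g - w)\<^sup>2) = E (\<lambda>g. (m g)\<^sup>2 - (2 * w) * m g + w\<^sup>2)"
    by (simp add: power2_diff algebra_simps)
  also have "\<dots> = E (\<lambda>g. (m g)\<^sup>2) - (2 * w) * w + w\<^sup>2"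
    using i2 int_m by (simp add: prob_space w_def)
  finally have 2: "E (\<lambda>g. (m g - w)\<^sup>2) = E (\<lambda>g. (m g)\<^sup>2) - w\<^sup>2"
    by (simp add: power2_eq_square)
  have "w\<^sup>2 - z * w + 1 = - (E (\<lambda>g. (m g - w)\<^sup>2) + E e1)"
    using 1 2 by (simp add: algebra_simps)
  then have "norm (w\<^sup>2 - z * w + 1) \<le> norm (E (\<lambda>g. (m g - w)\<^sup>2)) + norm (E e1)"
    by (simp only: norm_minus_cancel norm_triangle_ineq)
  also have "norm (E (\<lambda>g. (m g - w)\<^sup>2)) \<le> V"
    unfolding V_def norm_power[symmetric] by (rule integral_norm_bound)
  also have "norm (E e1) \<le> E (\<lambda>g. norm (e1 g))" by (rule integral_norm_bound)
  also have "\<dots> \<le> E (\<lambda>g. \<alpha> g / (n * \<eta>))"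
    by (rule integral_mono) (use ie int_\<alpha> e1_bound in auto)
  also have "\<dots> = a / (n * \<eta>)" by (simp add: a_eq)
  finally show ?thesis using V_le(1)[OF big] by linarith
qed

text \<open>The part of \<open>tr (A Q M) / n\<close>, after integration by parts, that is not \<open>m S + \<beta> S\<close>.\<close>

definition e3 where "e3 g =
   ((\<Sum>i\<in>I. \<Sum>k\<in>I. (\<Sum>j\<in>I. Q g j i * Q g j k) * of_real (M g k i))
    - 2 * (\<Sum>i\<in>I. \<Sum>k\<in>I. (Q g i i * Q g i k) * of_real (M g k i))
    - \<beta> * (\<Sum>i\<in>I. \<Sum>j\<in>I. \<Sum>k\<in>I. Q g j k * of_real (M g k i) * of_real (M g i j))) / (of_nat n)\<^sup>2"

lemma e3_bound:
  assumes "\<beta> \<ge> 0"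
  shows "norm (e3 g) \<le> 3 / (n * \<eta>\<^sup>2) + \<beta> / \<eta> * (V2 g / (real n)\<^sup>2)"
proof -
  have tri: "norm (x - 2 * y - \<beta> * u) \<le> A + 2 * A + \<beta> * B"
    if "norm x \<le> A" "norm y \<le> A" "norm u \<le> B" for x y u :: complex and A B
  proof -
    have "norm (x - 2 * y - \<beta> * u) \<le> norm x + norm (2 * y) + norm (of_real \<beta> * u)"
      using norm_triangle_ineq4[of "x - 2 * y" "of_real \<beta> * u"] norm_triangle_ineq4[of x "2 * y"] by simp
    also have "norm (2 * y) \<le> 2 * A" using that by (simp add: norm_mult)
    also have "norm (of_real \<beta> * u) \<le> \<beta> * B"
      using that assms by (simp add: norm_mult mult_left_mono)
    finally show ?thesis using that by simp
  qed
  have "norm (e3 g) \<le> (n / \<eta>\<^sup>2 + 2 * (n / \<eta>\<^sup>2) + \<beta> * (V2 g / \<eta>)) / (real n)\<^sup>2"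
    unfolding e3_def norm_divide norm_power norm_of_nat
    by (intro divide_right_mono tri T1_bound T2_bound T3_bound) auto
  also have "\<dots> = 3 / (n * \<eta>\<^sup>2) + \<beta> / \<eta> * (V2 g / (real n)\<^sup>2)"
    using n by (simp add: add_divide_distrib power2_eq_square)
  finally show ?thesis .
qed

lemma meas_e3: "borel_rv e3"
  unfolding e3_def
  by (intro borel_measurable_divide borel_measurable_diff borel_measurable_sum borel_measurable_times
      measurable_Q meas_cov borel_measurable_const)

text \<open>Multiplying \<open>z Q - A Q = 1\<close> by \<open>M\<close> and taking the trace, with
  unit diagonal of \<open>M\<close>, gives \<open>z S - 1 = tr (A Q M) / n\<close>. After
  integration by parts the derivative of \<open>Q\<close> yields \<open>m S\<close> and
  \<open>T1\<close>, the derivative of \<open>M\<close> yields \<open>\<beta> S\<close> and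
  \<open>T3\<close>, and the missing diagonal yields \<open>T2\<close>.\<close>

lemma S_identity: "E (\<lambda>g. z * S g - 1) = E (\<lambda>g. m g * S g + \<beta> * S g + e3 g)"
proof -
  have n0: "real n > 0" using n by simp
  let ?r = "complex_of_real (sqrt n)"
  have rr: "?r * ?r = of_nat n" "?r \<noteq> 0"
    using n0 by (simp_all flip: of_real_mult)
  define X where "X i j g = (\<Sum>k\<in>I. Q g j k * complex_of_real (M g k i))" for i j g
  define Y where "Y i j k g = (Q g j i * Q g j k + Q g j j * Q g i k) * of_real (M g k i)
      + \<beta> * (Q g j k * of_real (M g k j) - Q g j k * of_real (M g k i) * of_real (M g i j))" for i j k g
  define X' where "X' i j g = (\<Sum>k\<in>I. Y i j k g) / ?r" for i j g
  have M1: "norm (complex_of_real (M g k i)) \<le> 1" if "k \<in> I" "i \<in> I" for g k i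
    using cov_abs_le[OF that] by simp
  have ibp: "E (\<lambda>g. \<Sum>i\<in>I. \<Sum>j\<in>I. of_real (coupling n g i j) * X i j g)
      = E (\<lambda>g. \<Sum>i\<in>I. \<Sum>j\<in>I - {i}. X' i j g) / ?r"
  proof (rule sum_ibp)
    fix i j assume ij: "i \<in> I" "j \<in> I"
    show "borel_rv (X i j)" "borel_rv (X' i j)"
      unfolding X_def X'_def Y_def
      by (intro borel_measurable_sum borel_measurable_add borel_measurable_diff borel_measurable_divide
          borel_measurable_times borel_measurable_const measurable_Q meas_cov ij; assumption)+
    {
      assume ne: "i \<noteq> j"
      have "pd (min i j, max i j) (X i j) (\<lambda>g. \<Sum>k\<in>I.
          Q g j k * of_real (\<beta> / sqrt n * (M g k j - M g k i * M g i j))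
          + (Q g j i * Q g j k + Q g j j * Q g i k) / ?r * of_real (M g k i))"
        unfolding X_def by (intro pd_sum pd_mult pd_Q pd_of_real pd_cov ij ne)
      moreover have "(\<Sum>k\<in>I. Q g j k * of_real (\<beta> / sqrt n * (M g k j - M g k i * M g i j))
          + (Q g j i * Q g j k + Q g j j * Q g i k) / ?r * of_real (M g k i)) = X' i j g" for g
        unfolding X'_def Y_def sum_divide_distrib
        by (intro sum.cong refl) (simp add: algebra_simps add_divide_distrib diff_divide_distrib)
      ultimately show "pd (min i j, max i j) (X i j) (X' i j)" by simp
    }
    fix g
    show "norm (X i j g) \<le> n * (1 / \<eta> * 1)"
    proof -
      have "norm (X i j g) \<le> (\<Sum>k\<in>I. 1 / \<eta> * 1)"
        unfolding X_def
      proof (rule order_trans[OF norm_sum], rule sum_mono)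
        fix k assume k: "k \<in> I"
        show "norm (Q g j k * complex_of_real (M g k i)) \<le> 1 / \<eta> * 1"
          unfolding norm_mult by (intro mult_mono Q_entry_bound M1 ij k) (use Im_z in auto)
      qed
      then show ?thesis by simp
    qed
    let ?b = "1 / \<eta> :: real"
    have Yb: "norm (Y i j k g) \<le> (?b * ?b + ?b * ?b) * 1 + \<bar>\<beta>\<bar> * (?b * 1 + ?b * 1 * 1)" if k: "k \<in> I" for k
    proof -
      have q: "norm (Q g p r) \<le> ?b" if "p \<in> I" "r \<in> I" for p r using that by (rule Q_entry_bound)
      have b0: "0 \<le> ?b" using Im_z by simp
      have "norm ((Q g j i * Q g j k + Q g j j * Q g i k) * of_real (M g k i)) \<le> (?b * ?b + ?b * ?b) * 1"
        unfolding norm_mult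
      proof (intro mult_mono M1 ij k order_trans[OF norm_triangle_ineq] add_mono)
        show "norm (Q g j i * Q g j k) \<le> ?b * ?b" "norm (Q g j j * Q g i k) \<le> ?b * ?b"
          unfolding norm_mult using b0 by (intro mult_mono q ij k; simp)+
      qed (use b0 in auto)
      moreover have "norm (\<beta> * (Q g j k * of_real (M g k j) - Q g j k * of_real (M g k i) * of_real (M g i j)))
          \<le> \<bar>\<beta>\<bar> * (?b * 1 + ?b * 1 * 1)"
        unfolding norm_mult[of "complex_of_real \<beta>"] norm_of_real
      proof (intro mult_left_mono order_trans[OF norm_triangle_ineq4] add_mono)
        show "norm (Q g j k * of_real (M g k j)) \<le> ?b * 1"
          "norm (Q g j k * of_real (M g k i) * of_real (M g i j)) \<le> ?b * 1 * 1"
          unfolding norm_mult using b0 by (intro mult_mono q M1 ij k; simp)+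
      qed simp
      ultimately show ?thesis
        unfolding Y_def by (intro order_trans[OF norm_triangle_ineq] add_mono)
    qed
    show "norm (X' i j g) \<le> n * ((?b * ?b + ?b * ?b) * 1 + \<bar>\<beta>\<bar> * (?b * 1 + ?b * 1 * 1)) / sqrt n"
    proof -
      have "norm (\<Sum>k\<in>I. Y i j k g) \<le> (\<Sum>k\<in>I. (?b * ?b + ?b * ?b) * 1 + \<bar>\<beta>\<bar> * (?b * 1 + ?b * 1 * 1))"
        by (rule order_trans[OF norm_sum], rule sum_mono, rule Yb)
      also have "\<dots> = n * ((?b * ?b + ?b * ?b) * 1 + \<bar>\<beta>\<bar> * (?b * 1 + ?b * 1 * 1))" by simp
      finally have "norm (\<Sum>k\<in>I. Y i j k g) / sqrt n \<le> n * ((?b * ?b + ?b * ?b) * 1 + \<bar>\<beta>\<bar> * (?b * 1 + ?b * 1 * 1)) / sqrt n"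
        by (rule divide_right_mono) simp
      then show ?thesis by (simp only: X'_def norm_divide norm_of_real abs_of_nonneg[OF real_sqrt_ge_zero[OF of_nat_0_le_iff]])
    qed
  qed
  have l: "(\<Sum>i\<in>I. \<Sum>j\<in>I. of_real (coupling n g i j) * X i j g) = of_nat n * (z * S g - 1)" for g
  proof -
    have row: "(\<Sum>j\<in>I. of_real (coupling n g i j) * X i j g) = z * (\<Sum>k\<in>I. Q g i k * of_real (M g k i)) - 1" if i: "i \<in> I" for i
      using R.Q_apply[OF i, of "\<lambda>k. of_real (M g k i)" g] cov_diag[OF i, of \<beta> g]
      unfolding X_def Q_def by (simp add: algebra_simps)
    have "(\<Sum>i\<in>I. \<Sum>j\<in>I. of_real (coupling n g i j) * X i j g) = (\<Sum>i\<in>I. z * (\<Sum>k\<in>I. Q g i k * of_real (M g k i)) - 1)"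
      by (intro sum.cong refl row)
    also have "\<dots> = z * (\<Sum>i\<in>I. \<Sum>k\<in>I. Q g i k * of_real (M g k i)) - of_nat n"
      unfolding sum_subtractf sum_distrib_left[symmetric] by simp
    also have "(\<Sum>i\<in>I. \<Sum>k\<in>I. Q g i k * of_real (M g k i)) = of_nat n * S g"
      using n by (simp add: S_def)
    finally show ?thesis by (simp add: algebra_simps)
  qed
  have r: "(\<Sum>i\<in>I. \<Sum>j\<in>I - {i}. X' i j g) / ?r = of_nat n * (m g * S g + \<beta> * S g + e3 g)" for g
  proof -
    let ?N = "complex_of_nat n"
    define P1 where "P1 = (\<Sum>i\<in>I. \<Sum>k\<in>I. (\<Sum>j\<in>I. Q g j i * Q g j k) * of_real (M g k i))"
    define P2 where "P2 = (\<Sum>i\<in>I. \<Sum>k\<in>I. (Q g i i * Q g i k) * of_real (M g k i))"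
    define P3 where "P3 = (\<Sum>i\<in>I. \<Sum>j\<in>I. \<Sum>k\<in>I. Q g j k * of_real (M g k i) * of_real (M g i j))"
    have S: "(\<Sum>i\<in>I. \<Sum>k\<in>I. Q g i k * of_real (M g k i)) = ?N * S g" using n by (simp add: S_def)
    have m: "(\<Sum>i\<in>I. Q g i i) = ?N * m g" using n by (simp add: m_def)
    have "(\<Sum>i\<in>I. \<Sum>j\<in>I. \<Sum>k\<in>I. Q g j i * Q g j k * of_real (M g k i)) = P1"
      unfolding P1_def sum_distrib_right by (intro sum.cong refl sum.swap)
    moreover have "(\<Sum>i\<in>I. \<Sum>j\<in>I. \<Sum>k\<in>I. Q g j j * Q g i k * of_real (M g k i)) = (?N * m g) * (?N * S g)"
      unfolding S[symmetric] m[symmetric] sum_product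
      by (subst sum.swap) (simp add: sum_distrib_left mult.assoc)
    moreover have "(\<Sum>i\<in>I. \<Sum>j\<in>I. \<Sum>k\<in>I. Q g j k * of_real (M g k j)) = ?N * (?N * S g)"
      unfolding S by simp
    moreover have "(\<Sum>i\<in>I. \<Sum>j\<in>I. \<Sum>k\<in>I. Y i j k g)
        = (\<Sum>i\<in>I. \<Sum>j\<in>I. \<Sum>k\<in>I. Q g j i * Q g j k * of_real (M g k i))
        + (\<Sum>i\<in>I. \<Sum>j\<in>I. \<Sum>k\<in>I. Q g j j * Q g i k * of_real (M g k i))
        + \<beta> * ((\<Sum>i\<in>I. \<Sum>j\<in>I. \<Sum>k\<in>I. Q g j k * of_real (M g k j)) - P3)"
      unfolding Y_def P3_def by (simp only: sum.distrib sum_subtractf sum_distrib_left distrib_right right_diff_distrib)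
    ultimately have full: "(\<Sum>i\<in>I. \<Sum>j\<in>I. \<Sum>k\<in>I. Y i j k g) = P1 + (?N * m g) * (?N * S g) + \<beta> * (?N * (?N * S g) - P3)"
      by simp
    \<comment> \<open>On the diagonal the two terms with \<beta> cancel because
      \<open>M g i i = 1\<close>, and the two products of \<open>Q\<close> coincide.\<close>
    have diag: "(\<Sum>i\<in>I. \<Sum>k\<in>I. Y i i k g) = 2 * P2"
    proof -
      have "(\<Sum>i\<in>I. \<Sum>k\<in>I. Y i i k g) = (\<Sum>i\<in>I. \<Sum>k\<in>I. 2 * ((Q g i i * Q g i k) * of_real (M g k i)))"
        by (intro sum.cong refl) (simp add: Y_def cov_diag)
      then show ?thesis by (simp only: P2_def sum_distrib_left)
    qed
    have "(\<Sum>i\<in>I. \<Sum>j\<in>I - {i}. X' i j g) = (\<Sum>i\<in>I. \<Sum>j\<in>I - {i}. \<Sum>k\<in>I. Y i j k g) / ?r"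
      unfolding X'_def by (simp only: sum_divide_distrib)
    also have "\<dots> = (P1 + (?N * m g) * (?N * S g) + \<beta> * (?N * (?N * S g) - P3) - 2 * P2) / ?r"
      unfolding sum_off_diag[OF finite_atLeastAtMost] full diag ..
    finally have "(\<Sum>i\<in>I. \<Sum>j\<in>I - {i}. X' i j g) / ?r
        = (P1 + (?N * m g) * (?N * S g) + \<beta> * (?N * (?N * S g) - P3) - 2 * P2) / ?N"
      using rr by simp
    also have "\<dots> = ?N * (m g * S g + \<beta> * S g + (P1 - 2 * P2 - \<beta> * P3) / ?N\<^sup>2)"
      using n by (simp add: field_simps power2_eq_square)
    finally show ?thesis unfolding e3_def P1_def P2_def P3_def .
  qed
  have "of_nat n * E (\<lambda>g. z * S g - 1) = of_nat n * E (\<lambda>g. m g * S g + \<beta> * S g + e3 g)"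
    using ibp unfolding l integral_divide_zero[symmetric] r integral_mult_right_zero .
  then show ?thesis using n by simp
qed

section \<open>The mean of \<open>S\<close>\<close>

lemma int_S: "integrable (disorder n) S"
  by (rule integrable_disorder_bounded[OF meas_S S_bound])

lemma int_V2: "integrable (disorder n) V2"
  by (rule integrable_disorder_bounded[OF meas_V2, of "(real n)\<^sup>2"]) (use V2_bounds in auto)

text \<open>Replacing \<open>m\<close> by \<open>w\<close> in \<open>S_identity\<close> costs the
  deviation \<open>2 / (n * \<eta>)\<close> times the bound \<open>1 / \<eta>\<close> on
  \<open>S\<close>; with the 3 from \<open>e3_bound\<close> this makes 5. A deviation of order
  \<open>1 / (n * \<eta>\<^sup>2)\<close> would leave an error
  \<open>1 / (n * \<eta>\<^sup>3)\<close>, which diverges for \<eta> of order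
  \<open>n powr (- 3 / 8)\<close>.\<close>

lemma ES_equation:
  assumes big: "n * \<eta>\<^sup>2 \<ge> 1" and \<beta>: "\<beta> \<ge> 0"
  shows "norm (E S * (z - w - \<beta>) - 1) \<le> 5 / (n * \<eta>\<^sup>2) + \<beta> * \<nu> / \<eta>"
proof -
  interpret prob_space "disorder n" by (rule prob_space_disorder)
  note meas_m [measurable] meas_S [measurable] meas_e3 [measurable]
  have ie: "integrable (disorder n) e3"
  proof (rule integrable_disorder_bounded[OF meas_e3])
    show "norm (e3 g) \<le> 3 / (n * \<eta>\<^sup>2) + \<beta> / \<eta> * ((real n)\<^sup>2 / (real n)\<^sup>2)" for g
      by (rule order_trans[OF e3_bound[OF \<beta>]], intro add_left_mono mult_left_mono divide_right_mono V2_bounds)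
         (use \<beta> Im_z in auto)
  qed
  have id': "integrable (disorder n) (\<lambda>g. (m g - w) * S g)"
  proof (rule integrable_disorder_bounded[of _ _ "2 / \<eta> * (1 / \<eta>)"])
    show "norm ((m g - w) * S g) \<le> 2 / \<eta> * (1 / \<eta>)" for g
      unfolding norm_mult by (intro mult_mono dev_bound S_bound) (use Im_z in auto)
  qed measurable
  have "z * E S - 1 = E (\<lambda>g. z * S g - 1)"
    using int_S by (simp add: prob_space)
  also have "\<dots> = E (\<lambda>g. (m g - w) * S g + (w + \<beta>) * S g + e3 g)"
    unfolding S_identity by (simp add: algebra_simps)
  also have "\<dots> = E (\<lambda>g. (m g - w) * S g) + (w + \<beta>) * E S + E e3"
    using id' int_S ie by simp
  finally have "E S * (z - w - \<beta>) - 1 = E (\<lambda>g. (m g - w) * S g) + E e3"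
    by (simp add: algebra_simps)
  then have "norm (E S * (z - w - \<beta>) - 1) \<le> norm (E (\<lambda>g. (m g - w) * S g)) + norm (E e3)"
    by (simp only: norm_triangle_ineq)
  also have "norm (E (\<lambda>g. (m g - w) * S g)) \<le> E (\<lambda>g. norm ((m g - w) * S g))" by (rule integral_norm_bound)
  also have "\<dots> \<le> E (\<lambda>g. norm (m g - w) * (1 / \<eta>))"
  proof (rule integral_mono)
    show "norm ((m g - w) * S g) \<le> norm (m g - w) * (1 / \<eta>)" for g
      unfolding norm_mult by (intro mult_left_mono S_bound) simp
  qed (use id' int_dev in auto)
  also have "\<dots> = D * (1 / \<eta>)" unfolding D_def by simp
  also have "\<dots> \<le> 2 / (n * \<eta>) * (1 / \<eta>)"
    using V_le(2)[OF big] Im_z by (intro mult_right_mono) auto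
  also have "norm (E e3) \<le> E (\<lambda>g. norm (e3 g))" by (rule integral_norm_bound)
  also have "\<dots> \<le> E (\<lambda>g. 3 / (n * \<eta>\<^sup>2) + \<beta> / \<eta> * (V2 g / (real n)\<^sup>2))"
    by (rule integral_mono) (use ie int_V2 e3_bound[OF \<beta>] in auto)
  also have "\<dots> = 3 / (n * \<eta>\<^sup>2) + \<beta> / \<eta> * \<nu>"
    unfolding \<nu>_def using int_V2 by (simp add: prob_space)
  finally show ?thesis by (simp add: power2_eq_square add_divide_distrib[symmetric] mult_ac)
qed

lemma V2_ge: "V2 g \<ge> n"
proof -
  have "(\<Sum>i\<in>I. 1) \<le> (\<Sum>i\<in>I. \<Sum>j\<in>I. (M g i j)\<^sup>2)"
  proof (rule sum_mono)
    fix i assume i: "i \<in> I"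
    have "(M g i i)\<^sup>2 \<le> (\<Sum>j\<in>I. (M g i j)\<^sup>2)" using i by (intro member_le_sum) auto
    then show "1 \<le> (\<Sum>j\<in>I. (M g i j)\<^sup>2)" using cov_diag[OF i, of \<beta> g] by simp
  qed
  then show ?thesis by (simp add: V2_def)
qed

lemma \<nu>_ge: "\<nu> \<ge> 1 / n"
proof -
  interpret prob_space "disorder n" by (rule prob_space_disorder)
  have "E (\<lambda>_. real n) \<le> E V2" by (rule integral_mono) (use int_V2 V2_ge in auto)
  then show ?thesis using n by (simp add: \<nu>_def prob_space field_simps power2_eq_square)
qed

text \<open>Cauchy-Schwarz for the expectation of \<open>sqrt (V2 g) * sqrt (F g)\<close>, carried
  out as AM-GM with a deterministic weight, so that only the means of \<open>V2\<close> and
  \<open>\<alpha>\<close> occur.\<close>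

lemma ES_bound: "(norm (E S))\<^sup>2 \<le> n * \<nu> * (a / \<eta>)"
proof -
  define P where "P = E V2"
  define R where "R = n * a / \<eta>"
  have \<nu>0: "\<nu> > 0" by (rule less_le_trans[OF _ \<nu>_ge]) (use n in simp)
  have P: "P = (real n)\<^sup>2 * \<nu>" "P > 0" using n \<nu>0 by (simp_all add: P_def \<nu>_def zero_less_divide_iff)
  have R: "R > 0" using n a_pos Im_z by (simp add: R_def)
  \<comment> \<open>The optimal weight: it makes the two AM-GM terms \<open>t * P\<close> and
    \<open>R / t\<close> equal.\<close>
  define t where "t = sqrt (R / P)"
  have t: "t > 0" using P R by (simp add: t_def)
  have "norm (E S) \<le> E (\<lambda>g. norm (S g))" by (rule integral_norm_bound)
  also have "\<dots> \<le> E (\<lambda>g. (t * V2 g + (n / \<eta> / t) * \<alpha> g) / (2 * n))"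
  proof (rule integral_mono)
    fix g
    have am: "x * y \<le> (t * x\<^sup>2 + y\<^sup>2 / t) / 2" for x y :: real
    proof -
      have "0 \<le> (t * x - y)\<^sup>2 / t" using t by simp
      also have "\<dots> = t * x\<^sup>2 + y\<^sup>2 / t - 2 * (x * y)" using t by (simp add: power2_eq_square field_simps)
      finally show ?thesis by simp
    qed
    have F0: "F g \<ge> 0" using F_pos[of g] by simp
    have "norm (S g) \<le> sqrt (V2 g) * sqrt (F g) / n" by (rule S_le_V2)
    also have "\<dots> \<le> (t * V2 g + F g / t) / 2 / n"
      using am[of "sqrt (V2 g)" "sqrt (F g)"] V2_bounds F0 by (intro divide_right_mono) auto
    also have "\<dots> = (t * V2 g + (n / \<eta> / t) * \<alpha> g) / (2 * n)" by (simp add: F_eq)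
    finally show "norm (S g) \<le> (t * V2 g + (n / \<eta> / t) * \<alpha> g) / (2 * n)" .
  qed (use int_S int_V2 int_\<alpha> in auto)
  also have "\<dots> = (t * P + R / t) / (2 * n)"
    unfolding P_def R_def a_eq using int_V2 int_\<alpha> by simp
  also have "t * P + R / t = 2 * sqrt (P * R)"
  proof -
    have "sqrt (R / P) * P = sqrt R * (P / sqrt P)" by (simp add: real_sqrt_divide)
    moreover have "R / sqrt (R / P) = sqrt P * (R / sqrt R)" by (simp add: real_sqrt_divide)
    ultimately have "t * P = sqrt (P * R)" "R / t = sqrt (P * R)"
      unfolding t_def using P(2) R by (simp_all add: real_div_sqrt real_sqrt_mult)
    then show ?thesis by simp
  qed
  also have "2 * sqrt (P * R) / (2 * n) = sqrt (P * R) / n" by simp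
  finally have "(norm (E S))\<^sup>2 \<le> (sqrt (P * R) / n)\<^sup>2" by (intro power_mono) auto
  also have "\<dots> = n * \<nu> * (a / \<eta>)"
  proof -
    have "(sqrt (P * R))\<^sup>2 = P * R" using P R by simp
    then show ?thesis using n unfolding power_divide P(1) R_def by (simp add: power2_eq_square)
  qed
  finally show ?thesis .
qed

end

subsection \<open>Operator norm and overlap\<close>

text \<open>Extensional functions, so that the irrelevant coordinates are pinned and the set is
  countable. Suprema over all vectors are reduced to it both for measurability and for the largest
  eigenvalue.\<close>

definition rat_vectors :: "nat \<Rightarrow> (nat \<Rightarrow> real) set" where
  "rat_vectors n = ({1..n} \<rightarrow>\<^sub>E \<rat>)"

lemma countable_rat_vectors: "countable (rat_vectors n)"
  unfolding rat_vectors_def by (intro countable_PiE countable_rat) auto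

lemma rat_vectors_dense:
  obtains r where "\<And>k. r k \<in> rat_vectors n" "\<And>i. i \<in> {1..n} \<Longrightarrow> (\<lambda>k. r k i) \<longlonglongrightarrow> x i"
proof -
  have "\<exists>q\<in>\<rat>. x i < q \<and> q < x i + 1 / real (Suc k)" for i k
    using Rats_dense_in_real[of "x i" "x i + 1 / real (Suc k)"] by auto
  then obtain q where q: "\<And>i k. q i k \<in> \<rat>" "\<And>i k. x i < q i k" "\<And>i k. q i k < x i + 1 / real (Suc k)"
    by metis
  define r where "r k = restrict (\<lambda>i. q i k) {1..n}" for k
  have "(\<lambda>k. r k i) \<longlonglongrightarrow> x i" if "i \<in> {1..n}" for i
  proof (rule tendsto_sandwich[where f = "\<lambda>_. x i" and h = "\<lambda>k. x i + 1 / real (Suc k)"])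
    show "(\<lambda>k. x i + 1 / real (Suc k)) \<longlonglongrightarrow> x i"
      using tendsto_add[OF tendsto_const LIMSEQ_inverse_real_of_nat, of "x i"] by (simp add: inverse_eq_divide)
    show "\<forall>\<^sub>F k in sequentially. x i \<le> r k i" "\<forall>\<^sub>F k in sequentially. r k i \<le> x i + 1 / real (Suc k)"
      using that less_imp_le[OF q(2)] less_imp_le[OF q(3)] by (simp_all add: r_def)
  qed simp
  moreover have "r k \<in> rat_vectors n" for k using q(1) by (auto simp: r_def rat_vectors_def)
  ultimately show ?thesis using that by blast
qed

lemma L2_set_pos: "L2_set x S \<noteq> 0 \<Longrightarrow> 0 < L2_set x S"
  using L2_set_nonneg[of x S] by linarith

context
  fixes n :: nat and A :: "nat \<Rightarrow> nat \<Rightarrow> real"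
  assumes A: "\<And>i j. i \<in> {1..n} \<Longrightarrow> j \<in> {1..n} \<Longrightarrow> \<bar>A i j\<bar> \<le> 1"
begin

text \<open>Row-wise Cauchy-Schwarz. The crude factor \<open>n\<close> serves to make the supremum
  in \<open>op_norm\<close> finite.\<close>

lemma apply_le: "L2_set (\<lambda>i. \<Sum>j=1..n. A i j * x j) {1..n} \<le> real n * L2_set x {1..n}"
proof -
  have row: "\<bar>\<Sum>j=1..n. A i j * x j\<bar> \<le> sqrt n * L2_set x {1..n}" if i: "i \<in> {1..n}" for i
  proof -
    have "\<bar>\<Sum>j=1..n. A i j * x j\<bar> \<le> (\<Sum>j=1..n. \<bar>1\<bar> * \<bar>x j\<bar>)"
    proof (rule order_trans[OF sum_abs], rule sum_mono)
      fix j assume "j \<in> {1..n}"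
      then show "\<bar>A i j * x j\<bar> \<le> \<bar>1\<bar> * \<bar>x j\<bar>"
        unfolding abs_mult using A[OF i] by (intro mult_right_mono) simp_all
    qed
    also have "\<dots> \<le> L2_set (\<lambda>_. 1) {1..n} * L2_set x {1..n}" by (rule L2_set_mult_ineq)
    finally show ?thesis by (simp add: L2_set_def)
  qed
  have "L2_set (\<lambda>i. \<Sum>j=1..n. A i j * x j) {1..n} = L2_set (\<lambda>i. \<bar>\<Sum>j=1..n. A i j * x j\<bar>) {1..n}"
    by (simp add: L2_set_def)
  also have "\<dots> \<le> L2_set (\<lambda>i. sqrt n * L2_set x {1..n}) {1..n}"
    by (intro L2_set_mono row) auto
  also have "\<dots> = real n * L2_set x {1..n}"
    by (simp add: L2_set_def real_sqrt_mult power_mult_distrib sum_nonneg)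
  finally show ?thesis .
qed

lemma op_norm_bdd: "bdd_above (range (\<lambda>x. L2_set (\<lambda>i. \<Sum>j=1..n. A i j * x j) {1..n} / L2_set x {1..n}))"
proof (rule bdd_aboveI2)
  fix x :: "nat \<Rightarrow> real"
  show "L2_set (\<lambda>i. \<Sum>j=1..n. A i j * x j) {1..n} / L2_set x {1..n} \<le> n"
    using apply_le[of x] L2_set_pos[of x "{1..n}"] by (cases "L2_set x {1..n} = 0") (auto simp: divide_le_eq)
qed

lemma op_norm_le: "op_norm n A \<le> n"
  unfolding op_norm_def
proof (rule cSUP_least)
  fix x :: "nat \<Rightarrow> real"
  show "L2_set (\<lambda>i. \<Sum>j=1..n. A i j * x j) {1..n} / L2_set x {1..n} \<le> n"
    using apply_le[of x] L2_set_pos[of x "{1..n}"] by (cases "L2_set x {1..n} = 0") (auto simp: divide_le_eq)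
qed simp

lemma op_norm_apply: "L2_set (\<lambda>i. \<Sum>j=1..n. A i j * x j) {1..n} \<le> op_norm n A * L2_set x {1..n}"
proof (cases "L2_set x {1..n} = 0")
  case True
  then show ?thesis using apply_le[of x] by simp
next
  case False
  then have "L2_set x {1..n} > 0" by (rule L2_set_pos)
  moreover have "L2_set (\<lambda>i. \<Sum>j=1..n. A i j * x j) {1..n} / L2_set x {1..n} \<le> op_norm n A"
    unfolding op_norm_def by (rule cSUP_upper[OF UNIV_I op_norm_bdd])
  ultimately show ?thesis by (simp add: divide_le_eq)
qed

lemma op_norm_nonneg: "op_norm n A \<ge> 0"
proof -
  have "L2_set (\<lambda>i. \<Sum>j=1..n. A i j * 0) {1..n} / L2_set (\<lambda>_. 0) {1..n} \<le> op_norm n A"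
    unfolding op_norm_def by (rule cSUP_upper[OF UNIV_I op_norm_bdd])
  then show ?thesis by (simp add: L2_set_def)
qed

text \<open>Both sides are continuous in the vector, so rational vectors suffice; sublevel sets of
  the operator norm become countable intersections. Nonnegativity of \<open>c\<close> covers vectors
  of norm zero, whose quotient is 0.\<close>

lemma op_norm_le_iff:
  assumes "c \<ge> 0"
  shows "op_norm n A \<le> c \<longleftrightarrow>
    (\<forall>x\<in>rat_vectors n. L2_set (\<lambda>i. \<Sum>j=1..n. A i j * x j) {1..n} \<le> c * L2_set x {1..n})" (is "_ \<longleftrightarrow> ?R")
proof
  assume "op_norm n A \<le> c"
  then show ?R
    using op_norm_apply mult_right_mono[OF _ L2_set_nonneg] by (blast intro: order_trans)
next
  assume R: ?R
  have "L2_set (\<lambda>i. \<Sum>j=1..n. A i j * x j) {1..n} \<le> c * L2_set x {1..n}" for x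
  proof -
    obtain r where r: "\<And>k. r k \<in> rat_vectors n" "\<And>i. i \<in> {1..n} \<Longrightarrow> (\<lambda>k. r k i) \<longlonglongrightarrow> x i"
      using rat_vectors_dense[of n x] by blast
    have "(\<lambda>k. L2_set (\<lambda>i. \<Sum>j=1..n. A i j * r k j) {1..n}) \<longlonglongrightarrow> L2_set (\<lambda>i. \<Sum>j=1..n. A i j * x j) {1..n}"
      unfolding L2_set_def by (intro tendsto_intros r)
    moreover have "(\<lambda>k. c * L2_set (r k) {1..n}) \<longlonglongrightarrow> c * L2_set x {1..n}"
      unfolding L2_set_def by (intro tendsto_intros r)
    ultimately show ?thesis
      by (rule LIMSEQ_le) (use R r(1) in blast)
  qed
  note * = this
  show "op_norm n A \<le> c"
    unfolding op_norm_def
  proof (rule cSUP_least)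
    fix x :: "nat \<Rightarrow> real"
    show "L2_set (\<lambda>i. \<Sum>j=1..n. A i j * x j) {1..n} / L2_set x {1..n} \<le> c"
      using *[of x] L2_set_pos[of x "{1..n}"] assms by (cases "L2_set x {1..n} = 0") (auto simp: divide_le_eq)
  qed simp
qed

end

section \<open>Operator norm of the covariance\<close>

lemma op_norm_cov_nonneg: "op_norm n (cov n \<beta> g) \<ge> 0"
  by (rule op_norm_nonneg, rule cov_abs_le)

lemma op_norm_cov_le: "op_norm n (cov n \<beta> g) \<le> n"
  by (rule op_norm_le, rule cov_abs_le)

lemma sets_Ball_countable:
  assumes "countable D" "\<And>x. x \<in> D \<Longrightarrow> {g \<in> space M. P x g} \<in> sets M"
  shows "{g \<in> space M. \<forall>x\<in>D. P x g} \<in> sets M"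
proof (cases "D = {}")
  case False
  then have "{g \<in> space M. \<forall>x\<in>D. P x g} = (\<Inter>x\<in>D. {g \<in> space M. P x g})" by auto
  then show ?thesis using assms False by (auto intro!: sets.countable_INT')
qed simp

lemma measurable_op_norm_cov: "(\<lambda>g. op_norm n (cov n \<beta> g)) \<in> borel_measurable (disorder n)"
proof (rule borel_measurable_iff_le[THEN iffD2], rule allI)
  fix c :: real
  note measurable_cov [measurable]
  show "{g \<in> space (disorder n). op_norm n (cov n \<beta> g) \<le> c} \<in> sets (disorder n)"
  proof (cases "c \<ge> 0")
    case True
    have "{g \<in> space (disorder n). \<forall>x\<in>rat_vectors n.
        L2_set (\<lambda>i. \<Sum>j=1..n. cov n \<beta> g i j * x j) {1..n} \<le> c * L2_set x {1..n}} \<in> sets (disorder n)"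
      unfolding L2_set_def by (rule sets_Ball_countable[OF countable_rat_vectors]) measurable
    moreover have "op_norm n (cov n \<beta> g) \<le> c \<longleftrightarrow> (\<forall>x\<in>rat_vectors n.
        L2_set (\<lambda>i. \<Sum>j=1..n. cov n \<beta> g i j * x j) {1..n} \<le> c * L2_set x {1..n})" for g
      by (rule op_norm_le_iff[OF _ True], rule cov_abs_le)
    ultimately show ?thesis by simp
  next
    case False
    then have "\<not> op_norm n (cov n \<beta> g) \<le> c" for g
      using op_norm_cov_nonneg[of n \<beta> g] by linarith
    then show ?thesis by simp
  qed
qed

text \<open>The sum of squares is the Gibbs average of the quadratic form of \<open>M\<close> at
  \<open>\<sigma>\<close>, and every \<open>\<sigma>\<close> has squared length \<open>n\<close>.
  This replaces the spectral decomposition of a positive semidefinite matrix.\<close>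

lemma cov_sum_squares_le_op_norm:
  "(\<Sum>i=1..n. \<Sum>j=1..n. (cov n \<beta> g i j)\<^sup>2) \<le> n * op_norm n (cov n \<beta> g)"
proof -
  let ?M = "cov n \<beta> g"
  have "(\<Sum>i=1..n. \<Sum>j=1..n. (?M i j)\<^sup>2) = (\<Sum>i=1..n. \<Sum>j=1..n. bracket n \<beta> g (\<lambda>\<sigma>. ?M i j * (\<sigma> i * \<sigma> j)))"
    by (intro sum.cong refl) (simp only: bracket_cmult cov_def[symmetric] power2_eq_square)
  also have "\<dots> = bracket n \<beta> g (\<lambda>\<sigma>. \<Sum>i=1..n. \<Sum>j=1..n. ?M i j * (\<sigma> i * \<sigma> j))"
    by (simp only: bracket_sum)
  also have "\<dots> \<le> bracket n \<beta> g (\<lambda>_. n * op_norm n ?M)"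
  proof (rule bracket_mono)
    fix \<sigma> assume \<sigma>: "\<sigma> \<in> spins n"
    have s: "L2_set \<sigma> {1..n} = sqrt n"
      using \<sigma> by (simp add: L2_set_def power2_eq_square spin_square)
    have "(\<Sum>i=1..n. \<Sum>j=1..n. ?M i j * (\<sigma> i * \<sigma> j)) = (\<Sum>i=1..n. \<sigma> i * (\<Sum>j=1..n. ?M i j * \<sigma> j))"
      unfolding sum_distrib_left by (intro sum.cong refl) (simp add: mult_ac)
    also have "\<dots> \<le> (\<Sum>i=1..n. \<bar>\<sigma> i\<bar> * \<bar>\<Sum>j=1..n. ?M i j * \<sigma> j\<bar>)"
      by (intro sum_mono) (simp add: abs_mult[symmetric])
    also have "\<dots> \<le> L2_set \<sigma> {1..n} * L2_set (\<lambda>i. \<Sum>j=1..n. ?M i j * \<sigma> j) {1..n}"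
      by (rule L2_set_mult_ineq)
    also have "\<dots> \<le> L2_set \<sigma> {1..n} * (op_norm n ?M * L2_set \<sigma> {1..n})"
      by (intro mult_left_mono op_norm_apply cov_abs_le L2_set_nonneg)
    also have "\<dots> = n * op_norm n ?M" unfolding s by simp
    finally show "(\<Sum>i=1..n. \<Sum>j=1..n. ?M i j * (\<sigma> i * \<sigma> j)) \<le> n * op_norm n ?M" .
  qed
  also have "\<dots> = n * op_norm n ?M" by (rule bracket_const)
  finally show ?thesis .
qed

text \<open>The quantity \<open>\<nu>\<close> without reference to a spectral parameter, so that one
  value can be compared across different \<open>z\<close>.\<close>

definition overlap_sq :: "nat \<Rightarrow> real \<Rightarrow> real" where
  "overlap_sq n \<beta> = (LINT g|disorder n. (\<Sum>i=1..n. \<Sum>j=1..n. (cov n \<beta> g i j)\<^sup>2)) / (real n)\<^sup>2"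

lemma overlap_sq_le_op_norm:
  assumes "n \<ge> 1"
  shows "n * overlap_sq n \<beta> \<le> (LINT g|disorder n. op_norm n (cov n \<beta> g))"
proof -
  let ?V = "\<lambda>g. \<Sum>i=1..n. \<Sum>j=1..n. (cov n \<beta> g i j)\<^sup>2"
  have io: "integrable (disorder n) (\<lambda>g. op_norm n (cov n \<beta> g))"
  proof (rule integrable_disorder_bounded[OF measurable_op_norm_cov])
    show "norm (op_norm n (cov n \<beta> g)) \<le> n" for g
      using op_norm_cov_le op_norm_cov_nonneg by simp
  qed
  have iV: "integrable (disorder n) ?V"
  proof (rule integrable_disorder_bounded)
    show "?V \<in> borel_measurable (disorder n)"
      by (intro borel_measurable_sum borel_measurable_power measurable_cov)
    fix g
    have "?V g \<ge> 0" by (intro sum_nonneg zero_le_power2)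
    moreover have "n * op_norm n (cov n \<beta> g) \<le> real n * real n"
      by (intro mult_left_mono op_norm_cov_le) auto
    ultimately show "norm (?V g) \<le> real n * real n"
      using cov_sum_squares_le_op_norm[of n \<beta> g] by simp
  qed
  have "(LINT g|disorder n. ?V g) \<le> (LINT g|disorder n. n * op_norm n (cov n \<beta> g))"
    by (rule integral_mono) (use iV io cov_sum_squares_le_op_norm in auto)
  then show ?thesis using assms by (simp add: overlap_sq_def field_simps power2_eq_square)
qed

lemma (in sk_resolvent) \<nu>_eq: "\<nu> = overlap_sq n \<beta>"
  unfolding \<nu>_def overlap_sq_def V2_def[abs_def] ..

subsection \<open>High and critical temperature\<close>

text \<open>Multiply \<open>w\<^sup>2 - z w + 1 = e\<close> by \<open>cnj w\<close> to get
  \<open>|w|\<^sup>2 (z - w) = cnj w (1 - e)\<close> and take imaginary parts. This gives access to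
  the size of \<open>w\<close> without choosing a branch of a square root.\<close>

lemma near_fixed_point_energy:
  fixes w z :: complex
  assumes "norm (w\<^sup>2 - z * w + 1) \<le> \<epsilon>"
  shows "(norm w)\<^sup>2 * (Im z - Im w) \<le> - Im w + \<epsilon> * norm w"
proof -
  have im_mult: "Im (of_real r * y) = r * Im y" for r y by simp
  define e where "e = w\<^sup>2 - z * w + 1"
  have "of_real ((norm w)\<^sup>2) * (z - w) = cnj w * (1 - e)"
    unfolding complex_norm_square by (simp add: e_def algebra_simps power2_eq_square)
  then have "Im (of_real ((norm w)\<^sup>2) * (z - w)) = Im (cnj w * (1 - e))" by (rule arg_cong)
  then have "(norm w)\<^sup>2 * (Im z - Im w) = Im (cnj w * (1 - e))"
    using im_mult[of "(norm w)\<^sup>2" "z - w"] by (simp only: minus_complex.sel)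
  also have "\<dots> = - Im w - Im (cnj w * e)" by (simp add: algebra_simps)
  also have "\<dots> \<le> - Im w + norm (cnj w * e)" using abs_Im_le_cmod[of "cnj w * e"] by linarith
  also have "norm (cnj w * e) \<le> \<epsilon> * norm w"
    using assms unfolding e_def[symmetric] by (simp add: norm_mult mult.commute mult_right_mono)
  finally show ?thesis by simp
qed

text \<open>If \<open>|w| > 1\<close> then \<open>|w|\<^sup>2 (\<eta> + a)\<close> exceeds
  \<open>a + \<eta> |w|\<close>, against the energy inequality. Two passes are made because the
  error bound itself contains \<open>a = - Im w\<close>.\<close>

lemma near_fixed_point_norm:
  fixes w z :: complex
  assumes e: "norm (w\<^sup>2 - z * w + 1) \<le> \<epsilon>0 + \<kappa> * (- Im w)"
    and "Im z > 0" "Im w \<le> 0" "\<kappa> \<le> 1" "\<kappa> \<ge> 0" and small: "\<epsilon>0 + 2 * \<kappa> \<le> Im z"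
  shows "norm w \<le> 1" "norm (w\<^sup>2 - z * w + 1) \<le> \<epsilon>0 + 2 * \<kappa>"
proof -
  define \<eta> where "\<eta> = Im z"
  define a where "a = - Im w"
  define u where "u = norm w"
  note d = \<eta>_def[symmetric] a_def[symmetric] u_def[symmetric]
  have \<eta>: "\<eta> > 0" and a: "a \<ge> 0" and u: "u \<ge> 0" using assms by (simp_all add: \<eta>_def a_def u_def)
  have e0: "\<epsilon>0 \<le> \<eta>" using small assms by (simp add: \<eta>_def)
  have au: "a \<le> u" using abs_Im_le_cmod[of w] by (simp add: a_def u_def)
  \<comment> \<open>First pass, with the crude error \<open>\<eta> + a\<close>. Since
    \<open>a \<le> u\<close>, it bounds \<open>a\<close> by 2 and turns the error into the constant
    \<open>\<epsilon>0 + 2 * \<kappa>\<close>, which is at most \<open>Im z\<close>.\<close>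
  have "u \<le> 2"
  proof (rule ccontr)
    assume "\<not> u \<le> 2"
    then have u2: "u > 2" by simp
    have "u\<^sup>2 * (\<eta> + a) \<le> a + (\<epsilon>0 + \<kappa> * a) * u"
      using near_fixed_point_energy[OF e] by (simp add: \<eta>_def a_def u_def)
    also have "\<dots> \<le> a * u + (\<eta> + a) * u"
    proof (intro add_mono mult_right_mono u e0)
      show "a \<le> a * u" using u2 a by (simp add: mult_le_cancel_left1)
      show "\<kappa> * a \<le> a" using assms a by (simp add: mult_left_le_one_le)
    qed
    also have "\<dots> \<le> 2 * u * (\<eta> + a)" using \<eta> u by (simp add: algebra_simps)
    also have "\<dots> < u\<^sup>2 * (\<eta> + a)"
      using u2 \<eta> a by (intro mult_strict_right_mono) (auto simp: power2_eq_square)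
    finally show False by simp
  qed
  then have "\<kappa> * a \<le> \<kappa> * 2" using au assms by (intro mult_left_mono) auto
  then show b: "norm (w\<^sup>2 - z * w + 1) \<le> \<epsilon>0 + 2 * \<kappa>"
    using e by (simp add: a_def)
  have "u \<le> 1"
  proof (rule ccontr)
    assume "\<not> u \<le> 1"
    then have u1: "u > 1" by simp
    have "u\<^sup>2 * (\<eta> + a) \<le> a + \<eta> * u"
      using near_fixed_point_energy[OF order_trans[OF b small]] by (simp add: \<eta>_def a_def u_def)
    also have "\<dots> \<le> u * (\<eta> + a)"
      using u1 a by (simp add: algebra_simps mult_le_cancel_left1)
    also have "\<dots> < u\<^sup>2 * (\<eta> + a)"
      using u1 \<eta> a by (intro mult_strict_right_mono) (auto simp: power2_eq_square)
    finally show False by simp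
  qed
  then show "norm w \<le> 1" by (simp add: u_def)
qed

context sk_resolvent
begin

text \<open>\<open>near_fixed_point_norm\<close> with
  \<open>\<epsilon>0 = 4 / (n * \<eta>)\<^sup>2\<close> and
  \<open>\<kappa> = 1 / (n * \<eta>)\<close>. The hypothesis \<open>small\<close> contains
  \<open>2 / (n * \<eta>) \<le> \<eta>\<close>, which supplies the largeness of
  \<open>n * \<eta>\<^sup>2\<close> that the concentration bound asks for.\<close>

lemma w_near_fixed_point:
  assumes \<eta>1: "\<eta> \<le> 1" and small: "4 / (n * \<eta>)\<^sup>2 + 2 / (n * \<eta>) \<le> \<eta>"
  shows "n * \<eta>\<^sup>2 \<ge> 1" "norm w \<le> 1" "norm (w\<^sup>2 - z * w + 1) \<le> 4 / (n * \<eta>)\<^sup>2 + 2 / (n * \<eta>)"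
proof -
  have c: "n * \<eta> > 0" using n Im_z by simp
  have k: "2 * (1 / (n * \<eta>)) \<le> \<eta>"
  proof -
    have "0 \<le> 4 / (n * \<eta>)\<^sup>2" by simp
    from order_trans[OF add_increasing[OF this order_refl] small] show ?thesis by simp
  qed
  then show big: "n * \<eta>\<^sup>2 \<ge> 1"
    using c by (simp add: field_simps power2_eq_square)
  have e: "norm (w\<^sup>2 - z * w + 1) \<le> 4 / (n * \<eta>)\<^sup>2 + 1 / (n * \<eta>) * (- Im w)"
    using w_quadratic[OF big] by (simp add: a_def)
  have "norm w \<le> 1 \<and> norm (w\<^sup>2 - z * w + 1) \<le> 4 / (n * \<eta>)\<^sup>2 + 2 * (1 / (n * \<eta>))"
  proof -
    have "0 \<le> 1 / (n * \<eta>)" using c by simp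
    then have "1 / (n * \<eta>) \<le> 1" using k \<eta>1 by linarith
    then show ?thesis
      using near_fixed_point_norm[OF e Im_z] \<open>0 \<le> 1 / (n * \<eta>)\<close> a_pos small by (simp add: a_def)
  qed
  then show "norm w \<le> 1" "norm (w\<^sup>2 - z * w + 1) \<le> 4 / (n * \<eta>)\<^sup>2 + 2 / (n * \<eta>)" by simp_all
qed

lemma ES_lower:
  assumes "n * \<eta>\<^sup>2 \<ge> 1" "\<beta> \<ge> 0"
  shows "1 - (5 / (n * \<eta>\<^sup>2) + \<beta> * \<nu> / \<eta>) \<le> norm (E S) * norm (z - w - \<beta>)"
proof -
  have "1 - norm (E S * (z - w - \<beta>)) \<le> norm (E S * (z - w - \<beta>) - 1)"
    using norm_triangle_ineq2[of 1 "E S * (z - w - \<beta>)"] by (simp add: norm_minus_commute)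
  then show ?thesis using ES_equation[OF assms] by (simp add: norm_mult)
qed

end

text \<open>Interface between the random matrix part and the two temperature regimes: what remains
  is deterministic analysis of a number \<open>w\<close> in the lower half-disc that nearly solves
  the quadratic equation.\<close>

lemma overlap_lower_bound:
  assumes n: "n \<ge> 1" and \<beta>: "\<beta> \<ge> 0" and \<eta>: "0 < \<eta>" "\<eta> \<le> 1"
    and small: "4 / (real n * \<eta>)\<^sup>2 + 2 / (real n * \<eta>) \<le> \<eta>"
    and err: "5 / (n * \<eta>\<^sup>2) + \<beta> * overlap_sq n \<beta> / \<eta> \<le> err" "err \<le> 1"
  shows "\<exists>w. Im w < 0 \<and> norm w \<le> 1 \<and>
    norm (w\<^sup>2 - Complex x \<eta> * w + 1) \<le> 4 / (real n * \<eta>)\<^sup>2 + 2 / (real n * \<eta>) \<and>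
    (1 - err)\<^sup>2 \<le> n * overlap_sq n \<beta> * (- Im w / \<eta> * (norm (Complex x \<eta> - w - \<beta>))\<^sup>2)"
proof -
  interpret sk_resolvent n \<beta> "Complex x \<eta>"
    using n \<eta> by unfold_locales simp_all
  note f = w_near_fixed_point[unfolded complex.sel, OF \<eta>(2) small]
  have "1 - err \<le> norm (E S) * norm (Complex x \<eta> - w - \<beta>)"
    using ES_lower[unfolded complex.sel, OF f(1) \<beta>] err(1) unfolding \<nu>_eq by linarith
  then have "(1 - err)\<^sup>2 \<le> (norm (E S) * norm (Complex x \<eta> - w - \<beta>))\<^sup>2"
    using err by (intro power_mono) auto
  also have "\<dots> \<le> n * \<nu> * (a / \<eta>) * (norm (Complex x \<eta> - w - \<beta>))\<^sup>2"
    unfolding power_mult_distrib using ES_bound by (intro mult_right_mono) auto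
  finally have "(1 - err)\<^sup>2 \<le> n * overlap_sq n \<beta> * (- Im w / \<eta> * (norm (Complex x \<eta> - w - \<beta>))\<^sup>2)"
    unfolding \<nu>_eq a_def by (simp add: mult.assoc)
  moreover have "Im w < 0" using a_pos by (simp add: a_def)
  ultimately show ?thesis using f by blast
qed

lemma overlap_sq_ge:
  assumes "n \<ge> 1"
  shows "n * overlap_sq n \<beta> \<ge> 1"
proof -
  \<comment> \<open>The overlap does not depend on \<open>z\<close>, so any point of the upper
    half-plane serves.\<close>
  interpret sk_resolvent n \<beta> "Complex 0 1"
    using assms by unfold_locales simp_all
  show ?thesis using \<nu>_ge assms unfolding \<nu>_eq by (simp add: field_simps)
qed

text \<open>
  The choice of \<open>\<eta>\<close>: the equation for \<open>E S\<close> needs \<open>n \<eta>\<^sup>2\<close> to be large, and \<open>1 / \<surd>\<eta> = n\<^sup>3\<^sup>/\<^sup>1\<^sup>6\<close> is the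
  rate obtained at \<open>\<beta> = 1\<close>.
\<close>

definition mesh :: "nat \<Rightarrow> real" where "mesh n = real n powr (- 3 / 8)"

lemma eventually_mesh:
  "\<forall>\<^sub>F n in sequentially. 0 < mesh n \<and> mesh n \<le> 1 \<and> 4 / (real n * mesh n)\<^sup>2 + 2 / (real n * mesh n) \<le> mesh n"
proof -
  have "\<forall>\<^sub>F n in sequentially. 4 / (real n * real n powr (- 3 / 8))\<^sup>2 + 2 / (real n * real n powr (- 3 / 8)) \<le> real n powr (- 3 / 8)"
    by real_asymp
  moreover have "\<forall>\<^sub>F n in sequentially. 0 < real n powr (- 3 / 8)" by real_asymp
  moreover have "\<forall>\<^sub>F n in sequentially. real n powr (- 3 / 8) \<le> 1" by real_asymp
  ultimately show ?thesis unfolding mesh_def by eventually_elim blast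
qed

text \<open>Alternative on the size of the overlap relative to \<open>mesh n\<close>: a large
  overlap already gives a power of \<open>n\<close> above \<open>3 / 16\<close>, a small one makes
  the equation for the mean of \<open>S\<close> effective.\<close>

lemma overlap_critical:
  assumes n: "n \<ge> 1" and mesh: "0 < mesh n" "mesh n \<le> 1"
      "4 / (real n * mesh n)\<^sup>2 + 2 / (real n * mesh n) \<le> mesh n"
    and n': "5 / (n * (mesh n)\<^sup>2) \<le> 1 / 4"
  shows "n * overlap_sq n 1 \<ge> 1 / 40 * real n powr (3 / 16)"
proof (cases "overlap_sq n 1 / mesh n \<le> 1 / 4")
  case True
  define \<eta> where "\<eta> = mesh n"
  have err: "5 / (n * \<eta>\<^sup>2) + 1 * overlap_sq n 1 / \<eta> \<le> 1 / 2" using add_mono[OF n' True] by (simp add: \<eta>_def)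
  obtain w where w: "Im w < 0" "norm w \<le> 1"
      "norm (w\<^sup>2 - Complex 2 \<eta> * w + 1) \<le> 4 / (real n * \<eta>)\<^sup>2 + 2 / (real n * \<eta>)"
      "(1 - 1 / 2)\<^sup>2 \<le> n * overlap_sq n 1 * (- Im w / \<eta> * (norm (Complex 2 \<eta> - w - of_real 1))\<^sup>2)"
    using overlap_lower_bound[OF n _ _ _ _ err, of 2] mesh unfolding \<eta>_def by auto
  have \<eta>: "0 < \<eta>" "\<eta> \<le> 1" using mesh by (simp_all add: \<eta>_def)
  define s where "s = sqrt \<eta>"
  have s: "0 < s" "s \<le> 1" "s\<^sup>2 = \<eta>" using \<eta> by (simp_all add: s_def)
  have c: "Complex 2 \<eta> = 2 + \<i> * \<eta>" by (simp add: complex_eq_iff)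
  \<comment> \<open>At \<beta> = 1 both roots merge at 1, so the quadratic controls only
    \<open>(w - 1)\<^sup>2\<close>, here by \<open>2 * \<eta>\<close>. The resulting square root of
    \<eta> is the origin of the exponent.\<close>
  have "norm (w - 1) \<le> 3 / 2 * s"
  proof -
    have "(w - 1)\<^sup>2 = (w\<^sup>2 - Complex 2 \<eta> * w + 1) + \<i> * \<eta> * w"
      unfolding c by (simp add: power2_eq_square algebra_simps)
    then have "(norm (w - 1))\<^sup>2 \<le> norm (w\<^sup>2 - Complex 2 \<eta> * w + 1) + norm (\<i> * \<eta> * w)"
      using norm_triangle_ineq by (simp only: norm_power[symmetric])
    also have "\<dots> \<le> \<eta> + \<eta> * 1"
      using w mesh \<eta> unfolding norm_mult
      by (intro add_mono) (auto simp: \<eta>_def intro: mult_left_le)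
    also have "\<dots> \<le> (3 / 2 * s)\<^sup>2" using s \<eta>(1) by (simp add: power_mult_distrib power2_eq_square)
    finally show ?thesis by (rule power2_le_imp_le) (use s in simp)
  qed
  note w1 = this
  have a: "- Im w \<le> 3 / 2 * s" using w1 abs_Im_le_cmod[of "w - 1"] by simp
  have "norm (Complex 2 \<eta> - w - of_real 1) \<le> norm (w - 1) + norm (\<i> * \<eta>)"
    unfolding c using norm_triangle_ineq4[of "\<i> * \<eta>" "w - 1"] by (simp add: algebra_simps)
  also have "\<dots> \<le> 3 / 2 * s + s * s"
  proof -
    have "norm (\<i> * complex_of_real \<eta>) = s * s"
      unfolding norm_mult norm_of_real abs_of_pos[OF \<eta>(1)] s(3)[symmetric] by (simp add: power2_eq_square)
    then show ?thesis using w1 by simp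
  qed
  also have "\<dots> \<le> 5 / 2 * s" using s by simp
  finally have y: "norm (Complex 2 \<eta> - w - of_real 1) \<le> 5 / 2 * s" .
  have ov: "n * overlap_sq n 1 \<ge> 0" using overlap_sq_ge[OF n, of 1] by simp
  \<comment> \<open>The powers of \<open>s = sqrt \<eta>\<close> combine to
    \<open>s / s\<^sup>2 * s\<^sup>2 = s\<close>. With \<open>10 * s\<close> here and
    \<open>1 / 4\<close> from the squared error, the constant becomes \<open>1 / 40\<close>.\<close>
  have "- Im w / \<eta> * (norm (Complex 2 \<eta> - w - of_real 1))\<^sup>2 \<le> (3 / 2 * s) / \<eta> * (5 / 2 * s)\<^sup>2"
    using a y \<eta> s w(1) by (intro mult_mono divide_right_mono power_mono) auto
  also have "\<dots> = 75 / 8 * s" using s(1) by (simp add: s(3)[symmetric] power2_eq_square)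
  also have "\<dots> \<le> 10 * s" using s by simp
  finally have "n * overlap_sq n 1 * (- Im w / \<eta> * (norm (Complex 2 \<eta> - w - of_real 1))\<^sup>2)
      \<le> n * overlap_sq n 1 * (10 * s)"
    by (rule mult_left_mono[OF _ ov])
  with w(4) have "1 / 4 \<le> n * overlap_sq n 1 * (10 * s)"
    by (simp add: power2_eq_square)
  then have "1 / 40 * (1 / s) \<le> n * overlap_sq n 1"
    using s by (simp add: field_simps)
  moreover have "1 / s = real n powr (3 / 16)"
  proof -
    have "s = (real n powr (- 3 / 8)) powr (1 / 2)"
      unfolding s_def \<eta>_def mesh_def by (simp add: powr_half_sqrt)
    then have "s = real n powr (- (3 / 16))" by (simp add: powr_powr)
    then show ?thesis by (simp add: powr_minus_divide)
  qed
  ultimately show ?thesis by simp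
next
  case False
  \<comment> \<open>Here the overlap exceeds \<open>mesh n / 4\<close>, so \<open>n\<close> times it
    exceeds a quarter of \<open>n powr (5 / 8)\<close>.\<close>
  have "1 / 40 * real n powr (3 / 16) \<le> 1 / 4 * real n powr (5 / 8)"
    using n by (intro mult_mono powr_mono) auto
  also have "real n powr (5 / 8) = n * mesh n"
  proof -
    have "real n powr 1 * real n powr (- 3 / 8) = real n powr (5 / 8)"
      unfolding powr_add[symmetric] by simp
    then show ?thesis using n by (simp add: mesh_def)
  qed
  also have "1 / 4 * (n * mesh n) \<le> n * overlap_sq n 1"
    using False mesh n by (simp add: field_simps)
  finally show ?thesis .
qed

text \<open>Indices with \<open>n * overlap_sq n \<beta> \<ge> L\<close> satisfy the bound. For the
  others the overlap is at most \<open>L / n\<close>, so the error tends to 0 and the lower bound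
  tends to \<open>1 / lim G = L\<close>. The sequence \<open>h\<close> merges both kinds of
  indices.\<close>

lemma liminf_overlap_subcritical:
  assumes \<beta>: "0 \<le> \<beta>" "\<beta> < 1"
  shows "ereal (1 / (1 - \<beta>\<^sup>2)) \<le> liminf (\<lambda>n. ereal (n * overlap_sq n \<beta>))"
proof (cases "\<beta> = 0")
  case True
  have "\<forall>\<^sub>F n in sequentially. ereal 1 \<le> ereal (n * overlap_sq n \<beta>)"
    using eventually_ge_at_top[of 1] by eventually_elim (simp add: overlap_sq_ge)
  then show ?thesis using True by (intro Liminf_bounded) simp
next
  case False
  then have \<beta>0: "\<beta> > 0" using \<beta> by simp
  define x where "x = \<beta> + 1 / \<beta>"
  define L where "L = 1 / (1 - \<beta>\<^sup>2)"
  have b2: "\<beta>\<^sup>2 < 1" using \<beta> by (simp add: abs_square_less_1)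
  have L: "L > 0" using b2 by (simp add: L_def)
  have gap: "1 / \<beta> - 1 > 0" using \<beta> \<beta>0 by simp
  define err where "err n = 5 / (n * (mesh n)\<^sup>2) + \<beta> * (L / n) / mesh n" for n :: nat
  have err0: "err \<longlonglongrightarrow> 0"
  proof -
    have "(\<lambda>n. 5 / (real n * (real n powr (- 3 / 8))\<^sup>2)) \<longlonglongrightarrow> 0" by real_asymp
    moreover have "(\<lambda>n. 1 / real n / real n powr (- 3 / 8)) \<longlonglongrightarrow> 0" by real_asymp
    ultimately have "(\<lambda>n. 5 / (real n * (real n powr (- 3 / 8))\<^sup>2) + \<beta> * L * (1 / real n / real n powr (- 3 / 8))) \<longlonglongrightarrow> 0 + \<beta> * L * 0"
      by (intro tendsto_add tendsto_mult tendsto_const)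
    then show ?thesis unfolding err_def[abs_def] mesh_def by simp
  qed
  define good where "good n \<longleftrightarrow> n \<ge> 1 \<and> 0 < mesh n \<and> mesh n \<le> 1
      \<and> 4 / (real n * mesh n)\<^sup>2 + 2 / (real n * mesh n) \<le> mesh n \<and> err n \<le> 1" for n
  have good: "\<forall>\<^sub>F n in sequentially. good n"
  proof -
    have "\<forall>\<^sub>F n in sequentially. err n \<le> 1"
      using order_tendstoD(2)[OF err0, of 1] by (auto elim: eventually_mono)
    then show ?thesis
      using eventually_mesh eventually_ge_at_top[of 1] by eventually_elim (simp add: good_def)
  qed
  define del where "del n = 4 / (real n * mesh n)\<^sup>2 + 2 / (real n * mesh n)" for n
  define P where "P n w \<longleftrightarrow> Im w < 0 \<and> norm w \<le> 1 \<and> norm (w\<^sup>2 - Complex x (mesh n) * w + 1) \<le> del n \<and>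
    (n * overlap_sq n \<beta> < L \<longrightarrow>
      (1 - err n)\<^sup>2 \<le> n * overlap_sq n \<beta> * (- Im w / mesh n * (norm (Complex x (mesh n) - w - \<beta>))\<^sup>2))" for n w
  \<comment> \<open>A \<open>w\<close> is chosen for every good \<open>n\<close>, also where the
    overlap is already large, so that limits can be taken along the full sequence.\<close>
  have ex: "\<exists>w. good n \<longrightarrow> P n w" for n
  proof (cases "good n")
    case True
    then have g: "n \<ge> 1" "0 < mesh n" "mesh n \<le> 1" "err n \<le> 1"
      "4 / (real n * mesh n)\<^sup>2 + 2 / (real n * mesh n) \<le> mesh n" by (simp_all add: good_def)
    show ?thesis
    proof (cases "n * overlap_sq n \<beta> < L")
      case True
      then have "overlap_sq n \<beta> \<le> L / n" using g(1) by (simp add: field_simps)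
      then have "5 / (n * (mesh n)\<^sup>2) + \<beta> * overlap_sq n \<beta> / mesh n \<le> err n"
        unfolding err_def using \<beta>0 g by (intro add_left_mono divide_right_mono mult_left_mono) auto
      from overlap_lower_bound[OF g(1) \<beta>(1) g(2,3,5) this g(4), of x]
      show ?thesis unfolding P_def del_def by blast
    next
      case False
      interpret sk_resolvent n \<beta> "Complex x (mesh n)"
        using g by unfold_locales simp_all
      note f = w_near_fixed_point[unfolded complex.sel, OF g(3,5)]
      show ?thesis using f False a_pos unfolding P_def del_def a_def by (intro exI[of _ w]) simp
    qed
  qed simp
  then obtain w where w: "good n \<Longrightarrow> P n (w n)" for n by metis
  have P: "\<forall>\<^sub>F n in sequentially. P n (w n) \<and> good n"
    using good by eventually_elim (simp add: w)
  have mesh0: "mesh \<longlonglongrightarrow> 0" unfolding mesh_def[abs_def] by real_asymp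
  have del0: "(\<lambda>n. del n / mesh n) \<longlonglongrightarrow> 0" unfolding del_def mesh_def by real_asymp
  have c: "Complex x y = of_real x + \<i> * y" for y by (simp add: complex_eq_iff)
  define e where "e n = (w n)\<^sup>2 - Complex x (mesh n) * w n + 1" for n
  have e0: "(\<lambda>n. e n / mesh n) \<longlonglongrightarrow> 0"
  proof (rule Lim_null_comparison[OF _ del0])
    show "\<forall>\<^sub>F n in sequentially. norm (e n / complex_of_real (mesh n)) \<le> del n / mesh n"
      using P by eventually_elim (simp add: P_def good_def e_def norm_divide divide_right_mono)
  qed
  \<comment> \<open>The quadratic at \<open>\<eta> = 0\<close> factors with roots
    \<open>\<beta>\<close> and \<open>1 / \<beta>\<close>; the term with \<open>\<i>\<close>
    compensates for the shift of \<open>z\<close> into the upper half-plane.\<close>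
  have fact: "(w n - \<beta>) * (w n - 1 / \<beta>) = e n + \<i> * mesh n * w n" for n
  proof -
    have "of_real \<beta> * (1 / of_real \<beta>) = (1 :: complex)" using \<beta>0 by simp
    then show ?thesis unfolding e_def c by (simp add: x_def algebra_simps power2_eq_square)
  qed
  \<comment> \<open>The root \<open>1 / \<beta>\<close> lies outside the unit disc, so
    \<open>w\<close> keeps a fixed distance from it and must approach the other root.\<close>
  have far: "norm (w n - 1 / \<beta>) \<ge> 1 / \<beta> - 1" if "norm (w n) \<le> 1" for n
    using norm_triangle_ineq2[of "1 / complex_of_real \<beta>" "w n"] that \<beta>0
    by (simp add: norm_minus_commute norm_divide)
  have w_lim: "w \<longlonglongrightarrow> of_real \<beta>"
  proof -
    have "(\<lambda>n. w n - \<beta>) \<longlonglongrightarrow> 0"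
    proof (rule Lim_null_comparison)
      show "\<forall>\<^sub>F n in sequentially. norm (w n - \<beta>) \<le> 2 * mesh n / (1 / \<beta> - 1)"
        using P
      proof eventually_elim
        case (elim n)
        then have g: "norm (w n) \<le> 1" "norm (e n) \<le> mesh n" "0 < mesh n"
          by (auto simp: P_def good_def e_def del_def)
        have "norm (w n - \<beta>) * (1 / \<beta> - 1) \<le> norm (w n - \<beta>) * norm (w n - 1 / \<beta>)"
          by (intro mult_left_mono far g) simp
        also have "\<dots> = norm (e n + \<i> * mesh n * w n)"
          unfolding norm_mult[symmetric] fact ..
        also have "\<dots> \<le> norm (e n) + norm (\<i> * mesh n * w n)" by (rule norm_triangle_ineq)
        also have "\<dots> \<le> mesh n + mesh n * 1"
          using g by (intro add_mono) (auto simp: norm_mult mult_left_le)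
        finally show ?case using gap by (simp add: field_simps)
      qed
      have "(\<lambda>n. 2 * mesh n / (1 / \<beta> - 1)) \<longlonglongrightarrow> 2 * 0 / (1 / \<beta> - 1)"
        by (intro tendsto_intros mesh0) (use gap in linarith)
      then show "(\<lambda>n. 2 * mesh n / (1 / \<beta> - 1)) \<longlonglongrightarrow> 0" by simp
    qed
    then show ?thesis by (rule LIM_zero_cancel)
  qed
  define G where "G n = - Im (w n) / mesh n * (norm (Complex x (mesh n) - w n - \<beta>))\<^sup>2" for n
  \<comment> \<open>Dividing the factorisation by \<open>mesh n\<close> gives
    \<open>(w - \<beta>) / mesh n\<close> as a quotient of convergent sequences. As
    \<open>\<beta>\<close> is real, its imaginary part is that of \<open>w / mesh n\<close>.\<close>
  have "(\<lambda>n. - Im (w n) / mesh n) \<longlonglongrightarrow> \<beta>\<^sup>2 * L"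
  proof -
    have t1: "(\<lambda>n. - Im ((e n / mesh n + \<i> * w n) / (w n - 1 / \<beta>))) \<longlonglongrightarrow> - Im ((0 + \<i> * \<beta>) / (complex_of_real \<beta> - complex_of_real (1 / \<beta>)))"
    proof (intro tendsto_intros e0 w_lim)
      show "complex_of_real \<beta> - complex_of_real (1 / \<beta>) \<noteq> 0"
      proof
        assume "complex_of_real \<beta> - complex_of_real (1 / \<beta>) = 0"
        then have "complex_of_real (\<beta> - 1 / \<beta>) = of_real 0" by simp
        then have "\<beta> = 1 / \<beta>" unfolding of_real_eq_iff by simp
        then show False using b2 \<beta>0 by (simp add: field_simps power2_eq_square)
      qed
    qed
    have t2: "- Im ((0 + \<i> * \<beta>) / (complex_of_real \<beta> - complex_of_real (1 / \<beta>))) = \<beta>\<^sup>2 * L"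
    proof -
      have "(0 + \<i> * complex_of_real \<beta>) / (complex_of_real \<beta> - complex_of_real (1 / \<beta>)) = \<i> * complex_of_real (\<beta> / (\<beta> - 1 / \<beta>))"
        by simp
      then have "Im ((0 + \<i> * complex_of_real \<beta>) / (complex_of_real \<beta> - complex_of_real (1 / \<beta>))) = \<beta> / (\<beta> - 1 / \<beta>)"
        by simp
      moreover have "- (\<beta> / (\<beta> - 1 / \<beta>)) = \<beta>\<^sup>2 * L"
        unfolding L_def using \<beta>0 b2 by (simp add: field_simps power2_eq_square)
      ultimately show ?thesis by simp
    qed
    have t3: "\<forall>\<^sub>F n in sequentially. - Im ((e n / mesh n + \<i> * w n) / (w n - 1 / \<beta>)) = - Im (w n) / mesh n"
      using P
    proof eventually_elim
      case (elim n)
      then have g: "norm (w n) \<le> 1" "0 < mesh n" by (auto simp: P_def good_def)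
      have ne: "w n - 1 / \<beta> \<noteq> 0" using far[OF g(1)] gap by auto
      have "e n / mesh n + \<i> * w n = (e n + \<i> * mesh n * w n) / mesh n"
        using g by (simp add: field_simps)
      also have "\<dots> = (w n - \<beta>) * (w n - 1 / \<beta>) / mesh n" unfolding fact ..
      finally have "(e n / mesh n + \<i> * w n) / (w n - 1 / \<beta>) = (w n - \<beta>) / mesh n"
        using ne by simp
      then show ?case by (simp add: Im_divide_of_real)
    qed
    show ?thesis using Lim_transform_eventually[OF t1 t3] unfolding t2 .
  qed
  moreover have "(\<lambda>n. norm (Complex x (mesh n) - w n - \<beta>)) \<longlonglongrightarrow> norm (complex_of_real x + \<i> * of_real 0 - \<beta> - \<beta>)"
    unfolding c by (intro tendsto_intros w_lim mesh0)
  ultimately have "G \<longlonglongrightarrow> \<beta>\<^sup>2 * L * (norm (complex_of_real x + \<i> * of_real 0 - \<beta> - \<beta>))\<^sup>2"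
    unfolding G_def[abs_def] by (intro tendsto_mult tendsto_power)
  moreover have "\<beta>\<^sup>2 * L * (norm (complex_of_real x + \<i> * of_real 0 - \<beta> - \<beta>))\<^sup>2 = 1 / L"
  proof -
    have "complex_of_real x + \<i> * of_real 0 - \<beta> - \<beta> = of_real (1 / \<beta> - \<beta>)" by (simp add: x_def)
    then have n1: "(norm (complex_of_real x + \<i> * of_real 0 - \<beta> - \<beta>))\<^sup>2 = (1 / \<beta> - \<beta>)\<^sup>2"
      by (simp only: norm_of_real power2_abs)
    have n2: "\<beta>\<^sup>2 * (1 / \<beta> - \<beta>)\<^sup>2 = (1 - \<beta>\<^sup>2)\<^sup>2"
      using \<beta>0 unfolding power_mult_distrib[symmetric] by (simp add: right_diff_distrib power2_eq_square)
    have "\<beta>\<^sup>2 * L * (1 / \<beta> - \<beta>)\<^sup>2 = L * (1 - \<beta>\<^sup>2)\<^sup>2"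
      unfolding n2[symmetric] by (simp only: mult_ac)
    also have "\<dots> = 1 / L" using b2 by (simp add: L_def power2_eq_square)
    finally show ?thesis unfolding n1 .
  qed
  ultimately have G: "G \<longlonglongrightarrow> 1 / L" by simp
  define h where "h n = min L ((1 - err n)\<^sup>2 / G n)" for n
  have "h \<longlonglongrightarrow> min L ((1 - 0)\<^sup>2 / (1 / L))"
    unfolding h_def[abs_def] using L by (intro tendsto_min tendsto_divide tendsto_power tendsto_diff tendsto_const err0 G) simp
  then have h: "h \<longlonglongrightarrow> L" by simp
  have "\<forall>\<^sub>F n in sequentially. G n > 0" using order_tendstoD(1)[OF G, of 0] L by simp
  with P have "\<forall>\<^sub>F n in sequentially. ereal (h n) \<le> ereal (n * overlap_sq n \<beta>)"
  proof eventually_elim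
    case (elim n)
    show ?case
    proof (cases "n * overlap_sq n \<beta> < L")
      case True
      then have "(1 - err n)\<^sup>2 \<le> n * overlap_sq n \<beta> * G n" using elim by (simp add: P_def G_def)
      then have "(1 - err n)\<^sup>2 / G n \<le> n * overlap_sq n \<beta>" using elim by (simp add: divide_le_eq)
      then show ?thesis by (simp add: h_def min.coboundedI2)
    qed (simp add: h_def min.coboundedI1)
  qed
  then have "liminf (\<lambda>n. ereal (h n)) \<le> liminf (\<lambda>n. ereal (n * overlap_sq n \<beta>))" by (rule Liminf_mono)
  moreover have "liminf (\<lambda>n. ereal (h n)) = ereal L"
    using h by (intro lim_imp_Liminf) auto
  ultimately show ?thesis unfolding L_def by simp
qed

subsection \<open>Comparison of Gaussian processes\<close>

text \<open>
  The rotation \<open>\<theta>\<close> moves the process with coefficients \<open>a\<close> to the one with coefficients \<open>b\<close>. The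
  \<open>q\<close>-th moment of the partition function \<open>Z\<close> is used because its entropy factor \<open>(card N)\<^sup>q\<close> disappears
  as \<open>q\<close> tends to 0.
\<close>

locale gauss_comparison =
  fixes J :: "'i set" and N :: "'u set" and a b :: "'u \<Rightarrow> 'i \<Rightarrow> real" and q \<tau> :: real
  assumes J: "finite J" and N: "finite N" "N \<noteq> {}"
    and q: "0 < q" "q < 1" and \<tau>: "\<tau> > 0"
    and orth: "\<And>u v. u \<in> N \<Longrightarrow> v \<in> N \<Longrightarrow> (\<Sum>e\<in>J. a u e * b v e) = 0"
begin

definition c where "c \<theta> u e = cos \<theta> * a u e + sin \<theta> * b u e"
text \<open>The derivative of \<open>c\<close> in \<open>\<theta>\<close>; accordingly
  \<open>W\<close> is the derivative of \<open>U\<close>.\<close>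

definition c' where "c' \<theta> u e = - sin \<theta> * a u e + cos \<theta> * b u e"
definition U where "U \<theta> g u = (\<Sum>e\<in>J. c \<theta> u e * g e)"
definition W where "W \<theta> g u = (\<Sum>e\<in>J. c' \<theta> u e * g e)"
definition ex where "ex \<theta> g u = exp (\<tau> * U \<theta> g u)"
definition Z where "Z \<theta> g = (\<Sum>u\<in>N. ex \<theta> g u)"
definition f where "f \<theta> u g = Z \<theta> g powr (q - 1) * ex \<theta> g u"
text \<open>The derivative in \<open>\<theta>\<close> of \<open>Z \<theta> g powr q\<close>,
  arranged as a linear form in the Gaussians times \<open>f\<close> so that integration by parts
  applies.\<close>

definition G where "G \<theta> g = q * \<tau> * (\<Sum>u\<in>N. W \<theta> g u * f \<theta> u g)"
text \<open>The partial derivative of \<open>f \<theta> u\<close> in the coordinate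
  \<open>e\<close>.\<close>

definition Df where "Df \<theta> u e g = \<tau> * c \<theta> u e * f \<theta> u g
    - (1 - q) * \<tau> * (Z \<theta> g powr (q - 2) * ex \<theta> g u * (\<Sum>v\<in>N. ex \<theta> g v * c \<theta> v e))"
definition A where "A = (\<Sum>u\<in>N. \<Sum>e\<in>J. \<bar>a u e\<bar> + \<bar>b u e\<bar>)"
definition s :: "('i \<Rightarrow> real) \<Rightarrow> real" where "s g = (\<Sum>e\<in>J. \<bar>g e\<bar>)"
text \<open>Difference of the two covariance kernels: final process minus initial process.\<close>

definition Cov where "Cov u v = (\<Sum>e\<in>J. b u e * b v e) - (\<Sum>e\<in>J. a u e * a v e)"

abbreviation P where "P \<equiv> gauss_space J"

lemma ex_pos: "ex \<theta> g u > 0" by (simp add: ex_def)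

lemma Z_pos: "Z \<theta> g > 0"
  unfolding Z_def using N ex_pos by (intro sum_pos) auto

lemma ex_le_Z: "u \<in> N \<Longrightarrow> ex \<theta> g u \<le> Z \<theta> g"
  unfolding Z_def using N ex_pos by (intro member_le_sum) (auto simp: less_imp_le)

lemma A_nonneg: "A \<ge> 0" unfolding A_def by (intro sum_nonneg add_nonneg_nonneg) auto

lemma s_nonneg: "s g \<ge> 0" unfolding s_def by (intro sum_nonneg) auto

lemma ab_le_A:
  assumes "u \<in> N" "e \<in> J"
  shows "\<bar>a u e\<bar> + \<bar>b u e\<bar> \<le> A"
proof -
  have "\<bar>a u e\<bar> + \<bar>b u e\<bar> \<le> (\<Sum>e\<in>J. \<bar>a u e\<bar> + \<bar>b u e\<bar>)"
    using assms J by (intro member_le_sum) auto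
  also have "\<dots> \<le> A"
    unfolding A_def using assms N by (intro member_le_sum[of u N]) (auto intro: sum_nonneg)
  finally show ?thesis .
qed

lemma c_le: "u \<in> N \<Longrightarrow> e \<in> J \<Longrightarrow> \<bar>c \<theta> u e\<bar> \<le> A"
  and c'_le: "u \<in> N \<Longrightarrow> e \<in> J \<Longrightarrow> \<bar>c' \<theta> u e\<bar> \<le> A"
proof -
  assume ue: "u \<in> N" "e \<in> J"
  have "\<bar>x * y\<bar> \<le> \<bar>y\<bar>" if "\<bar>x\<bar> \<le> 1" for x y :: real
    using that by (simp add: abs_mult mult_left_le_one_le)
  note * = this[OF abs_sin_le_one[of \<theta>]] this[OF abs_cos_le_one[of \<theta>]]
  have "\<bar>c \<theta> u e\<bar> \<le> \<bar>cos \<theta> * a u e\<bar> + \<bar>sin \<theta> * b u e\<bar>" unfolding c_def by (rule abs_triangle_ineq)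
  then show "\<bar>c \<theta> u e\<bar> \<le> A" using *(2)[of "a u e"] *(1)[of "b u e"] ab_le_A[OF ue] by linarith
  have "\<bar>c' \<theta> u e\<bar> \<le> \<bar>- sin \<theta> * a u e\<bar> + \<bar>cos \<theta> * b u e\<bar>" unfolding c'_def by (rule abs_triangle_ineq)
  then show "\<bar>c' \<theta> u e\<bar> \<le> A" using *(1)[of "a u e"] *(2)[of "b u e"] ab_le_A[OF ue] by simp
qed

lemma lin_le:
  assumes "\<And>e. e \<in> J \<Longrightarrow> \<bar>k e\<bar> \<le> A"
  shows "\<bar>\<Sum>e\<in>J. k e * g e\<bar> \<le> A * s g"
  unfolding s_def sum_distrib_left abs_mult[symmetric]
  by (rule order_trans[OF sum_abs], rule sum_mono) (simp add: abs_mult mult_right_mono assms)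

lemma U_le: "u \<in> N \<Longrightarrow> \<bar>U \<theta> g u\<bar> \<le> A * s g"
  unfolding U_def by (rule lin_le) (rule c_le)

lemma W_le: "u \<in> N \<Longrightarrow> \<bar>W \<theta> g u\<bar> \<le> A * s g"
  unfolding W_def by (rule lin_le) (rule c'_le)

lemma ex_le: "u \<in> N \<Longrightarrow> ex \<theta> g u \<le> exp (\<tau> * A * s g)"
  unfolding ex_def using U_le[of u \<theta> g] \<tau> by (simp add: mult.assoc abs_le_iff)

lemma ex_ge: "u \<in> N \<Longrightarrow> exp (- (\<tau> * A * s g)) \<le> ex \<theta> g u"
proof -
  assume "u \<in> N"
  then have "\<tau> * (- (A * s g)) \<le> \<tau> * U \<theta> g u" using U_le[of u \<theta> g] \<tau> by (intro mult_left_mono) auto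
  then show ?thesis by (simp add: ex_def mult.assoc)
qed

lemma f_pos: "f \<theta> u g > 0"
  unfolding f_def using Z_pos[of \<theta> g] ex_pos by simp

text \<open>The power of \<open>Z\<close> is negative, so a lower bound on \<open>Z\<close> is
  wanted: a single summand, at least \<open>exp (- (\<tau> * A * s g))\<close>, provides it.\<close>

lemma f_le:
  assumes u: "u \<in> N"
  shows "f \<theta> u g \<le> exp (2 * \<tau> * A * s g)"
proof -
  let ?m = "exp (- (\<tau> * A * s g))"
  have "Z \<theta> g powr (q - 1) \<le> ?m powr (q - 1)"
    using order_trans[OF ex_ge[OF u] ex_le_Z[OF u]] q by (intro powr_mono2') auto
  also have "\<dots> = exp ((1 - q) * (\<tau> * A * s g))" by (simp add: powr_def algebra_simps)
  also have "\<dots> \<le> exp (1 * (\<tau> * A * s g))"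
    using q \<tau> A_nonneg s_nonneg[of g] by (simp add: mult_left_le_one_le)
  finally have "f \<theta> u g \<le> exp (1 * (\<tau> * A * s g)) * exp (\<tau> * A * s g)"
    unfolding f_def using ex_le[OF u] by (intro mult_mono) (auto simp: ex_pos less_imp_le)
  then show ?thesis by (simp add: exp_add[symmetric] mult_ac)
qed

lemma Z_powr_q2: "Z \<theta> g powr (q - 2) * ex \<theta> g u * Z \<theta> g = f \<theta> u g"
proof -
  have "Z \<theta> g powr (q - 2) * Z \<theta> g = Z \<theta> g powr (q - 2) * Z \<theta> g powr 1"
    using Z_pos[of \<theta> g] by simp
  also have "\<dots> = Z \<theta> g powr (q - 1)" unfolding powr_add[symmetric] by simp
  finally show ?thesis unfolding f_def by (simp add: mult_ac)
qed

lemma Df_le: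
  assumes u: "u \<in> N" "e \<in> J"
  shows "\<bar>Df \<theta> u e g\<bar> \<le> 2 * \<tau> * A * exp (2 * \<tau> * A * s g)"
proof -
  let ?z = "Z \<theta> g powr (q - 2) * ex \<theta> g u"
  have z: "?z \<ge> 0" using ex_pos[of \<theta> g u] by simp
  have 1: "\<bar>\<tau> * c \<theta> u e * f \<theta> u g\<bar> \<le> \<tau> * A * f \<theta> u g"
    using c_le[OF u] \<tau> f_pos[of \<theta> u g] by (simp add: abs_mult mult_right_mono)
  have "\<bar>\<Sum>v\<in>N. ex \<theta> g v * c \<theta> v e\<bar> \<le> (\<Sum>v\<in>N. ex \<theta> g v * A)"
  proof (rule order_trans[OF sum_abs], rule sum_mono)
    fix v assume "v \<in> N"
    then show "\<bar>ex \<theta> g v * c \<theta> v e\<bar> \<le> ex \<theta> g v * A"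
      unfolding abs_mult abs_of_pos[OF ex_pos] using c_le u ex_pos[of \<theta> g v] by (intro mult_left_mono) auto
  qed
  then have "?z * \<bar>\<Sum>v\<in>N. ex \<theta> g v * c \<theta> v e\<bar> \<le> ?z * (Z \<theta> g * A)"
    using z unfolding Z_def sum_distrib_right by (intro mult_left_mono)
  also have "\<dots> = f \<theta> u g * A" unfolding Z_powr_q2[symmetric] by (simp add: mult.assoc)
  finally have "\<bar>?z * (\<Sum>v\<in>N. ex \<theta> g v * c \<theta> v e)\<bar> \<le> f \<theta> u g * A"
    unfolding abs_mult[of ?z] abs_of_nonneg[OF z] .
  then have "(1 - q) * \<tau> * \<bar>?z * (\<Sum>v\<in>N. ex \<theta> g v * c \<theta> v e)\<bar> \<le> (1 - q) * \<tau> * (f \<theta> u g * A)"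
    using q \<tau> by (intro mult_left_mono) auto
  also have "\<dots> \<le> 1 * \<tau> * (f \<theta> u g * A)"
    using q \<tau> f_pos[of \<theta> u g] A_nonneg by (intro mult_right_mono) auto
  finally have 2: "\<bar>(1 - q) * \<tau> * (?z * (\<Sum>v\<in>N. ex \<theta> g v * c \<theta> v e))\<bar> \<le> \<tau> * A * f \<theta> u g"
    using q \<tau> by (simp add: abs_mult mult_ac)
  have "\<bar>Df \<theta> u e g\<bar> \<le> 2 * \<tau> * A * f \<theta> u g"
    unfolding Df_def
    using 1 2 abs_triangle_ineq4[of "\<tau> * c \<theta> u e * f \<theta> u g" "(1 - q) * \<tau> * (?z * (\<Sum>v\<in>N. ex \<theta> g v * c \<theta> v e))"]
    by linarith
  also have "\<dots> \<le> 2 * \<tau> * A * exp (2 * \<tau> * A * s g)"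
    using f_le[OF u(1)] \<tau> A_nonneg by (intro mult_left_mono) auto
  finally show ?thesis .
qed

lemma U_deriv:
  assumes e: "e \<in> J"
  shows "((\<lambda>t. U \<theta> (g(e := t)) u) has_real_derivative c \<theta> u e) (at t)"
proof -
  have "U \<theta> (g(e := t)) u = c \<theta> u e * t + (\<Sum>e'\<in>J - {e}. c \<theta> u e' * g e')" for t
    unfolding U_def using sum.remove[OF J e, of "\<lambda>e'. c \<theta> u e' * (g(e := t)) e'"] by simp
  then show ?thesis by (auto intro!: derivative_eq_intros)
qed

lemma ex_deriv:
  assumes "e \<in> J"
  shows "((\<lambda>t. ex \<theta> (g(e := t)) u) has_real_derivative \<tau> * c \<theta> u e * ex \<theta> (g(e := t)) u) (at t)"
  unfolding ex_def by (auto intro!: derivative_eq_intros U_deriv[OF assms])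

lemma Z_deriv:
  assumes "e \<in> J"
  shows "((\<lambda>t. Z \<theta> (g(e := t))) has_real_derivative (\<Sum>v\<in>N. \<tau> * c \<theta> v e * ex \<theta> (g(e := t)) v)) (at t)"
  unfolding Z_def by (intro DERIV_sum ex_deriv assms)

lemma f_deriv:
  assumes e: "e \<in> J"
  shows "((\<lambda>t. f \<theta> u (g(e := t))) has_vector_derivative Df \<theta> u e g) (at (g e))"
proof -
  let ?t = "g e"
  have "((\<lambda>t. Z \<theta> (g(e := t)) powr (q - 1)) has_real_derivative
      (q - 1) * Z \<theta> (g(e := ?t)) powr (q - 1 - 1) * (\<Sum>v\<in>N. \<tau> * c \<theta> v e * ex \<theta> (g(e := ?t)) v)) (at ?t)"
    using DERIV_fun_powr[OF Z_deriv[OF e, of \<theta> g ?t] Z_pos, where r = "q - 1"] by (simp only: of_nat_1)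
  from DERIV_mult[OF this ex_deriv[OF e, of \<theta> g u ?t]]
  have "((\<lambda>t. f \<theta> u (g(e := t))) has_real_derivative
     (q - 1) * Z \<theta> g powr (q - 1 - 1) * (\<Sum>v\<in>N. \<tau> * c \<theta> v e * ex \<theta> g v) * ex \<theta> g u
      + \<tau> * c \<theta> u e * ex \<theta> g u * Z \<theta> g powr (q - 1)) (at ?t)"
    unfolding f_def by simp
  moreover have "(q - 1) * Z \<theta> g powr (q - 1 - 1) * (\<Sum>v\<in>N. \<tau> * c \<theta> v e * ex \<theta> g v) * ex \<theta> g u
      + \<tau> * c \<theta> u e * ex \<theta> g u * Z \<theta> g powr (q - 1) = Df \<theta> u e g"
  proof -
    have "(\<Sum>v\<in>N. \<tau> * c \<theta> v e * ex \<theta> g v) = \<tau> * (\<Sum>v\<in>N. ex \<theta> g v * c \<theta> v e)"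
      unfolding sum_distrib_left by (intro sum.cong refl) simp
    moreover have "q - 1 - 1 = q - 2" by simp
    ultimately show ?thesis unfolding Df_def f_def by (simp only:) (simp add: algebra_simps)
  qed
  ultimately show ?thesis by (simp only: has_real_derivative_iff_has_vector_derivative)
qed

lemma measurable_coord: "e \<in> J \<Longrightarrow> (\<lambda>g. g e) \<in> borel_measurable P"
  using measurable_component_singleton[of e J "\<lambda>_. std_gauss"] by simp

lemma measurable_U: "(\<lambda>g. U \<theta> g u) \<in> borel_measurable P"
  unfolding U_def by (intro borel_measurable_sum borel_measurable_times borel_measurable_const measurable_coord)

lemma measurable_ex: "(\<lambda>g. ex \<theta> g u) \<in> borel_measurable P"
  unfolding ex_def by (intro measurable_compose[OF _ borel_measurable_exp] borel_measurable_times borel_measurable_const measurable_U)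

lemma measurable_Z: "(\<lambda>g. Z \<theta> g) \<in> borel_measurable P"
  unfolding Z_def by (intro borel_measurable_sum measurable_ex)

lemma measurable_f: "f \<theta> u \<in> borel_measurable P"
proof -
  note measurable_Z [measurable] measurable_ex [measurable]
  show ?thesis unfolding f_def[abs_def] by measurable
qed

lemma measurable_Df: "Df \<theta> u e \<in> borel_measurable P"
proof -
  note measurable_Z [measurable] measurable_ex [measurable] measurable_f [measurable]
  show ?thesis unfolding Df_def[abs_def] by measurable
qed

lemma abs_coord_le: "e \<in> J \<Longrightarrow> \<bar>g e\<bar> \<le> exp (s g)"
proof -
  assume "e \<in> J"
  then have "\<bar>g e\<bar> \<le> s g" unfolding s_def using J by (intro member_le_sum) auto
  then show ?thesis using exp_ge_add_one_self[of "s g"] by linarith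
qed

lemma integrable_coord_f:
  assumes "u \<in> N" "e \<in> J"
  shows "integrable P (\<lambda>g. g e * f \<theta> u g)"
proof (rule integrable_gauss_space_bound[OF J])
  show "(\<lambda>g. g e * f \<theta> u g) \<in> borel_measurable P"
    by (intro borel_measurable_times measurable_coord measurable_f assms)
  fix g :: "'i \<Rightarrow> real"
  have "norm (g e * f \<theta> u g) \<le> exp (s g) * exp (2 * \<tau> * A * s g)"
    unfolding norm_mult using assms abs_coord_le[of e g] f_le[of u \<theta> g] f_pos[of \<theta> u g] by (intro mult_mono) auto
  then show "norm (g e * f \<theta> u g) \<le> 1 * exp ((1 + 2 * \<tau> * A) * (\<Sum>e\<in>J. \<bar>g e\<bar>))"
    by (simp add: exp_add[symmetric] s_def distrib_right)
qed

lemma coord_ibp: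
  assumes "u \<in> N" "e \<in> J"
  shows "(LINT g|P. g e * f \<theta> u g) = (LINT g|P. Df \<theta> u e g)"
proof -
  let ?C = "max 1 (2 * \<tau> * A)"
  have "(LINT g|P. g e *\<^sub>R f \<theta> u g) = (LINT g|P. Df \<theta> u e g)"
  proof (rule gauss_ibp[OF J assms(2)])
    show "norm (f \<theta> u g) \<le> ?C * exp (2 * \<tau> * A * (\<Sum>j\<in>J. \<bar>g j\<bar>))" for g
    proof -
      have "norm (f \<theta> u g) \<le> 1 * exp (2 * \<tau> * A * s g)"
        using f_le[OF assms(1), of \<theta> g] f_pos[of \<theta> u g] by simp
      also have "\<dots> \<le> ?C * exp (2 * \<tau> * A * s g)" by (intro mult_right_mono) auto
      finally show ?thesis unfolding s_def .
    qed
    show "norm (Df \<theta> u e g) \<le> ?C * exp (2 * \<tau> * A * (\<Sum>j\<in>J. \<bar>g j\<bar>))" for g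
    proof -
      have "norm (Df \<theta> u e g) \<le> (2 * \<tau> * A) * exp (2 * \<tau> * A * s g)"
        using Df_le[OF assms, of \<theta> g] by simp
      also have "\<dots> \<le> ?C * exp (2 * \<tau> * A * s g)" by (intro mult_right_mono) auto
      finally show ?thesis unfolding s_def .
    qed
  qed (intro f_deriv measurable_f measurable_Df assms)+
  then show ?thesis by simp
qed

lemma integrable_Df: "u \<in> N \<Longrightarrow> e \<in> J \<Longrightarrow> integrable P (Df \<theta> u e)"
  by (rule integrable_gauss_space_bound[OF J measurable_Df, where C = "2 * \<tau> * A" and c = "2 * \<tau> * A"])
     (use Df_le in \<open>simp add: s_def\<close>)

lemma G_expand: "G \<theta> g = q * \<tau> * (\<Sum>u\<in>N. \<Sum>e\<in>J. c' \<theta> u e * (g e * f \<theta> u g))"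
  unfolding G_def W_def sum_distrib_right by (simp add: mult.assoc)

lemma integrable_G: "integrable P (G \<theta>)"
  unfolding G_expand by (intro integrable_mult_right Bochner_Integration.integrable_sum integrable_coord_f)

text \<open>The covariance between the velocity \<open>W\<close> and the process \<open>U\<close>.
  Independence of the two processes, in the form of \<open>orth\<close>, removes the cross
  terms.\<close>

lemma c'_c: "u \<in> N \<Longrightarrow> v \<in> N \<Longrightarrow> (\<Sum>e\<in>J. c' \<theta> u e * c \<theta> v e) = sin \<theta> * cos \<theta> * Cov u v"
proof -
  assume uv: "u \<in> N" "v \<in> N"
  have "(\<Sum>e\<in>J. c' \<theta> u e * c \<theta> v e)
      = (\<Sum>e\<in>J. sin \<theta> * cos \<theta> * (b u e * b v e) - sin \<theta> * cos \<theta> * (a u e * a v e)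
          + (cos \<theta>)\<^sup>2 * (a v e * b u e) - (sin \<theta>)\<^sup>2 * (a u e * b v e))"
    unfolding c'_def c_def by (intro sum.cong refl) (simp add: algebra_simps power2_eq_square)
  also have "\<dots> = sin \<theta> * cos \<theta> * Cov u v
      + (cos \<theta>)\<^sup>2 * (\<Sum>e\<in>J. a v e * b u e) - (sin \<theta>)\<^sup>2 * (\<Sum>e\<in>J. a u e * b v e)"
    unfolding Cov_def by (simp add: sum.distrib sum_subtractf sum_distrib_left right_diff_distrib)
  finally show ?thesis using orth uv by simp
qed

text \<open>The first term of \<open>Df\<close> is also written as a double sum, using
  \<open>f = Z powr (q - 2) * ex * Z\<close>. Only then do variances and covariances carry the same
  weights \<open>ex \<theta> g u * ex \<theta> g v\<close>.\<close>

lemma Df_sum: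
  "(\<Sum>u\<in>N. \<Sum>e\<in>J. c' \<theta> u e * Df \<theta> u e g)
    = \<tau> * (sin \<theta> * cos \<theta>) * Z \<theta> g powr (q - 2)
      * (\<Sum>u\<in>N. \<Sum>v\<in>N. ex \<theta> g u * ex \<theta> g v * (Cov u u - (1 - q) * Cov u v))"
proof -
  let ?z = "Z \<theta> g powr (q - 2)" and ?sc = "sin \<theta> * cos \<theta>"
  have "(\<Sum>e\<in>J. c' \<theta> u e * Df \<theta> u e g)
      = \<tau> * ?sc * ?z * (\<Sum>v\<in>N. ex \<theta> g u * ex \<theta> g v * (Cov u u - (1 - q) * Cov u v))" if u: "u \<in> N" for u
  proof -
    have "(\<Sum>e\<in>J. c' \<theta> u e * Df \<theta> u e g)
        = (\<Sum>e\<in>J. (c' \<theta> u e * c \<theta> u e) * (\<tau> * f \<theta> u g)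
            - (\<Sum>v\<in>N. (c' \<theta> u e * c \<theta> v e) * ((1 - q) * \<tau> * ?z * ex \<theta> g u * ex \<theta> g v)))"
      unfolding Df_def right_diff_distrib sum_distrib_left
      by (intro sum.cong refl arg_cong2[where f = "(-)"]) simp_all
    also have "\<dots> = (\<Sum>e\<in>J. c' \<theta> u e * c \<theta> u e) * (\<tau> * f \<theta> u g)
        - (\<Sum>v\<in>N. (\<Sum>e\<in>J. c' \<theta> u e * c \<theta> v e) * ((1 - q) * \<tau> * ?z * ex \<theta> g u * ex \<theta> g v))"
      unfolding sum_subtractf sum_distrib_right by (subst (2) sum.swap) (rule refl)
    also have "\<dots> = ?sc * Cov u u * (\<tau> * f \<theta> u g)
        - (\<Sum>v\<in>N. ?sc * Cov u v * ((1 - q) * \<tau> * ?z * ex \<theta> g u * ex \<theta> g v))"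
      using u by (simp add: c'_c)
    also have "f \<theta> u g = ?z * ex \<theta> g u * (\<Sum>v\<in>N. ex \<theta> g v)"
      unfolding Z_powr_q2[symmetric] by (simp add: Z_def)
    also have "?sc * Cov u u * (\<tau> * (?z * ex \<theta> g u * (\<Sum>v\<in>N. ex \<theta> g v)))
        - (\<Sum>v\<in>N. ?sc * Cov u v * ((1 - q) * \<tau> * ?z * ex \<theta> g u * ex \<theta> g v))
        = \<tau> * ?sc * ?z * (\<Sum>v\<in>N. ex \<theta> g u * ex \<theta> g v * (Cov u u - (1 - q) * Cov u v))"
      unfolding sum_distrib_left sum_subtractf[symmetric] by (intro sum.cong refl) (simp add: algebra_simps)
    finally show ?thesis .
  qed
  then show ?thesis by (simp add: sum_distrib_left)
qed

text \<open>Symmetrising the double sum in \<open>u\<close> and \<open>v\<close> leaves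
  \<open>1 - q\<close> times the gain in the variance of the increment plus \<open>q\<close> times
  the gain in the variances. For small \<open>q\<close> the first, which is the Sudakov-Fernique
  condition, dominates.\<close>

lemma integral_G_nonneg:
  assumes diag: "\<And>u. u \<in> N \<Longrightarrow> Cov u u \<ge> 0"
    and incr: "\<And>u v. u \<in> N \<Longrightarrow> v \<in> N \<Longrightarrow> Cov u u + Cov v v - 2 * Cov u v \<ge> 0"
    and \<theta>: "0 \<le> \<theta>" "\<theta> \<le> pi / 2"
  shows "(LINT g|P. G \<theta> g) \<ge> 0"
proof -
  have "(LINT g|P. G \<theta> g) = q * \<tau> * (\<Sum>u\<in>N. \<Sum>e\<in>J. c' \<theta> u e * (LINT g|P. g e * f \<theta> u g))"
  proof -
    have "(LINT g|P. (\<Sum>u\<in>N. \<Sum>e\<in>J. c' \<theta> u e * (g e * f \<theta> u g))) = (\<Sum>u\<in>N. (LINT g|P. (\<Sum>e\<in>J. c' \<theta> u e * (g e * f \<theta> u g))))"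
      by (intro Bochner_Integration.integral_sum Bochner_Integration.integrable_sum integrable_mult_right integrable_coord_f)
    also have "\<dots> = (\<Sum>u\<in>N. \<Sum>e\<in>J. (LINT g|P. c' \<theta> u e * (g e * f \<theta> u g)))"
      by (intro sum.cong refl Bochner_Integration.integral_sum integrable_mult_right integrable_coord_f)
    finally show ?thesis unfolding G_expand by simp
  qed
  also have "\<dots> = q * \<tau> * (\<Sum>u\<in>N. \<Sum>e\<in>J. c' \<theta> u e * (LINT g|P. Df \<theta> u e g))"
    by (simp add: coord_ibp)
  also have "\<dots> = q * \<tau> * (LINT g|P. (\<Sum>u\<in>N. \<Sum>e\<in>J. c' \<theta> u e * Df \<theta> u e g))"
  proof -
    have "(LINT g|P. (\<Sum>u\<in>N. \<Sum>e\<in>J. c' \<theta> u e * Df \<theta> u e g)) = (\<Sum>u\<in>N. (LINT g|P. (\<Sum>e\<in>J. c' \<theta> u e * Df \<theta> u e g)))"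
      by (intro Bochner_Integration.integral_sum Bochner_Integration.integrable_sum integrable_mult_right integrable_Df)
    also have "\<dots> = (\<Sum>u\<in>N. \<Sum>e\<in>J. (LINT g|P. c' \<theta> u e * Df \<theta> u e g))"
      by (intro sum.cong refl Bochner_Integration.integral_sum integrable_mult_right integrable_Df)
    finally show ?thesis by simp
  qed
  also have "\<dots> \<ge> 0"
  proof (intro mult_nonneg_nonneg Bochner_Integration.integral_nonneg)
    fix g
    let ?t = "\<lambda>u v. ex \<theta> g u * ex \<theta> g v * (Cov u u - (1 - q) * Cov u v)"
    have sw: "(\<Sum>u\<in>N. \<Sum>v\<in>N. ?t u v) = (\<Sum>u\<in>N. \<Sum>v\<in>N. ?t v u)" by (rule sum.swap)
    have "0 \<le> (\<Sum>u\<in>N. \<Sum>v\<in>N. ?t u v + ?t v u)"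
    proof (intro sum_nonneg)
      fix u v assume uv: "u \<in> N" "v \<in> N"
      have Cs: "Cov v u = Cov u v" by (simp add: Cov_def mult.commute)
      have "?t u v + ?t v u = ex \<theta> g u * ex \<theta> g v *
          ((1 - q) * (Cov u u + Cov v v - 2 * Cov u v) + q * (Cov u u + Cov v v))"
        unfolding Cs by (simp add: algebra_simps)
      also have "\<dots> \<ge> 0"
        using q diag uv incr[OF uv] ex_pos by (intro mult_nonneg_nonneg add_nonneg_nonneg) (auto simp: less_imp_le)
      finally show "0 \<le> ?t u v + ?t v u" .
    qed
    then have "0 \<le> (\<Sum>u\<in>N. \<Sum>v\<in>N. ?t u v)" using sw by (simp add: sum.distrib)
    moreover have "sin \<theta> * cos \<theta> \<ge> 0"
      using \<theta> by (intro mult_nonneg_nonneg sin_ge_zero cos_ge_zero) auto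
    ultimately show "0 \<le> (\<Sum>u\<in>N. \<Sum>e\<in>J. c' \<theta> u e * Df \<theta> u e g)"
      unfolding Df_sum
      by (intro mult_nonneg_nonneg[OF mult_nonneg_nonneg[OF mult_nonneg_nonneg]]) (use \<tau> in auto)
  qed (use q \<tau> in auto)
  finally show ?thesis .
qed

lemma Z_powr_deriv: "((\<lambda>\<theta>. Z \<theta> g powr q) has_real_derivative G \<theta> g) (at \<theta>)"
proof -
  have U: "((\<lambda>\<theta>. U \<theta> g u) has_real_derivative W \<theta> g u) (at \<theta>)" for u
    unfolding U_def W_def c_def c'_def by (auto intro!: derivative_eq_intros sum.cong)
  have "((\<lambda>\<theta>. Z \<theta> g) has_real_derivative (\<Sum>u\<in>N. \<tau> * W \<theta> g u * ex \<theta> g u)) (at \<theta>)"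
    unfolding Z_def ex_def by (intro DERIV_sum) (auto intro!: derivative_eq_intros U)
  from DERIV_fun_powr[OF this Z_pos, where r = q]
  have "((\<lambda>\<theta>. Z \<theta> g powr q) has_real_derivative q * Z \<theta> g powr (q - 1) * (\<Sum>u\<in>N. \<tau> * W \<theta> g u * ex \<theta> g u)) (at \<theta>)"
    by simp
  moreover have "q * Z \<theta> g powr (q - 1) * (\<Sum>u\<in>N. \<tau> * W \<theta> g u * ex \<theta> g u) = G \<theta> g"
    unfolding G_def f_def sum_distrib_left by (intro sum.cong refl) (simp add: mult_ac)
  ultimately show ?thesis by simp
qed

lemma integrable_Z_powr: "integrable P (\<lambda>g. Z \<theta> g powr q)"
proof (rule integrable_gauss_space_bound[OF J])
  note measurable_Z [measurable]
  show "(\<lambda>g. Z \<theta> g powr q) \<in> borel_measurable P" by measurable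
  fix g :: "'i \<Rightarrow> real"
  have c1: "real (card N) \<ge> 1" using N by (simp add: Suc_le_eq card_gt_0_iff)
  have "Z \<theta> g \<le> card N * exp (\<tau> * A * s g)"
  proof -
    have "Z \<theta> g \<le> (\<Sum>u\<in>N. exp (\<tau> * A * s g))" unfolding Z_def by (intro sum_mono ex_le)
    then show ?thesis by simp
  qed
  then have "Z \<theta> g powr q \<le> (card N * exp (\<tau> * A * s g)) powr q"
    using Z_pos[of \<theta> g] q by (intro powr_mono2) auto
  also have "\<dots> \<le> (card N * exp (\<tau> * A * s g)) powr 1"
  proof (rule powr_mono)
    have "1 * 1 \<le> card N * exp (\<tau> * A * s g)"
      using c1 \<tau> A_nonneg s_nonneg[of g] by (intro mult_mono) auto
    then show "1 \<le> card N * exp (\<tau> * A * s g)" by simp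
  qed (use q in simp)
  finally show "norm (Z \<theta> g powr q) \<le> card N * exp (\<tau> * A * (\<Sum>e\<in>J. \<bar>g e\<bar>))"
    by (simp add: s_def)
qed

lemma isCont_G: "isCont (\<lambda>\<theta>. G \<theta> g) \<theta>"
proof -
  have Z: "continuous_on UNIV (\<lambda>\<theta>. Z \<theta> g)"
    unfolding Z_def ex_def U_def c_def by (intro continuous_intros)
  have "continuous_on UNIV (\<lambda>\<theta>. G \<theta> g)"
    unfolding G_def f_def W_def c'_def ex_def U_def c_def
    by (intro continuous_intros Z ballI less_imp_neq[OF Z_pos, symmetric])
  then show ?thesis by (simp add: continuous_on_eq_continuous_at)
qed

lemma measurable_pair_G: "(\<lambda>p. G (fst p) (snd p)) \<in> borel_measurable (lborel \<Otimes>\<^sub>M P)"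
proof -
  have co: "(\<lambda>p. snd p e) \<in> borel_measurable (lborel \<Otimes>\<^sub>M P)" if "e \<in> J" for e
    using measurable_compose[OF measurable_snd measurable_coord[OF that]] .
  have fs [measurable]: "(\<lambda>p. fst p) \<in> borel_measurable (lborel \<Otimes>\<^sub>M P)"
    using measurable_fst[of lborel P] by simp
  have "(cos :: real \<Rightarrow> real) \<in> borel_measurable borel" "(sin :: real \<Rightarrow> real) \<in> borel_measurable borel"
    by (auto intro!: borel_measurable_continuous_onI continuous_intros)
  note tr = this[THEN measurable_compose[OF fs]]
  have U [measurable]: "(\<lambda>p. U (fst p) (snd p) u) \<in> borel_measurable (lborel \<Otimes>\<^sub>M P)" for u
    unfolding U_def c_def
    by (intro borel_measurable_sum borel_measurable_times borel_measurable_add borel_measurable_const tr co)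
  have W [measurable]: "(\<lambda>p. W (fst p) (snd p) u) \<in> borel_measurable (lborel \<Otimes>\<^sub>M P)" for u
    unfolding W_def c'_def
    by (intro borel_measurable_sum borel_measurable_times borel_measurable_add borel_measurable_uminus borel_measurable_const tr co)
  show ?thesis unfolding G_def f_def Z_def ex_def by measurable
qed

lemma G_le: "\<bar>G \<theta> g\<bar> \<le> q * \<tau> * (card N * A) * exp ((1 + 2 * \<tau> * A) * (\<Sum>e\<in>J. \<bar>g e\<bar>))"
proof -
  have "\<bar>\<Sum>u\<in>N. W \<theta> g u * f \<theta> u g\<bar> \<le> (\<Sum>u\<in>N. A * exp (s g) * exp (2 * \<tau> * A * s g))"
  proof (rule order_trans[OF sum_abs], rule sum_mono)
    fix u assume u: "u \<in> N"
    have "s g \<le> exp (s g)" using exp_ge_add_one_self[of "s g"] by linarith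
    then have "A * s g \<le> A * exp (s g)" using A_nonneg by (rule mult_left_mono)
    then have "\<bar>W \<theta> g u\<bar> \<le> A * exp (s g)" using W_le[OF u, of \<theta> g] by linarith
    then show "\<bar>W \<theta> g u * f \<theta> u g\<bar> \<le> A * exp (s g) * exp (2 * \<tau> * A * s g)"
      unfolding abs_mult using f_le[OF u, of \<theta> g] f_pos[of \<theta> u g] by (intro mult_mono) auto
  qed
  also have "\<dots> = card N * A * exp ((1 + 2 * \<tau> * A) * s g)"
    by (simp add: distrib_right exp_add)
  finally have "q * \<tau> * \<bar>\<Sum>u\<in>N. W \<theta> g u * f \<theta> u g\<bar> \<le> q * \<tau> * (card N * A * exp ((1 + 2 * \<tau> * A) * s g))"
    using q \<tau> by (intro mult_left_mono) auto
  then show ?thesis unfolding G_def s_def abs_mult using q \<tau> by (simp add: mult.assoc)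
qed

text \<open>Integrate \<open>G\<close> over the rotation and exchange the integrals by Fubini;
  \<open>G_le\<close> supplies a dominating function that does not depend on
  \<open>\<theta>\<close>.\<close>

theorem Z_powr_mono:
  assumes diag: "\<And>u. u \<in> N \<Longrightarrow> Cov u u \<ge> 0"
    and incr: "\<And>u v. u \<in> N \<Longrightarrow> v \<in> N \<Longrightarrow> Cov u u + Cov v v - 2 * Cov u v \<ge> 0"
  shows "(LINT g|P. Z 0 g powr q) \<le> (LINT g|P. Z (pi / 2) g powr q)"
proof -
  interpret P: prob_space P by (rule prob_space_gauss_space)
  interpret pair_sigma_finite lborel P ..
  define h where "h \<theta> g = G \<theta> g * indicator {0..pi / 2} \<theta>" for \<theta> g
  define K where "K = (LINT g|P. q * \<tau> * (card N * A) * exp ((1 + 2 * \<tau> * A) * (\<Sum>e\<in>J. \<bar>g e\<bar>)))"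
  have mh: "(\<lambda>p. h (fst p) (snd p)) \<in> borel_measurable (lborel \<Otimes>\<^sub>M P)"
  proof -
    note measurable_pair_G [measurable]
    show ?thesis unfolding h_def by measurable
  qed
  then have mh': "case_prod h \<in> borel_measurable (lborel \<Otimes>\<^sub>M P)" by (simp add: case_prod_beta')
  have ih: "integrable P (h \<theta>)" for \<theta>
    unfolding h_def by (intro integrable_mult_left integrable_G)
  have "integrable (lborel \<Otimes>\<^sub>M P) (case_prod h)"
  proof (rule Fubini_integrable[OF mh'])
    have m: "(\<lambda>\<theta>. LINT g|P. norm (h \<theta> g)) \<in> borel_measurable lborel"
    proof -
      note mh' [measurable]
      show ?thesis by measurable
    qed
    show "integrable lborel (\<lambda>\<theta>. LINT g|P. norm (case_prod h (\<theta>, g)))"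
      unfolding prod.case
    proof (rule Bochner_Integration.integrable_bound[OF _ m])
      show "integrable lborel (\<lambda>\<theta>. K * indicator {0..pi / 2} \<theta>)" by simp
      show "AE \<theta> in lborel. norm (LINT g|P. norm (h \<theta> g)) \<le> norm (K * indicator {0..pi / 2} \<theta>)"
      proof (rule AE_I2)
        fix \<theta>
        have K0: "K \<ge> 0" unfolding K_def using q \<tau> A_nonneg by (intro Bochner_Integration.integral_nonneg) auto
        have "(LINT g|P. norm (h \<theta> g)) \<le> (LINT g|P. q * \<tau> * (card N * A) * exp ((1 + 2 * \<tau> * A) * (\<Sum>e\<in>J. \<bar>g e\<bar>)) * indicator {0..pi / 2} \<theta>)"
        proof (rule integral_mono)
          show "integrable P (\<lambda>g. q * \<tau> * (card N * A) * exp ((1 + 2 * \<tau> * A) * (\<Sum>e\<in>J. \<bar>g e\<bar>)) * indicator {0..pi / 2} \<theta>)"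
            by (intro integrable_mult_left integrable_gauss_space_exp J)
          show "norm (h \<theta> g) \<le> q * \<tau> * (card N * A) * exp ((1 + 2 * \<tau> * A) * (\<Sum>e\<in>J. \<bar>g e\<bar>)) * indicator {0..pi / 2} \<theta>" for g
            unfolding h_def using G_le[of \<theta> g] by (simp add: indicator_def)
        qed (use ih in auto)
        also have "\<dots> = K * indicator {0..pi / 2} \<theta>" unfolding K_def by simp
        finally show "norm (LINT g|P. norm (h \<theta> g)) \<le> norm (K * indicator {0..pi / 2} \<theta>)"
          using K0 by (simp add: abs_of_nonneg)
      qed
    qed
    show "AE \<theta> in lborel. integrable P (\<lambda>g. case_prod h (\<theta>, g))" using ih by simp
  qed
  from Fubini_integral[OF this]
  have fub: "(LINT g|P. (LINT \<theta>|lborel. h \<theta> g)) = (LINT \<theta>|lborel. (LINT g|P. h \<theta> g))" .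
  have "(LINT \<theta>|lborel. h \<theta> g) = Z (pi / 2) g powr q - Z 0 g powr q" for g
    unfolding h_def by (rule integral_FTC_Icc_real) (auto intro: Z_powr_deriv isCont_G)
  then have "(LINT g|P. Z (pi / 2) g powr q) - (LINT g|P. Z 0 g powr q) = (LINT \<theta>|lborel. (LINT g|P. h \<theta> g))"
    unfolding fub[symmetric] using integrable_Z_powr by simp
  also have "\<dots> \<ge> 0"
  proof (rule Bochner_Integration.integral_nonneg)
    fix \<theta>
    show "0 \<le> (LINT g|P. h \<theta> g)"
      unfolding h_def using integral_G_nonneg[OF diag incr, of \<theta>] by (cases "\<theta> \<in> {0..pi / 2}") auto
  qed
  finally show ?thesis by simp
qed

end

section \<open>Sums over pairs and exponential moments of squared Gaussians\<close>

lemma pairs_Suc: "pairs (Suc n) = pairs n \<union> (\<lambda>i. (i, Suc n)) ` {1..n}"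
  by (auto simp: pairs_def)

lemma pairs_double_sum:
  fixes f :: "nat \<Rightarrow> nat \<Rightarrow> real"
  assumes "\<And>i j. f i j = f j i"
  shows "(\<Sum>i=1..n. \<Sum>j=1..n. f i j) = 2 * (\<Sum>p\<in>pairs n. f (fst p) (snd p)) + (\<Sum>i=1..n. f i i)"
proof (induction n)
  case 0
  have "pairs 0 = {}" by (auto simp: pairs_def)
  then show ?case by simp
next
  case (Suc n)
  have d: "pairs n \<inter> (\<lambda>i. (i, Suc n)) ` {1..n} = {}" by (auto simp: pairs_def)
  have p: "(\<Sum>p\<in>pairs (Suc n). f (fst p) (snd p)) = (\<Sum>p\<in>pairs n. f (fst p) (snd p)) + (\<Sum>i=1..n. f i (Suc n))"
    unfolding pairs_Suc by (subst sum.union_disjoint[OF finite_pairs _ d]) (auto simp: sum.reindex inj_on_def)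
  have "(\<Sum>i=1..Suc n. \<Sum>j=1..Suc n. f i j)
      = (\<Sum>i=1..n. \<Sum>j=1..n. f i j) + (\<Sum>i=1..n. f i (Suc n)) + (\<Sum>j=1..n. f (Suc n) j) + f (Suc n) (Suc n)"
    by (simp add: sum.distrib)
  also have "(\<Sum>j=1..n. f (Suc n) j) = (\<Sum>i=1..n. f i (Suc n))"
    by (intro sum.cong refl assms)
  finally show ?case unfolding p Suc.IH by simp
qed

text \<open>Up to the factor \<open>\<sigma>\<close>, the tilted density is the normal density of
  variance \<open>1 / (1 - 2 * \<kappa>)\<close>.\<close>

lemma integral_std_gauss_exp_square:
  assumes "\<kappa> < 1 / 2"
  shows "integrable std_gauss (\<lambda>x. exp (\<kappa> * x\<^sup>2))"
    and "(LINT x|std_gauss. exp (\<kappa> * x\<^sup>2)) = 1 / sqrt (1 - 2 * \<kappa>)"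
proof -
  define \<sigma> where "\<sigma> = 1 / sqrt (1 - 2 * \<kappa>)"
  have k: "1 - 2 * \<kappa> > 0" using assms by simp
  have \<sigma>: "\<sigma> > 0" "\<sigma>\<^sup>2 = 1 / (1 - 2 * \<kappa>)" using k by (simp_all add: \<sigma>_def power_divide)
  have e: "std_normal_density x * exp (\<kappa> * x\<^sup>2) = \<sigma> * normal_density 0 \<sigma> x" for x
  proof -
    have "std_normal_density x * exp (\<kappa> * x\<^sup>2) = 1 / sqrt (2 * pi) * exp (- x\<^sup>2 / 2 + \<kappa> * x\<^sup>2)"
      unfolding exp_add by (simp add: std_normal_density_def)
    also have "- x\<^sup>2 / 2 + \<kappa> * x\<^sup>2 = - (x - 0)\<^sup>2 / (2 * \<sigma>\<^sup>2)" using k by (simp add: \<sigma>(2) field_simps)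
    also have "1 / sqrt (2 * pi) = \<sigma> * (1 / sqrt (2 * pi * \<sigma>\<^sup>2))" using \<sigma>(1) by (simp add: real_sqrt_mult)
    finally show ?thesis by (simp add: normal_density_def mult.assoc)
  qed
  have i: "integrable lborel (\<lambda>x. \<sigma> * normal_density 0 \<sigma> x)"
    using integrable_normal_density[OF \<sigma>(1)] by simp
  show "integrable std_gauss (\<lambda>x. exp (\<kappa> * x\<^sup>2))"
    by (subst integrable_density) (use i e in auto)
  have "(LINT x|std_gauss. exp (\<kappa> * x\<^sup>2)) = (LINT x|lborel. std_normal_density x * exp (\<kappa> * x\<^sup>2))"
    by (subst integral_density) auto
  then show "(LINT x|std_gauss. exp (\<kappa> * x\<^sup>2)) = 1 / sqrt (1 - 2 * \<kappa>)"
    unfolding e using integral_normal_density[OF \<sigma>(1)] by (simp add: \<sigma>_def)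
qed

lemma exp_square_const_le:
  assumes "0 \<le> \<kappa>" "\<kappa> \<le> 1 / 4"
  shows "1 / sqrt (1 - 2 * \<kappa>) \<le> exp (\<kappa> + 4 * \<kappa>\<^sup>2)"
proof -
  have k: "1 - 2 * \<kappa> > 0" using assms by simp
  have "- (2 * \<kappa>) - 2 * (2 * \<kappa>)\<^sup>2 \<le> ln (1 - 2 * \<kappa>)"
    by (rule ln_one_minus_pos_lower_bound) (use assms in auto)
  then have "- ln (1 - 2 * \<kappa>) / 2 \<le> \<kappa> + 4 * \<kappa>\<^sup>2" by (simp add: power_mult_distrib)
  then have "exp (- (ln (1 - 2 * \<kappa>) / 2)) \<le> exp (\<kappa> + 4 * \<kappa>\<^sup>2)" by simp
  moreover have "exp (ln (1 - 2 * \<kappa>) / 2) = sqrt (1 - 2 * \<kappa>)"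
    using k by (simp add: ln_sqrt[symmetric])
  ultimately show ?thesis by (simp add: exp_minus inverse_eq_divide)
qed

subsection \<open>Largest eigenvalue of the couplings and low temperature\<close>

definition quad where "quad n g x = (\<Sum>i=1..n. \<Sum>j=1..n. coupling n g i j * x i * x j)"

lemma quad_eq_pairs:
  "quad n g x = (\<Sum>p\<in>pairs n. 2 / sqrt (real n) * (x (fst p) * x (snd p)) * g p)"
proof -
  have "quad n g x = 2 * (\<Sum>p\<in>pairs n. coupling n g (fst p) (snd p) * x (fst p) * x (snd p))
      + (\<Sum>i=1..n. coupling n g i i * x i * x i)"
    unfolding quad_def by (rule pairs_double_sum) (simp add: coupling_sym[of n g] mult_ac)
  also have "(\<Sum>i=1..n. coupling n g i i * x i * x i) = 0" by (simp add: coupling_def)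
  also have "2 * (\<Sum>p\<in>pairs n. coupling n g (fst p) (snd p) * x (fst p) * x (snd p)) + 0
      = (\<Sum>p\<in>pairs n. 2 / sqrt (real n) * (x (fst p) * x (snd p)) * g p)"
    unfolding add_0_right sum_distrib_left
    by (intro sum.cong refl) (auto simp: pairs_def coupling_def min_def max_def)
  finally show ?thesis .
qed

lemma measurable_quad: "(\<lambda>g. quad n g x) \<in> borel_measurable (disorder n)"
  unfolding quad_eq_pairs
  by (intro borel_measurable_sum borel_measurable_times borel_measurable_const measurable_disorder_component)

lemma quad_scale: "quad n g (\<lambda>i. c * x i) = c\<^sup>2 * quad n g x"
  unfolding quad_def sum_distrib_left by (intro sum.cong refl) (simp add: power2_eq_square mult_ac)

text \<open>Exponential Markov inequality for \<open>Z 0 g powr q\<close>, transferred by comparison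
  to the linear process, where the supremum is explicit. The product \<open>\<tau> * q = l\<close>
  is kept fixed, so \<open>q\<close> affects the bound only through the power of
  \<open>card N\<close>.\<close>

lemma prob_quad_gt_powr:
  assumes n: "n \<ge> 1" and \<delta>: "0 < \<delta>" "\<delta> \<le> 1"
    and N: "finite N" "N \<noteq> {}" and unit: "\<And>u. u \<in> N \<Longrightarrow> (\<Sum>i=1..n. (u i)\<^sup>2) = 1"
    and q: "0 < q" "q < 1"
  shows "measure (disorder n) {g \<in> space (disorder n). \<exists>u\<in>N. quad n g u > 2 + \<delta>}
    \<le> real (card N) powr q * exp (- (n * \<delta>\<^sup>2 / 16))"
proof -
  \<comment> \<open>The final exponent is
    \<open>n * (4 * \<kappa>\<^sup>2 - \<delta> * \<kappa>)\<close>, minimal at this value and then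
    equal to \<open>- (n * \<delta>\<^sup>2 / 16)\<close>.\<close>
  define \<kappa> where "\<kappa> = \<delta> / 8"
  define l where "l = \<kappa> * n"
  define \<tau> where "\<tau> = l / q"
  \<comment> \<open>Labels for \<open>n\<close> fresh Gaussians; the first component 0 keeps them
    apart from the pairs, whose components start at 1.\<close>
  define H where "H = {0::nat} \<times> {1..n}"
  define J where "J = pairs n \<union> H"
  define r where "r = 2 / sqrt (real n)"
  define a where "a u e = (if e \<in> pairs n then r * (u (fst e) * u (snd e)) else 0)" for u :: "nat \<Rightarrow> real" and e :: "nat \<times> nat"
  define b where "b u e = (if e \<in> pairs n then 0 else r * u (snd e))" for u :: "nat \<Rightarrow> real" and e :: "nat \<times> nat"
  have n0: "real n > 0" using n by simp
  have r2: "r * r = 4 / n" using n0 by (simp add: r_def)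
  have \<kappa>: "0 < \<kappa>" "\<kappa> \<le> 1 / 4" using \<delta> by (simp_all add: \<kappa>_def)
  have l: "l > 0" using \<kappa> n0 by (simp add: l_def)
  have disj: "pairs n \<inter> H = {}" by (auto simp: pairs_def H_def)
  have fin: "finite H" "finite J" using finite_pairs by (auto simp: H_def J_def)
  have split: "(\<Sum>e\<in>J. F e) = (\<Sum>e\<in>pairs n. F e) + (\<Sum>e\<in>H. F e)" for F :: "nat \<times> nat \<Rightarrow> real"
    unfolding J_def by (rule sum.union_disjoint[OF finite_pairs fin(1) disj])
  have Hsum: "(\<Sum>e\<in>H. F e) = (\<Sum>i=1..n. F (0, i))" for F :: "nat \<times> nat \<Rightarrow> real"
    unfolding H_def by (rule sum.reindex_bij_witness[of _ "\<lambda>i. (0, i)" snd]) auto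
  have notH: "(0, i) \<notin> pairs n" for i by (simp add: pairs_def)
  interpret gauss_comparison J N a b q \<tau>
  proof
    show "\<tau> > 0" using l q by (simp add: \<tau>_def)
    show "(\<Sum>e\<in>J. a u e * b v e) = 0" for u v by (intro sum.neutral) (simp add: a_def b_def)
  qed (use fin N q in auto)
  \<comment> \<open>The last sum corrects for the vanishing diagonal of the coupling matrix.\<close>
  have Cov: "Cov u v = 2 / n * (2 * (\<Sum>i=1..n. u i * v i) - (\<Sum>i=1..n. u i * v i)\<^sup>2 + (\<Sum>i=1..n. (u i * v i)\<^sup>2))" for u v
  proof -
    let ?t = "\<lambda>i. u i * v i"
    have "(\<Sum>e\<in>J. b u e * b v e) = (\<Sum>i=1..n. (r * r) * ?t i)"
      unfolding split Hsum by (simp add: b_def notH mult_ac)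
    also have "\<dots> = 4 / n * (\<Sum>i=1..n. ?t i)" unfolding r2 by (simp only: sum_distrib_left)
    finally have B: "(\<Sum>e\<in>J. b u e * b v e) = 4 / n * (\<Sum>i=1..n. ?t i)" .
    have "(\<Sum>e\<in>J. a u e * a v e) = (\<Sum>e\<in>pairs n. (r * r) * (?t (fst e) * ?t (snd e)))"
      unfolding split Hsum by (simp add: a_def notH mult_ac)
    also have "\<dots> = 4 / n * (\<Sum>e\<in>pairs n. ?t (fst e) * ?t (snd e))" unfolding r2 by (simp only: sum_distrib_left)
    also have "\<dots> = 2 / n * (2 * (\<Sum>e\<in>pairs n. ?t (fst e) * ?t (snd e)))" by simp
    also have "2 * (\<Sum>e\<in>pairs n. ?t (fst e) * ?t (snd e)) = (\<Sum>i=1..n. \<Sum>j=1..n. ?t i * ?t j) - (\<Sum>i=1..n. ?t i * ?t i)"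
      using pairs_double_sum[of "\<lambda>i j. ?t i * ?t j" n] by (simp add: mult.commute)
    also have "(\<Sum>i=1..n. \<Sum>j=1..n. ?t i * ?t j) = (\<Sum>i=1..n. ?t i)\<^sup>2"
      by (simp add: power2_eq_square sum_product)
    finally have A: "(\<Sum>e\<in>J. a u e * a v e) = 2 / n * ((\<Sum>i=1..n. ?t i)\<^sup>2 - (\<Sum>i=1..n. (?t i)\<^sup>2))"
      by (simp only: power2_eq_square)
    show ?thesis unfolding Cov_def A B by (simp add: algebra_simps)
  qed
  have uu: "(\<Sum>i=1..n. u i * u i) = 1" if "u \<in> N" for u
    using unit[OF that] by (simp add: power2_eq_square)
  have mono: "(LINT g|P. Z 0 g powr q) \<le> (LINT g|P. Z (pi / 2) g powr q)"
  proof (rule Z_powr_mono)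
    fix u assume u: "u \<in> N"
    show "Cov u u \<ge> 0"
      unfolding Cov uu[OF u] by (intro mult_nonneg_nonneg add_nonneg_nonneg sum_nonneg) auto
    fix v assume v: "v \<in> N"
    define \<rho> where "\<rho> = (\<Sum>i=1..n. u i * v i)"
    have sq: "(\<Sum>i=1..n. ((u i)\<^sup>2 - (v i)\<^sup>2)\<^sup>2)
        = (\<Sum>i=1..n. (u i * u i)\<^sup>2) + (\<Sum>i=1..n. (v i * v i)\<^sup>2) - 2 * (\<Sum>i=1..n. (u i * v i)\<^sup>2)"
      unfolding sum_distrib_left sum.distrib[symmetric] sum_subtractf[symmetric]
      by (intro sum.cong refl) (simp add: power2_eq_square algebra_simps)
    \<comment> \<open>On unit vectors the difference of the increment variances is a sum of squares;
      the second square comes from the diagonal correction.\<close>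
    have "Cov u u + Cov v v - 2 * Cov u v
        = 2 / n * (2 * (1 - \<rho>)\<^sup>2 + (\<Sum>i=1..n. ((u i)\<^sup>2 - (v i)\<^sup>2)\<^sup>2))"
      unfolding Cov uu[OF u] uu[OF v] sq \<rho>_def[symmetric] by (simp add: power2_eq_square algebra_simps)
    also have "\<dots> \<ge> 0" by (intro mult_nonneg_nonneg add_nonneg_nonneg sum_nonneg) auto
    finally show "Cov u u + Cov v v - 2 * Cov u v \<ge> 0" .
  qed
  have U0: "U 0 g u = quad n g u" for g u
    unfolding U_def c_def split Hsum quad_eq_pairs by (simp add: a_def notH r_def)
  \<comment> \<open>By AM-GM with \<open>|u| = 1\<close>, the supremum over directions is replaced
    by \<open>1 + |h|\<^sup>2 / n\<close>, a sum of independent terms whose exponential moment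
    factorises. Its mean 2 is the spectral edge.\<close>
  have U1: "U (pi / 2) g u \<le> 1 + (\<Sum>e\<in>H. (g e)\<^sup>2) / n" if u: "u \<in> N" for g u
  proof -
    have "U (pi / 2) g u = (\<Sum>i=1..n. r * u i * g (0, i))"
      unfolding U_def c_def split Hsum by (simp add: b_def notH)
    also have "\<dots> \<le> (\<Sum>i=1..n. (u i)\<^sup>2 + (g (0, i))\<^sup>2 / n)"
    proof (rule sum_mono)
      fix i
      have "0 \<le> (u i - g (0, i) / sqrt n)\<^sup>2" by simp
      also have "\<dots> = (u i)\<^sup>2 + (g (0, i))\<^sup>2 / n - r * u i * g (0, i)"
        using n0 by (simp add: power2_diff power_divide r_def)
      finally show "r * u i * g (0, i) \<le> (u i)\<^sup>2 + (g (0, i))\<^sup>2 / n" by simp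
    qed
    also have "\<dots> = 1 + (\<Sum>e\<in>H. (g e)\<^sup>2) / n"
      unfolding sum.distrib unit[OF u] Hsum by (simp add: sum_divide_distrib)
    finally show ?thesis .
  qed
  have tq: "\<tau> * q = l" using q by (simp add: \<tau>_def)
  have c1: "real (card N) > 0" using N by (simp add: card_gt_0_iff)
  let ?h = "\<lambda>e x. if e \<in> pairs n then 1 else exp (\<kappa> * x\<^sup>2)"
  interpret P: prob_space P by (rule prob_space_gauss_space)
  interpret ps: product_sigma_finite "\<lambda>_. std_gauss" by (rule product_sigma_finite_std_gauss)
  have \<kappa>2: "\<kappa> < 1 / 2" using \<kappa> by simp
  have ih: "integrable std_gauss (?h e)" for e
    using integral_std_gauss_exp_square(1)[OF \<kappa>2]
      finite_measure.integrable_const[OF prob_space.finite_measure[OF prob_space_std_gauss], of "1::real"]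
    by (cases "e \<in> pairs n") auto
  have Zle: "Z (pi / 2) g powr q \<le> real (card N) powr q * exp l * (\<Prod>e\<in>J. ?h e (g e))" for g
  proof -
    let ?m = "exp (\<tau> * (1 + (\<Sum>e\<in>H. (g e)\<^sup>2) / n))"
    have "Z (pi / 2) g \<le> (\<Sum>u\<in>N. ?m)"
      unfolding Z_def ex_def using \<tau> by (intro sum_mono) (simp add: U1)
    then have "Z (pi / 2) g powr q \<le> (card N * ?m) powr q"
      using Z_pos[of "pi / 2" g] q by (intro powr_mono2) auto
    also have "\<dots> = real (card N) powr q * ?m powr q" by (simp add: powr_mult)
    also have "?m powr q = exp (l * (1 + (\<Sum>e\<in>H. (g e)\<^sup>2) / n))"
      by (simp add: powr_def tq[symmetric] mult_ac)
    also have "l * (1 + (\<Sum>e\<in>H. (g e)\<^sup>2) / n) = l + (\<Sum>e\<in>H. \<kappa> * (g e)\<^sup>2)"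
      using n0 by (simp add: l_def distrib_left sum_distrib_left[symmetric])
    also have "exp (l + (\<Sum>e\<in>H. \<kappa> * (g e)\<^sup>2)) = exp l * (\<Prod>e\<in>H. exp (\<kappa> * (g e)\<^sup>2))"
      by (simp add: exp_add exp_sum fin)
    also have "(\<Prod>e\<in>H. exp (\<kappa> * (g e)\<^sup>2)) = (\<Prod>e\<in>J. ?h e (g e))"
    proof -
      have "(\<Prod>e\<in>J. ?h e (g e)) = (\<Prod>e\<in>pairs n. ?h e (g e)) * (\<Prod>e\<in>H. ?h e (g e))"
        unfolding J_def by (rule prod.union_disjoint[OF finite_pairs fin(1) disj])
      moreover have "(\<Prod>e\<in>H. ?h e (g e)) = (\<Prod>e\<in>H. exp (\<kappa> * (g e)\<^sup>2))"
        by (intro prod.cong refl) (use disj in auto)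
      ultimately show ?thesis by simp
    qed
    finally show ?thesis by (simp add: mult.assoc)
  qed
  have prodI: "(LINT g|P. (\<Prod>e\<in>J. ?h e (g e))) \<le> exp (n * (\<kappa> + 4 * \<kappa>\<^sup>2))"
  proof -
    have "(LINT g|P. (\<Prod>e\<in>J. ?h e (g e))) = (\<Prod>e\<in>J. (LINT x|std_gauss. ?h e x))"
      by (rule ps.product_integral_prod[OF fin(2) ih])
    also have "\<dots> = (\<Prod>e\<in>pairs n. (LINT x|std_gauss. ?h e x)) * (\<Prod>e\<in>H. (LINT x|std_gauss. ?h e x))"
      unfolding J_def by (rule prod.union_disjoint[OF finite_pairs fin(1) disj])
    also have "(\<Prod>e\<in>pairs n. (LINT x|std_gauss. ?h e x)) = 1"
    proof -
      have "measure std_gauss UNIV = 1" using prob_space.prob_space[OF prob_space_std_gauss] by simp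
      then show ?thesis by (intro prod.neutral ballI) simp
    qed
    also have "(\<Prod>e\<in>H. (LINT x|std_gauss. ?h e x)) = (\<Prod>e\<in>H. 1 / sqrt (1 - 2 * \<kappa>))"
    proof (intro prod.cong refl)
      fix e assume "e \<in> H"
      then have "e \<notin> pairs n" using disj by blast
      then show "(LINT x|std_gauss. ?h e x) = 1 / sqrt (1 - 2 * \<kappa>)"
        using integral_std_gauss_exp_square(2)[OF \<kappa>2] by simp
    qed
    also have "\<dots> = (1 / sqrt (1 - 2 * \<kappa>)) ^ n" by (simp add: H_def)
    also have "\<dots> \<le> exp (\<kappa> + 4 * \<kappa>\<^sup>2) ^ n"
      using exp_square_const_le[of \<kappa>] \<kappa> by (intro power_mono) auto
    also have "\<dots> = exp (n * (\<kappa> + 4 * \<kappa>\<^sup>2))" by (simp add: exp_of_nat_mult)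
    finally show ?thesis by simp
  qed
  have iprod: "integrable P (\<lambda>g. \<Prod>e\<in>J. ?h e (g e))"
    by (rule ps.product_integrable_prod[OF fin(2) ih])
  have EZ: "(LINT g|P. Z (pi / 2) g powr q) \<le> real (card N) powr q * exp l * exp (n * (\<kappa> + 4 * \<kappa>\<^sup>2))"
  proof -
    have "(LINT g|P. Z (pi / 2) g powr q) \<le> (LINT g|P. real (card N) powr q * exp l * (\<Prod>e\<in>J. ?h e (g e)))"
      by (rule integral_mono[OF integrable_Z_powr integrable_mult_right[OF iprod] Zle])
    also have "\<dots> = real (card N) powr q * exp l * (LINT g|P. (\<Prod>e\<in>J. ?h e (g e)))" by simp
    also have "\<dots> \<le> real (card N) powr q * exp l * exp (n * (\<kappa> + 4 * \<kappa>\<^sup>2))"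
      by (intro mult_left_mono prodI) auto
    finally show ?thesis .
  qed
  let ?Ev = "{g \<in> space (disorder n). \<exists>u\<in>N. quad n g u > 2 + \<delta>}"
  let ?Ev' = "{g \<in> space P. \<exists>u\<in>N. quad n g u > 2 + \<delta>}"
  have Ev: "?Ev \<in> sets (disorder n)"
  proof -
    note measurable_quad [measurable]
    have "?Ev = (\<Union>u\<in>N. {g \<in> space (disorder n). quad n g u > 2 + \<delta>})" by auto
    also have "\<dots> \<in> sets (disorder n)" by (intro sets.finite_UN N(1)) measurable
    finally show ?thesis .
  qed
  have Ev': "?Ev' \<in> sets P"
  proof -
    have [measurable]: "(\<lambda>g. quad n g u) \<in> borel_measurable P" for u
      unfolding U0[symmetric] by (rule measurable_U)
    have "?Ev' = (\<Union>u\<in>N. {g \<in> space P. quad n g u > 2 + \<delta>})" by auto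
    also have "\<dots> \<in> sets P" by (intro sets.finite_UN N(1)) measurable
    finally show ?thesis .
  qed
  have "measure (disorder n) ?Ev = measure P ?Ev'"
  proof -
    \<comment> \<open>The event involves only the couplings, and the disorder is the marginal of the
      enlarged Gaussian space.\<close>
    have D: "disorder n = distr P (disorder n) (\<lambda>g. restrict g (pairs n))"
      unfolding disorder_def J_def
      by (rule product_prob_space.distr_restrict[OF product_prob_space_std_gauss]) (use fin J_def in auto)
    have mr: "(\<lambda>g. restrict g (pairs n)) \<in> P \<rightarrow>\<^sub>M disorder n"
      unfolding disorder_def J_def by (rule measurable_restrict_subset) auto
    have qr: "quad n (restrict g (pairs n)) u = quad n g u" for g u
      unfolding quad_eq_pairs by (intro sum.cong refl) simp
    have "measure (disorder n) ?Ev = measure (distr P (disorder n) (\<lambda>g. restrict g (pairs n))) ?Ev"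
      using D by simp
    also have "\<dots> = measure P ((\<lambda>g. restrict g (pairs n)) -` ?Ev \<inter> space P)"
      by (rule measure_distr[OF mr Ev])
    also have "(\<lambda>g. restrict g (pairs n)) -` ?Ev \<inter> space P = ?Ev'"
      using measurable_space[OF mr] by (auto simp: qr)
    finally show ?thesis .
  qed
  also have "measure P ?Ev' = (LINT g|P. indicator ?Ev' g)"
    using Ev' by (simp add: Int_absorb2 sets.sets_into_space)
  \<comment> \<open>On the event a single summand of \<open>Z 0 g\<close> exceeds
    \<open>exp (\<tau> * (2 + \<delta>))\<close>; raising to the power \<open>q\<close> turns \<tau>
    into \<open>l\<close>.\<close>
  also have "\<dots> \<le> (LINT g|P. exp (- (l * (2 + \<delta>))) * Z 0 g powr q)"
  proof (rule integral_mono)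
    show "integrable P (\<lambda>g. indicator ?Ev' g :: real)"
      using Ev' by (intro integrable_real_indicator) (auto simp: P.emeasure_eq_measure)
    show "integrable P (\<lambda>g. exp (- (l * (2 + \<delta>))) * Z 0 g powr q)"
      by (intro integrable_mult_right integrable_Z_powr)
    fix g
    show "indicator ?Ev' g \<le> exp (- (l * (2 + \<delta>))) * Z 0 g powr q"
    proof (cases "g \<in> ?Ev'")
      case True
      then obtain u where u: "u \<in> N" "quad n g u > 2 + \<delta>" by auto
      have "exp (\<tau> * (2 + \<delta>)) \<le> ex 0 g u" unfolding ex_def U0 using u \<tau> by simp
      also have "\<dots> \<le> Z 0 g" by (rule ex_le_Z[OF u(1)])
      finally have "exp (\<tau> * (2 + \<delta>)) powr q \<le> Z 0 g powr q" using q by (intro powr_mono2) auto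
      moreover have "exp (\<tau> * (2 + \<delta>)) powr q = exp (l * (2 + \<delta>))"
        by (simp add: powr_def tq[symmetric] mult_ac)
      ultimately have "exp (- (l * (2 + \<delta>))) * exp (l * (2 + \<delta>)) \<le> exp (- (l * (2 + \<delta>))) * Z 0 g powr q"
        by (intro mult_left_mono) auto
      then show ?thesis using True by (simp add: exp_add[symmetric])
    qed (use Z_pos in simp)
  qed
  also have "\<dots> = exp (- (l * (2 + \<delta>))) * (LINT g|P. Z 0 g powr q)" by simp
  also have "\<dots> \<le> exp (- (l * (2 + \<delta>))) * (real (card N) powr q * exp l * exp (n * (\<kappa> + 4 * \<kappa>\<^sup>2)))"
    using mono EZ by (intro mult_left_mono) auto
  also have "\<dots> = real (card N) powr q * exp (- (l * (2 + \<delta>)) + (l + n * (\<kappa> + 4 * \<kappa>\<^sup>2)))"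
    unfolding exp_add by (simp only: mult_ac)
  also have "- (l * (2 + \<delta>)) + (l + n * (\<kappa> + 4 * \<kappa>\<^sup>2)) = - (n * \<delta>\<^sup>2 / 16)"
    unfolding l_def \<kappa>_def by (simp add: power2_eq_square algebra_simps)
  finally show ?thesis .
qed

text \<open>Let \<open>q = 1 / (k + 2)\<close> tend to 0: the factor \<open>card N powr q\<close>
  tends to 1 and the bound becomes independent of the finite set.\<close>

lemma prob_quad_gt:
  assumes n: "n \<ge> 1" and \<delta>: "0 < \<delta>" "\<delta> \<le> 1"
    and N: "finite N" "N \<noteq> {}" and unit: "\<And>u. u \<in> N \<Longrightarrow> (\<Sum>i=1..n. (u i)\<^sup>2) = 1"
  shows "measure (disorder n) {g \<in> space (disorder n). \<exists>u\<in>N. quad n g u > 2 + \<delta>} \<le> exp (- (n * \<delta>\<^sup>2 / 16))"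
proof -
  have c: "real (card N) \<noteq> 0" using N by simp
  have "(\<lambda>k. real (card N) powr (1 / real (k + 2)) * exp (- (n * \<delta>\<^sup>2 / 16)))
      \<longlonglongrightarrow> real (card N) powr 0 * exp (- (n * \<delta>\<^sup>2 / 16))"
  proof (intro tendsto_mult tendsto_powr tendsto_const c)
    show "(\<lambda>k. 1 / real (k + 2)) \<longlonglongrightarrow> 0" by real_asymp
  qed
  moreover have "measure (disorder n) {g \<in> space (disorder n). \<exists>u\<in>N. quad n g u > 2 + \<delta>}
      \<le> real (card N) powr (1 / real (k + 2)) * exp (- (n * \<delta>\<^sup>2 / 16))" for k
    by (rule prob_quad_gt_powr[OF n \<delta> N unit]) auto
  ultimately show ?thesis using c by (intro LIMSEQ_le_const) auto
qed

text \<open>As the bound is uniform over finite sets of directions, it survives the increasing union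
  along an enumeration of normalised rational vectors. Continuity of the quadratic form extends it
  to all vectors, in place of a net argument.\<close>

lemma quad_bound_event:
  assumes n: "n \<ge> 1" and \<delta>: "0 < \<delta>" "\<delta> \<le> 1"
  obtains B where "B \<in> sets (disorder n)" "measure (disorder n) B \<le> exp (- (n * \<delta>\<^sup>2 / 16))"
    "\<And>g x. g \<in> space (disorder n) - B \<Longrightarrow> quad n g x \<le> (2 + \<delta>) * (\<Sum>i=1..n. (x i)\<^sup>2)"
proof -
  interpret prob_space "disorder n" by (rule prob_space_disorder)
  let ?s = "\<lambda>x :: nat \<Rightarrow> real. \<Sum>i=1..n. (x i)\<^sup>2"
  define D where "D = {x \<in> rat_vectors n. ?s x > 0}"
  have cD: "countable D" unfolding D_def using countable_rat_vectors by simp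
  have "(\<lambda>i\<in>{1..n}. 1) \<in> D" using n by (simp add: D_def rat_vectors_def)
  then have Dne: "D \<noteq> {}" by blast
  define r where "r = from_nat_into D"
  have rD: "r k \<in> D" for k unfolding r_def by (rule from_nat_into[OF Dne])
  have rsurj: "\<exists>k. r k = x" if "x \<in> D" for x
    using from_nat_into_surj[OF cD that] by (auto simp: r_def)
  define u where "u k = (\<lambda>i. (1 / sqrt (?s (r k))) * r k i)" for k
  have pos: "?s (r k) > 0" for k using rD[of k] by (simp add: D_def)
  have unit: "?s (u k) = 1" for k
    using pos[of k] unfolding u_def by (simp add: power_mult_distrib power_divide sum_divide_distrib[symmetric])
  have qu: "quad n g (u k) > 2 + \<delta> \<longleftrightarrow> quad n g (r k) > (2 + \<delta>) * ?s (r k)" for g k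
    unfolding u_def quad_scale using pos[of k] by (simp add: power_divide less_divide_eq mult.commute)
  define Bk where "Bk k = {g \<in> space (disorder n). \<exists>v\<in>u ` {..k}. quad n g v > 2 + \<delta>}" for k
  have Bk: "Bk k \<in> sets (disorder n)" for k
  proof -
    note measurable_quad [measurable]
    have "Bk k = (\<Union>v\<in>u ` {..k}. {g \<in> space (disorder n). quad n g v > 2 + \<delta>})" by (auto simp: Bk_def)
    also have "\<dots> \<in> sets (disorder n)" by (intro sets.finite_UN finite_imageI finite_atMost) measurable
    finally show ?thesis .
  qed
  have "(\<lambda>k. measure (disorder n) (Bk k)) \<longlonglongrightarrow> measure (disorder n) (\<Union>k. Bk k)"
  proof (rule finite_Lim_measure_incseq)
    show "range Bk \<subseteq> sets (disorder n)" using Bk by auto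
    show "incseq Bk"
    proof (rule incseq_SucI)
      show "Bk k \<subseteq> Bk (Suc k)" for k unfolding Bk_def by (auto simp: atMost_Suc)
    qed
  qed
  moreover have "measure (disorder n) (Bk k) \<le> exp (- (n * \<delta>\<^sup>2 / 16))" for k
    unfolding Bk_def by (rule prob_quad_gt[OF n \<delta>]) (use unit in auto)
  ultimately have le: "measure (disorder n) (\<Union>k. Bk k) \<le> exp (- (n * \<delta>\<^sup>2 / 16))"
    by (intro LIMSEQ_le_const2) auto
  show ?thesis
  proof (rule that[OF _ le])
    show "(\<Union>k. Bk k) \<in> sets (disorder n)" using Bk by auto
    fix g x assume g: "g \<in> space (disorder n) - (\<Union>k. Bk k)"
    have rat: "quad n g y \<le> (2 + \<delta>) * ?s y" if y: "y \<in> rat_vectors n" for y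
    proof (cases "?s y > 0")
      case True
      then obtain k where k: "r k = y" using rsurj[of y] y by (auto simp: D_def)
      have "g \<notin> Bk k" using g by blast
      then have "\<not> quad n g (u k) > 2 + \<delta>" using g unfolding Bk_def by blast
      then show ?thesis unfolding qu k by simp
    next
      case False
      moreover have "?s y \<ge> 0" by (intro sum_nonneg) simp
      ultimately have s0: "?s y = 0" by linarith
      have "y i = 0" if "i \<in> {1..n}" for i
      proof -
        have "(y i)\<^sup>2 \<le> ?s y" using that by (intro member_le_sum) auto
        then show ?thesis using s0 by simp
      qed
      then have "quad n g y = (\<Sum>i=1..n. \<Sum>j=1..n. 0)"
        unfolding quad_def by (intro sum.cong refl) simp
      then show ?thesis unfolding s0 by simp
    qed
    obtain y where y: "\<And>k. y k \<in> rat_vectors n" "\<And>i. i \<in> {1..n} \<Longrightarrow> (\<lambda>k. y k i) \<longlonglongrightarrow> x i"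
      using rat_vectors_dense[of n x] by blast
    have "(\<lambda>k. quad n g (y k)) \<longlonglongrightarrow> quad n g x"
      unfolding quad_def by (intro tendsto_intros y)
    moreover have "(\<lambda>k. (2 + \<delta>) * ?s (y k)) \<longlonglongrightarrow> (2 + \<delta>) * ?s x"
      by (intro tendsto_intros y)
    ultimately show "quad n g x \<le> (2 + \<delta>) * ?s x"
      by (rule LIMSEQ_le) (use rat y(1) in blast)
  qed
qed

text \<open>Off the exceptional event the point \<open>z\<close> lies to the right of the spectrum
  at distance at least \<open>Re z - L\<close>; on it the bound \<open>1 / \<eta>\<close> is paid
  with the small probability.\<close>

lemma (in sk_resolvent) ES_upper:
  assumes B: "B \<in> sets (disorder n)"
    and form: "\<And>g x. g \<in> space (disorder n) - B \<Longrightarrow> quad n g x \<le> L * (\<Sum>i=1..n. (x i)\<^sup>2)" and L: "L < Re z"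
  shows "norm (E S) \<le> 1 / (Re z - L) + measure (disorder n) B / \<eta>"
proof -
  interpret prob_space "disorder n" by (rule prob_space_disorder)
  have good: "norm (S g) \<le> 1 / (Re z - L)" if g: "g \<in> space (disorder n) - B" for g
  proof -
    have "norm (\<Sum>j\<in>I. \<Sum>k\<in>I. Q g j k * of_real (M g k j)) \<le> n / (Re z - L)"
    proof (rule norm_cov_sum_le)
      fix \<sigma> assume \<sigma>: "\<sigma> \<in> spins n"
      let ?v = "\<lambda>j. complex_of_real (\<sigma> j)"
      have "(\<Sum>j\<in>I. \<Sum>k\<in>I. Q g j k * of_real (\<sigma> k * \<sigma> j)) = (\<Sum>j\<in>I. ?v j * (\<Sum>k\<in>I. Q g j k * ?v k))"
        unfolding sum_distrib_left by (intro sum.cong refl) simp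
      then have "norm (\<Sum>j\<in>I. \<Sum>k\<in>I. Q g j k * of_real (\<sigma> k * \<sigma> j))
          \<le> L2_set (\<lambda>j. norm (?v j)) I * L2_set (\<lambda>j. norm (\<Sum>k\<in>I. Q g j k * ?v k)) I"
        using cmod_sum_mult_le_L2_set by (simp only:)
      also have "\<dots> \<le> L2_set (\<lambda>j. norm (?v j)) I * (L2_set (\<lambda>j. norm (?v j)) I / (Re z - L))"
        unfolding Q_def
        by (intro mult_left_mono R.Q_bound_form L L2_set_nonneg) (use form[OF g] in \<open>simp add: quad_def\<close>)
      also have "\<dots> = n / (Re z - L)"
        unfolding L2_set_of_real spin_L2[OF \<sigma>] by simp
      finally show "norm (\<Sum>j\<in>I. \<Sum>k\<in>I. Q g j k * of_real (\<sigma> k * \<sigma> j)) \<le> n / (Re z - L)" .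
    qed
    then have "norm (\<Sum>j\<in>I. \<Sum>k\<in>I. Q g j k * of_real (M g k j)) / n \<le> n / (Re z - L) / n"
      by (rule divide_right_mono) simp
    then show ?thesis using n by (simp add: S_def norm_divide)
  qed
  have r: "0 \<le> 1 / (Re z - L)" using L by simp
  have iB: "integrable (disorder n) (\<lambda>g. indicator B g / \<eta> :: real)"
    using B by (intro integrable_divide integrable_real_indicator) (auto simp: emeasure_eq_measure)
  have "norm (E S) \<le> E (\<lambda>g. norm (S g))" by (rule integral_norm_bound)
  also have "\<dots> \<le> E (\<lambda>g. 1 / (Re z - L) + indicator B g / \<eta>)"
  proof (rule integral_mono)
    fix g assume g: "g \<in> space (disorder n)"
    show "norm (S g) \<le> 1 / (Re z - L) + indicator B g / \<eta>"
    proof (cases "g \<in> B")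
      case True
      then show ?thesis using add_increasing[OF r S_bound[of g]] by simp
    next
      case False
      then show ?thesis using good[of g] g by simp
    qed
  qed (use int_S iB in auto)
  also have "\<dots> = 1 / (Re z - L) + measure (disorder n) B / \<eta>"
    using iB B by (simp add: prob_space Int_absorb2 sets.sets_into_space)
  finally show ?thesis .
qed

text \<open>The mean of \<open>S\<close> is at most \<open>K\<close>, while its prefactor
  \<open>z - w - \<beta>\<close> is at most \<open>C * \<eta>\<close>. With \<eta> fixed so that the
  product is below \<open>1 / 4\<close>, the equation can hold only if the overlap term is of order
  1.\<close>

lemma overlap_supercritical:
  assumes \<beta>: "\<beta> > 1"
  shows "\<exists>c>0. \<forall>n\<ge>1. overlap_sq n \<beta> \<ge> c"
proof -
  define x where "x = \<beta> + 1 / \<beta>"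
  have "x - 2 = (\<beta> - 1)\<^sup>2 / \<beta>" using \<beta> by (simp add: x_def field_simps power2_eq_square)
  also have "\<dots> > 0" using \<beta> by simp
  finally have x: "x - 2 > 0" .
  define \<delta> where "\<delta> = min 1 ((x - 2) / 2)"
  have \<delta>: "0 < \<delta>" "\<delta> \<le> 1" using x by (simp_all add: \<delta>_def)
  have "\<delta> \<le> (x - 2) / 2" unfolding \<delta>_def by (rule min.cobounded2)
  also have "\<dots> < x - 2" using x by simp
  finally have Lx: "2 + \<delta> < x" by (simp add: less_diff_eq add.commute)
  \<comment> \<open>The summand 1 is room for the exceptional event: its probability is eventually
    below \<eta>, so it contributes at most 1.\<close>
  define K where "K = 1 / (x - (2 + \<delta>)) + 1"
  define C where "C = 1 + 2 / (\<beta> - 1)"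
  have K: "K > 0" using Lx by (simp add: K_def add_pos_pos)
  have C: "C > 0" using \<beta> by (simp add: C_def add_pos_pos)
  define \<eta> where "\<eta> = min 1 (1 / (4 * C * K))"
  have \<eta>: "0 < \<eta>" "\<eta> \<le> 1" using C K by (simp_all add: \<eta>_def)
  have "K * (C * \<eta>) \<le> K * (C * (1 / (4 * C * K)))"
    using C K by (intro mult_left_mono) (auto simp: \<eta>_def)
  also have "\<dots> = 1 / 4" using C K by simp
  finally have small: "K * (C * \<eta>) \<le> 1 / 4" .
  have ev: "\<forall>\<^sub>F n in sequentially. 4 / (real n * \<eta>)\<^sup>2 + 2 / (real n * \<eta>) \<le> \<eta> \<and>
      5 / (real n * \<eta>\<^sup>2) \<le> 1 / 4 \<and> exp (- (real n * \<delta>\<^sup>2 / 16)) \<le> \<eta>"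
  proof -
    have inv: "(\<lambda>n. 1 / real n) \<longlonglongrightarrow> 0" by real_asymp
    have "(\<lambda>n. 4 / \<eta>\<^sup>2 * (1 / real n)\<^sup>2 + 2 / \<eta> * (1 / real n)) \<longlonglongrightarrow> 4 / \<eta>\<^sup>2 * 0\<^sup>2 + 2 / \<eta> * 0"
      by (intro tendsto_intros inv)
    then have "(\<lambda>n. 4 / (real n * \<eta>)\<^sup>2 + 2 / (real n * \<eta>)) \<longlonglongrightarrow> 0"
      by (simp add: power_mult_distrib power_divide mult.commute)
    from order_tendstoD(2)[OF this \<eta>(1)]
    have e1: "\<forall>\<^sub>F n in sequentially. 4 / (real n * \<eta>)\<^sup>2 + 2 / (real n * \<eta>) < \<eta>" .
    have "(\<lambda>n. 5 / \<eta>\<^sup>2 * (1 / real n)) \<longlonglongrightarrow> 5 / \<eta>\<^sup>2 * 0"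
      by (intro tendsto_intros inv)
    then have "(\<lambda>n. 5 / (real n * \<eta>\<^sup>2)) \<longlonglongrightarrow> 0" by (simp add: mult.commute)
    from order_tendstoD(2)[OF this, of "1 / 4"]
    have e2: "\<forall>\<^sub>F n in sequentially. 5 / (real n * \<eta>\<^sup>2) < 1 / 4" by simp
    have "(\<lambda>n. exp (- (\<delta>\<^sup>2 / 16)) ^ n) \<longlonglongrightarrow> 0"
      by (rule LIMSEQ_realpow_zero) (use \<delta> in auto)
    then have "(\<lambda>n. exp (- (real n * \<delta>\<^sup>2 / 16))) \<longlonglongrightarrow> 0" by (simp add: exp_of_nat_mult[symmetric])
    from order_tendstoD(2)[OF this \<eta>(1)]
    have e3: "\<forall>\<^sub>F n in sequentially. exp (- (real n * \<delta>\<^sup>2 / 16)) < \<eta>" .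
    show ?thesis using e1 e2 e3 by eventually_elim simp
  qed
  then obtain n0 where n0: "\<And>n. n \<ge> n0 \<Longrightarrow> 4 / (real n * \<eta>)\<^sup>2 + 2 / (real n * \<eta>) \<le> \<eta> \<and>
      5 / (real n * \<eta>\<^sup>2) \<le> 1 / 4 \<and> exp (- (real n * \<delta>\<^sup>2 / 16)) \<le> \<eta>"
    by (auto simp: eventually_sequentially)
  have large: "overlap_sq n \<beta> \<ge> \<eta> / (2 * \<beta>)" if n_ge: "n \<ge> n0" "n \<ge> 1" for n
  proof -
    interpret sk_resolvent n \<beta> "Complex x \<eta>"
      using n_ge \<eta> by unfold_locales simp_all
    note h = n0[OF n_ge(1)]
    note f = w_near_fixed_point[unfolded complex.sel, OF \<eta>(2) conjunct1[OF h]]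
    obtain B where B: "B \<in> sets (disorder n)" "measure (disorder n) B \<le> exp (- (n * \<delta>\<^sup>2 / 16))"
      "\<And>g x. g \<in> space (disorder n) - B \<Longrightarrow> quad n g x \<le> (2 + \<delta>) * (\<Sum>i=1..n. (x i)\<^sup>2)"
      using quad_bound_event[OF n_ge(2) \<delta>] by blast
    have "norm (E S) \<le> 1 / (x - (2 + \<delta>)) + measure (disorder n) B / \<eta>"
      using ES_upper[OF B(1,3)] Lx by simp
    also have "measure (disorder n) B / \<eta> \<le> 1"
      using B(2) h \<eta> by (simp add: divide_le_eq)
    finally have S: "norm (E S) \<le> K" by (simp add: K_def)
    have c: "Complex x \<eta> = of_real x + \<i> * \<eta>" by (simp add: complex_eq_iff)
    have "(w - \<beta>) * (w - 1 / \<beta>) = (w\<^sup>2 - Complex x \<eta> * w + 1) + \<i> * \<eta> * w"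
    proof -
      have "of_real \<beta> * (1 / of_real \<beta>) = (1 :: complex)" using \<beta> by simp
      then show ?thesis unfolding c by (simp add: x_def algebra_simps power2_eq_square)
    qed
    then have "norm (w - \<beta>) * norm (w - 1 / \<beta>) = norm ((w\<^sup>2 - Complex x \<eta> * w + 1) + \<i> * \<eta> * w)"
      unfolding norm_mult[symmetric] by (rule arg_cong)
    also have "\<dots> \<le> norm (w\<^sup>2 - Complex x \<eta> * w + 1) + norm (\<i> * \<eta> * w)" by (rule norm_triangle_ineq)
    also have "norm (w\<^sup>2 - Complex x \<eta> * w + 1) \<le> \<eta>" using f(3) h by linarith
    also have "norm (\<i> * \<eta> * w) \<le> \<eta>" using f(2) \<eta> by (simp add: norm_mult mult_left_le)
    finally have p: "norm (w - \<beta>) * norm (w - 1 / \<beta>) \<le> 2 * \<eta>" by simp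
    \<comment> \<open>For \<beta> > 1 the roles of the roots are exchanged: now \<beta> lies outside
      the unit disc and \<open>w\<close> is near \<open>1 / \<beta>\<close>, so that
      \<open>z - w - \<beta>\<close> nearly vanishes.\<close>
    have "\<beta> - 1 \<le> norm (w - \<beta>)"
      using norm_triangle_ineq2[of "complex_of_real \<beta>" w] f(2) \<beta> by (simp add: norm_minus_commute)
    then have "(\<beta> - 1) * norm (w - 1 / \<beta>) \<le> norm (w - \<beta>) * norm (w - 1 / \<beta>)"
      by (intro mult_right_mono) auto
    with p have "norm (w - 1 / \<beta>) \<le> 2 * \<eta> / (\<beta> - 1)" using \<beta> by (simp add: pos_le_divide_eq mult.commute)
    then have "norm (Complex x \<eta> - w - \<beta>) \<le> \<eta> + 2 * \<eta> / (\<beta> - 1)"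
    proof -
      assume b: "norm (w - 1 / \<beta>) \<le> 2 * \<eta> / (\<beta> - 1)"
      have "Complex x \<eta> - w - \<beta> = \<i> * \<eta> - (w - 1 / \<beta>)" unfolding c by (simp add: x_def)
      then have "norm (Complex x \<eta> - w - \<beta>) \<le> norm (\<i> * complex_of_real \<eta>) + norm (w - 1 / \<beta>)"
        by (simp only: norm_triangle_ineq4)
      then show ?thesis using b \<eta> by (simp add: norm_mult)
    qed
    also have "\<dots> = C * \<eta>" by (simp add: C_def distrib_right)
    finally have y: "norm (Complex x \<eta> - w - \<beta>) \<le> C * \<eta>" .
    have "1 - (5 / (n * \<eta>\<^sup>2) + \<beta> * \<nu> / \<eta>) \<le> norm (E S) * norm (Complex x \<eta> - w - \<beta>)"
      using ES_lower[unfolded complex.sel, OF f(1)] \<beta> by simp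
    also have "\<dots> \<le> K * (C * \<eta>)" using S y K by (intro mult_mono) auto
    also have "\<dots> \<le> 1 / 4" by (rule small)
    \<comment> \<open>Of the 1 in the equation, one quarter goes to the error
      \<open>5 / (n * \<eta>\<^sup>2)\<close> and at most one quarter to the product; the overlap
      has to supply the rest.\<close>
    finally have "1 / 2 \<le> \<beta> * \<nu> / \<eta>" using h by linarith
    then show ?thesis unfolding \<nu>_eq using \<eta> \<beta> by (simp add: field_simps)
  qed
  \<comment> \<open>The second entry handles the finitely many \<open>n\<close> below
    \<open>n0\<close>, where \<open>overlap_sq n \<beta> \<ge> 1 / n\<close> is used.\<close>
  define c where "c = min (\<eta> / (2 * \<beta>)) (1 / (real n0 + 1))"
  have "c > 0" using \<eta> \<beta> by (simp add: c_def)
  moreover have "overlap_sq n \<beta> \<ge> c" if n: "n \<ge> 1" for n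
  proof (cases "n \<ge> n0")
    case True
    then show ?thesis using large[OF True n] by (simp add: c_def min.coboundedI1)
  next
    case False
    have "1 / n \<le> overlap_sq n \<beta>" using overlap_sq_ge[OF n, of \<beta>] n by (simp add: divide_le_eq mult.commute)
    moreover have "1 / (real n0 + 1) \<le> 1 / n" using False n by (intro divide_left_mono) auto
    ultimately show ?thesis by (simp add: c_def min.coboundedI2)
  qed
  ultimately show ?thesis by blast
qed

text \<open>The constant \<open>c0\<close> extends the bound of order \<open>n powr (3 / 16)\<close>
  to small \<open>n\<close>, where \<open>n * overlap_sq n 1 \<ge> 1\<close>. The passage to the
  form with the logarithm uses \<open>ln n \<ge> ln 2\<close> and costs the factor
  \<open>d\<close>.\<close>

lemma overlap_critical_all:
  "\<exists>c>0. \<forall>n\<ge>2. c * (real n / ln (real n)) powr (3 / 16) \<le> n * overlap_sq n 1"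
proof -
  have "(\<lambda>n. 5 / (real n * (real n powr (- 3 / 8))\<^sup>2)) \<longlonglongrightarrow> 0" by real_asymp
  from order_tendstoD(2)[OF this, of "1 / 4"]
  have "\<forall>\<^sub>F n in sequentially. 5 / (real n * (mesh n)\<^sup>2) < 1 / 4" by (simp add: mesh_def)
  with eventually_mesh have "\<forall>\<^sub>F n in sequentially. 0 < mesh n \<and> mesh n \<le> 1 \<and>
      4 / (real n * mesh n)\<^sup>2 + 2 / (real n * mesh n) \<le> mesh n \<and> 5 / (real n * (mesh n)\<^sup>2) \<le> 1 / 4"
    by eventually_elim simp
  then obtain n0 where n0: "\<And>n. n \<ge> n0 \<Longrightarrow> 0 < mesh n \<and> mesh n \<le> 1 \<and>
      4 / (real n * mesh n)\<^sup>2 + 2 / (real n * mesh n) \<le> mesh n \<and> 5 / (real n * (mesh n)\<^sup>2) \<le> 1 / 4"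
    by (auto simp: eventually_sequentially)
  define c0 where "c0 = min (1 / 40) (1 / (real n0 + 1) powr (3 / 16))"
  have c0: "c0 > 0" by (simp add: c0_def)
  have b: "c0 * real n powr (3 / 16) \<le> n * overlap_sq n 1" if n: "n \<ge> 1" for n
  proof (cases "n \<ge> n0")
    case True
    have "c0 * real n powr (3 / 16) \<le> 1 / 40 * real n powr (3 / 16)"
      by (intro mult_right_mono) (auto simp: c0_def)
    also have "\<dots> \<le> n * overlap_sq n 1"
      using n0[OF True] by (intro overlap_critical n) auto
    finally show ?thesis .
  next
    case False
    have "c0 * real n powr (3 / 16) \<le> 1 / (real n0 + 1) powr (3 / 16) * (real n0 + 1) powr (3 / 16)"
      using False by (intro mult_mono powr_mono2) (auto simp: c0_def)
    also have "\<dots> = 1" by simp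
    also have "\<dots> \<le> n * overlap_sq n 1" by (rule overlap_sq_ge[OF n])
    finally show ?thesis .
  qed
  define d where "d = (1 / ln 2 :: real) powr (3 / 16)"
  have d: "d > 0" by (simp add: d_def)
  have "c0 / d * (real n / ln (real n)) powr (3 / 16) \<le> n * overlap_sq n 1" if n: "n \<ge> 2" for n :: nat
  proof -
    have "real n / ln n \<le> real n / ln 2" using n by (intro divide_left_mono) auto
    then have "(real n / ln n) powr (3 / 16) \<le> (1 / ln 2 * real n) powr (3 / 16)"
      using n by (intro powr_mono2) auto
    also have "\<dots> = d * real n powr (3 / 16)" unfolding d_def by (rule powr_mult)
    finally have "c0 / d * (real n / ln (real n)) powr (3 / 16) \<le> c0 / d * (d * real n powr (3 / 16))"
      using c0 d by (intro mult_left_mono) auto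
    also have "\<dots> = c0 * real n powr (3 / 16)" using d by simp
    also have "\<dots> \<le> n * overlap_sq n 1" using n by (intro b) auto
    finally show ?thesis .
  qed
  then show ?thesis using c0 d by (intro exI[of _ "c0 / d"]) auto
qed

theorem theorem1p2:
  shows "(\<forall>\<beta>::real. 0 \<le> \<beta> \<and> \<beta> < 1 \<longrightarrow>
            liminf (\<lambda>n. ereal (LINT g|disorder n. op_norm n (cov n \<beta> g)))
              \<ge> ereal (1 / (1 - \<beta>\<^sup>2))) \<and>
         (\<exists>c::real. c > 0 \<and> (\<forall>n::nat. n \<ge> 2 \<longrightarrow>
            (LINT g|disorder n. op_norm n (cov n 1 g))
              \<ge> c * (real n / ln (real n)) powr (3 / 16))) \<and>
         (\<forall>\<beta>::real. \<beta> > 1 \<longrightarrow> (\<exists>c::real. c > 0 \<and> (\<forall>n::nat. n \<ge> 1 \<longrightarrow>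
            (LINT g|disorder n. op_norm n (cov n \<beta> g)) \<ge> c * real n)))"
proof (intro conjI allI impI)
  fix \<beta> :: real assume \<beta>: "0 \<le> \<beta> \<and> \<beta> < 1"
  have "\<forall>\<^sub>F n in sequentially. ereal (n * overlap_sq n \<beta>) \<le> ereal (LINT g|disorder n. op_norm n (cov n \<beta> g))"
    using eventually_ge_at_top[of 1] by eventually_elim (simp add: overlap_sq_le_op_norm)
  then have "liminf (\<lambda>n. ereal (n * overlap_sq n \<beta>)) \<le> liminf (\<lambda>n. ereal (LINT g|disorder n. op_norm n (cov n \<beta> g)))"
    by (rule Liminf_mono)
  with liminf_overlap_subcritical[of \<beta>] \<beta>
  show "ereal (1 / (1 - \<beta>\<^sup>2)) \<le> liminf (\<lambda>n. ereal (LINT g|disorder n. op_norm n (cov n \<beta> g)))"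
    by (auto intro: order_trans)
next
  obtain c where c: "c > 0" "\<And>n. n \<ge> 2 \<Longrightarrow> c * (real n / ln (real n)) powr (3 / 16) \<le> n * overlap_sq n 1"
    using overlap_critical_all by blast
  have "c * (real n / ln (real n)) powr (3 / 16) \<le> (LINT g|disorder n. op_norm n (cov n 1 g))" if "n \<ge> 2" for n
    using order_trans[OF c(2)[OF that] overlap_sq_le_op_norm] that by simp
  then show "\<exists>c::real. c > 0 \<and> (\<forall>n::nat. n \<ge> 2 \<longrightarrow>
      (LINT g|disorder n. op_norm n (cov n 1 g)) \<ge> c * (real n / ln (real n)) powr (3 / 16))"
    using c(1) by blast
next
  fix \<beta> :: real assume "\<beta> > 1"
  then obtain c where c: "c > 0" "\<And>n. n \<ge> 1 \<Longrightarrow> overlap_sq n \<beta> \<ge> c"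
    using overlap_supercritical by blast
  have "c * real n \<le> (LINT g|disorder n. op_norm n (cov n \<beta> g))" if "n \<ge> 1" for n
  proof -
    have "c * n \<le> n * overlap_sq n \<beta>" using mult_left_mono[OF c(2)[OF that], of "real n"] by (simp add: mult.commute)
    then show ?thesis using overlap_sq_le_op_norm[OF that, of \<beta>] by linarith
  qed
  then show "\<exists>c::real. c > 0 \<and> (\<forall>n::nat. n \<ge> 1 \<longrightarrow>
      (LINT g|disorder n. op_norm n (cov n \<beta> g)) \<ge> c * real n)"
    using c(1) by blast
qed

end
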